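(* Let $f:\mathbb{T}\to\mathbb{R}$ be time-series data and let $\Psi_f$ be its ($N$-truncated) Liouville torus. Each bar in the $n$-dimensional barcode $\mathsf{bcd}_n^{\mathcal R}(\Psi_f)$ represents the bar of the projected point cloud onto $P_{i_1}\oplus\cdots\oplus P_{i_k}$, where $k=1,\dots,n$ and $\sum_{L=1}^k n_{i_L}=n$ with each $n_{i_L}$ a positive integer. That is, $$\mathsf{bcd}_n^{\mathcal R}(\Psi_f)=\bigcup_{1\le i_1<\cdots<i_k\le N}\ \bigcup_{1\le k\le n}\mathsf{bcd}_n^{\mathcal R}\left(\pi_{i_1\cdots i_k}\Psi_f\right).$$
   Context: For a metric space $(X,d)$ and $\epsilon\in\mathbb{R}$, the Vietoris–Rips complex $\mathcal R_\epsilon(X)$ is the simplicial complex of finite subsets $\{x_0,\dots,x_m\}\subset X$ with $\max_{i,j}d(x_i,x_j)<\epsilon$. The $n$-dimensional barcode $\mathsf{bcd}_n^{\mathcal R}(X)$ of the filtration $\{\mathcal R_\epsilon(X)\}_{\epsilon\in\mathbb{R}}$ is the multiset of intervals $(b,d]$, called bars, each representing an $n$-dimensional homology class (field coefficients) born at $\epsilon=b$ and dying at $\epsilon=d$ (with $(b,\infty)$ for a class that never dies). $\mathbb{T}=\mathbb{R}/2\pi\mathbb{Z}$; $\hat f(L)$ is the $L$th Fourier coefficient of $f$ and $r_L^f=2|\hat f(L)|$. The ($N$-truncated) Liouville torus $\Psi_f$ of $f$ is the Liouville torus of the Hamiltonian $H(\mathbf q,\mathbf p)=\sum_{L=1}^N\frac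 L2(p_L^2+q_L^2)$ on which, for each $L$, the action $I_L=\frac{p_L^2+q_L^2}{2}$ equals $\frac{(r_L^f)^2}{2}$; it is identified with the product of circles $r_1^f\cdot\mathbb{S}^1\times\cdots\times r_N^f\cdot\mathbb{S}^1$, where $\mathbb{S}^1$ is the unit circle with the Euclidean metric. Let $M=2N$, $\tau=\frac{2\pi}{M+1}$, $u_L=(1,\cos(L\tau),\dots,\cos(LM\tau))$, $v_L=(0,\sin(L\tau),\dots,\sin(LM\tau))$, and $P_L=\mathrm{span}\{u_L,v_L\}\subset\mathbb{R}^{M+1}$ for $L=1,\dots,N$. The torus $\Psi_f$ is regarded as lying in $P_1\oplus\cdots\oplus P_N$, its $L$th factor being the circle of radius $r_L^f$ centered at the origin of $P_L$. The direct sums carry the maximum metric (the maximum over the planes of the Euclidean distances of the components). $\pi_{i_1\cdots i_k}$ is the projection onto $P_{i_1}\oplus\cdots\oplus P_{i_k}$, keeping the components in $P_{i_1},\dots,P_{i_k}$ and dropping the others. *)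

theory Defs
  imports "HOL-Analysis.Analysis"
begin

section \<open>Homology of a simplicial complex with field coefficients\<close>

text \<open>
  A simplicial complex is the set of its (nonempty, finite) simplices. Homology is that of the
  ordered chain complex: the generators in degree \<open>n\<close> are the \<open>(n+1)\<close>-tuples of vertices, with
  repetitions allowed, whose entries span a simplex. A chain is the finitely supported function of
  its coefficients. The homology is not reduced: the boundary of a 0-chain is 0.
\<close>

definition chains :: "nat \<Rightarrow> 'a set set \<Rightarrow> ('a list \<Rightarrow> 'k::field) set" where
  "chains n K = {c. finite {s. c s \<noteq> 0} \<and> (\<forall>s. c s \<noteq> 0 \<longrightarrow> length s = Suc n \<and> set s \<in> K)}"

definition face :: "nat \<Rightarrow> 'a list \<Rightarrow> 'a list" where
  "face i s = take i s @ drop (Suc i) s"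

definition boundary :: "nat \<Rightarrow> ('a list \<Rightarrow> 'k::field) \<Rightarrow> 'a list \<Rightarrow> 'k" where
  "boundary n c t =
     (if n = 0 then 0
      else \<Sum>s | c s \<noteq> 0. \<Sum>i\<le>n. if face i s = t then (-1) ^ i * c s else 0)"

definition cycles :: "nat \<Rightarrow> 'a set set \<Rightarrow> ('a list \<Rightarrow> 'k::field) set" where
  "cycles n K = {c \<in> chains n K. boundary n c = (\<lambda>_. 0)}"

definition boundaries :: "nat \<Rightarrow> 'a set set \<Rightarrow> ('a list \<Rightarrow> 'k::field) set" where
  "boundaries n K = boundary (Suc n) ` chains (Suc n) K"

text \<open>Equality of homology classes in \<open>H\<^sub>n(K) = cycles n K / boundaries n K\<close>.\<close>

definition homologous ::
  "nat \<Rightarrow> 'a set set \<Rightarrow> ('a list \<Rightarrow> 'k::field) \<Rightarrow> ('a list \<Rightarrow> 'k) \<Rightarrow> bool" where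
  "homologous n K c c' \<longleftrightarrow> (\<lambda>s. c s - c' s) \<in> boundaries n K"

section \<open>Barcodes\<close>

text \<open>The pair \<open>(b, d)\<close> stands for the bar \<open>(b, d]\<close>, and \<open>(b, \<infinity>)\<close> if \<open>d = \<infinity>\<close>.\<close>

type_synonym bar = "real \<times> ereal"

definition bar_set :: "bar \<Rightarrow> real set" where
  "bar_set J = {\<epsilon>. fst J < \<epsilon> \<and> ereal \<epsilon> \<le> snd J}"

text \<open>
  A multiset of bars is represented by a set of tagged bars, so that equal bars are told apart by
  their tags; the multiplicity of \<open>J\<close> is the number of elements with first component \<open>J\<close>.
  A multiset of the library would have to be finite.
\<close>

type_synonym tagged_bar = "bar \<times> nat"

text \<open>
  \<open>B\<close> is the barcode of the persistence module \<open>\<epsilon> \<mapsto> H\<^sub>n(K \<epsilon>)\<close> if this module is isomorphic to the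
  direct sum of the interval modules of the bars in \<open>B\<close>. Unfolded, an isomorphism is a choice of a
  class \<open>[z \<beta> \<epsilon>] \<in> H\<^sub>n(K \<epsilon>)\<close> for each bar \<open>\<beta>\<close> and each \<open>\<epsilon>\<close> in it, such that the map induced by the
  inclusion \<open>K \<epsilon> \<subseteq> K \<epsilon>'\<close> sends \<open>[z \<beta> \<epsilon>]\<close> to \<open>[z \<beta> \<epsilon>']\<close> while the bar lasts and to 0 afterwards,
  and such that at every \<open>\<epsilon>\<close> the classes of the bars containing \<open>\<epsilon>\<close> form a basis of \<open>H\<^sub>n(K \<epsilon>)\<close>.
\<close>

definition interval_basis ::
  "nat \<Rightarrow> (real \<Rightarrow> 'a set set) \<Rightarrow> tagged_bar set \<Rightarrow>
     (tagged_bar \<Rightarrow> real \<Rightarrow> 'a list \<Rightarrow> 'k::field) \<Rightarrow> bool" where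
  "interval_basis n K B z \<longleftrightarrow>
     (\<forall>\<beta>\<in>B. \<forall>\<epsilon>\<in>bar_set (fst \<beta>). z \<beta> \<epsilon> \<in> cycles n (K \<epsilon>)) \<and>
     (\<forall>\<beta>\<in>B. \<forall>\<epsilon>\<in>bar_set (fst \<beta>). \<forall>\<epsilon>'\<ge>\<epsilon>.
        homologous n (K \<epsilon>') (z \<beta> \<epsilon>) (if \<epsilon>' \<in> bar_set (fst \<beta>) then z \<beta> \<epsilon>' else (\<lambda>_. 0))) \<and>
     (\<forall>\<epsilon>. \<forall>c\<in>cycles n (K \<epsilon>).
        \<exists>!a :: tagged_bar \<Rightarrow> 'k.
          finite {\<beta>. a \<beta> \<noteq> 0} \<and> {\<beta>. a \<beta> \<noteq> 0} \<subseteq> {\<beta>\<in>B. \<epsilon> \<in> bar_set (fst \<beta>)} \<and>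
          homologous n (K \<epsilon>) c (\<lambda>s. \<Sum>\<beta> | a \<beta> \<noteq> 0. a \<beta> * z \<beta> \<epsilon> s))"

definition is_barcode ::
  "'k::field itself \<Rightarrow> nat \<Rightarrow> (real \<Rightarrow> 'a set set) \<Rightarrow> tagged_bar set \<Rightarrow> bool" where
  "is_barcode k n K B \<longleftrightarrow>
     (\<forall>\<beta>\<in>B. ereal (fst (fst \<beta>)) < snd (fst \<beta>)) \<and>
     (\<exists>z :: tagged_bar \<Rightarrow> real \<Rightarrow> 'a list \<Rightarrow> 'k. interval_basis n K B z)"

definition vietoris_rips :: "('a \<Rightarrow> 'a \<Rightarrow> real) \<Rightarrow> 'a set \<Rightarrow> real \<Rightarrow> 'a set set" where
  "vietoris_rips d X \<epsilon> = {\<sigma>. finite \<sigma> \<and> \<sigma> \<noteq> {} \<and> \<sigma> \<subseteq> X \<and> (\<forall>x\<in>\<sigma>. \<forall>y\<in>\<sigma>. d x y < \<epsilon>)}"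

section \<open>The Liouville torus of a time series\<close>

text \<open>A function on \<open>\<real>/2\<pi>\<int>\<close> is a \<open>2\<pi>\<close>-periodic function on the reals.\<close>

definition fourier_coeff :: "(real \<Rightarrow> real) \<Rightarrow> nat \<Rightarrow> complex" where
  "fourier_coeff f L =
     (LINT t:{0..2*pi}|lebesgue. complex_of_real (f t) * cis (- (real L * t))) / (2 * pi)"

definition radius :: "(real \<Rightarrow> real) \<Rightarrow> nat \<Rightarrow> real" where
  "radius f L = 2 * cmod (fourier_coeff f L)"

text \<open>
  A point of the phase space \<open>\<real>\<^sup>2\<^sup>N\<close> is a family \<open>x L = (q\<^sub>L, p\<^sub>L)\<close> for \<open>L = 1, \<dots>, N\<close>. The actions
  \<open>I\<^sub>L\<close> are the first integrals of \<open>H = \<Sum>\<^sub>L L * I\<^sub>L\<close>, and a Liouville torus is a joint level set of them.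
\<close>

definition action :: "real \<times> real \<Rightarrow> real" where
  "action = (\<lambda>(q, p). (p\<^sup>2 + q\<^sup>2) / 2)"

definition hamiltonian :: "nat \<Rightarrow> (nat \<Rightarrow> real \<times> real) \<Rightarrow> real" where
  "hamiltonian N x = (\<Sum>L=1..N. real L / 2 * ((snd (x L))\<^sup>2 + (fst (x L))\<^sup>2))"

lemma hamiltonian_action: "hamiltonian N x = (\<Sum>L=1..N. real L * action (x L))"
  unfolding hamiltonian_def action_def by (intro sum.cong) (auto simp: case_prod_beta field_simps)

definition liouville_torus :: "nat \<Rightarrow> (real \<Rightarrow> real) \<Rightarrow> (nat \<Rightarrow> real \<times> real) set" where
  "liouville_torus N f =
     {x \<in> extensional {1..N}. \<forall>L\<in>{1..N}. action (x L) = (radius f L)\<^sup>2 / 2}"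

text \<open>
  A vector of \<open>\<real>\<^bsup>M+1\<^esup>\<close>, \<open>M = 2N\<close>, is a function of type \<^typ>\<open>nat \<Rightarrow> real\<close> which is 0 at every
  \<open>j > 2N\<close>; its Euclidean norm is its \<^const>\<open>L2_set\<close> over \<open>{..2*N}\<close>.
\<close>

definition tau :: "nat \<Rightarrow> real" where
  "tau N = 2 * pi / (2 * real N + 1)"

definition u_vec :: "nat \<Rightarrow> nat \<Rightarrow> nat \<Rightarrow> real" where
  "u_vec N L j = (if j \<le> 2 * N then cos (real L * real j * tau N) else 0)"

definition v_vec :: "nat \<Rightarrow> nat \<Rightarrow> nat \<Rightarrow> real" where
  "v_vec N L j = (if j \<le> 2 * N then sin (real L * real j * tau N) else 0)"

definition plane :: "nat \<Rightarrow> nat \<Rightarrow> (nat \<Rightarrow> real) set" where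
  "plane N L = {\<lambda>j. a * u_vec N L j + b * v_vec N L j |a b. True}"

text \<open>
  An element of the direct sum of the planes \<open>P\<^sub>L\<close>, \<open>L \<in> I\<close>, is the family of its components, an
  element of \<open>\<Pi>\<^sub>E L\<in>I. plane N L\<close>.
\<close>

definition plane_dist ::
  "nat \<Rightarrow> nat set \<Rightarrow> (nat \<Rightarrow> nat \<Rightarrow> real) \<Rightarrow> (nat \<Rightarrow> nat \<Rightarrow> real) \<Rightarrow> real" where
  "plane_dist N I x y = (MAX L\<in>I. L2_set (\<lambda>j. x L j - y L j) {..2 * N})"

definition plane_proj :: "nat set \<Rightarrow> (nat \<Rightarrow> nat \<Rightarrow> real) \<Rightarrow> nat \<Rightarrow> nat \<Rightarrow> real" where
  "plane_proj I x = restrict x I"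

text \<open>
  The isometry of the \<open>(q\<^sub>L, p\<^sub>L)\<close>-plane with \<open>P\<^sub>L\<close>; the vectors \<open>u\<^sub>L\<close> and \<open>v\<^sub>L\<close> are orthogonal and
  both have norm \<open>sqrt ((2N+1)/2)\<close>.
\<close>

definition embed_plane :: "nat \<Rightarrow> nat \<Rightarrow> real \<times> real \<Rightarrow> nat \<Rightarrow> real" where
  "embed_plane N L = (\<lambda>(q, p) j. sqrt (2 / (2 * real N + 1)) * (q * u_vec N L j + p * v_vec N L j))"

definition psi :: "nat \<Rightarrow> (real \<Rightarrow> real) \<Rightarrow> (nat \<Rightarrow> nat \<Rightarrow> real) set" where
  "psi N f = (\<lambda>x. \<lambda>L\<in>{1..N}. embed_plane N L (x L)) ` liouville_torus N f"

lemma sum_cis_zero: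
  assumes L: "1 \<le> L" "L \<le> N"
  shows "(\<Sum>j\<le>2*N. cis (2 * (real L * real j * tau N))) = 0"
proof -
  define w where "w = cis (2 * (real L * tau N))"
  have pw: "cis (2 * (real L * real j * tau N)) = w ^ j" for j
    unfolding w_def Complex.DeMoivre by (simp add: algebra_simps)
  have "w ^ Suc (2*N) = cis (2 * pi * real (2 * L))"
    unfolding w_def Complex.DeMoivre tau_def by (rule arg_cong[of _ _ cis]) (simp add: field_simps)
  also have "\<dots> = 1" by (intro cis_multiple_2pi) auto
  finally have w1: "w ^ Suc (2*N) = 1" .
  have "w \<noteq> 1"
  proof
    assume "w = 1"
    then have "cos (2 * (real L * tau N)) = 1"
      by (simp add: w_def complex_eq_iff)
    then obtain x :: int where "2 * (real L * tau N) = real_of_int x * 2 * pi"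
      unfolding cos_one_2pi_int by (elim exE)
    then have "(2 * pi) * (2 * real L) = (2 * pi) * (real_of_int x * (2 * real N + 1))"
      unfolding tau_def by (simp add: field_simps)
    then have "2 * real L = real_of_int x * (2 * real N + 1)"
      by (subst (asm) mult_cancel_left) simp
    then have "real_of_int (2 * int L) = real_of_int (x * (2 * int N + 1))" by simp
    then have eq: "2 * int L = x * (2 * int N + 1)" by (simp only: of_int_eq_iff)
    have "0 < x * (2 * int N + 1)" unfolding eq[symmetric] using L(1) by simp
    then have "x > 0" by (rule zero_less_mult_pos2) simp
    moreover have "even (x * (2 * int N + 1))" unfolding eq[symmetric] by (rule dvd_triv_left)
    then have "even x" by (simp only: even_mult_iff even_add) simp
    ultimately have "x \<ge> 2" by presburger
    then have "2 * (2 * int N + 1) \<le> x * (2 * int N + 1)" by (intro mult_right_mono) auto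
    with eq L(2) show False by simp
  qed
  then have "(\<Sum>j<Suc (2*N). w ^ j) = 0" using w1 geometric_sum[of w "Suc (2*N)"] by simp
  then show ?thesis by (simp only: pw lessThan_Suc_atMost)
qed

lemma L2_set_plane:
  assumes L: "1 \<le> L" "L \<le> N"
  shows "L2_set (\<lambda>j. a * u_vec N L j + b * v_vec N L j) {..2*N} =
    sqrt ((2 * real N + 1) / 2 * (a\<^sup>2 + b\<^sup>2))"
proof -
  define t where "t = (\<lambda>j. real L * real j * tau N)"
  have c: "(\<Sum>j\<le>2*N. cos (2 * t j)) = 0" and s: "(\<Sum>j\<le>2*N. sin (2 * t j)) = 0"
    using arg_cong[OF sum_cis_zero[OF L], of Re] arg_cong[OF sum_cis_zero[OF L], of Im]
    by (simp_all add: t_def)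
  have "(a * u_vec N L j + b * v_vec N L j)\<^sup>2 =
      (a\<^sup>2 + b\<^sup>2) / 2 + (a\<^sup>2 - b\<^sup>2) / 2 * cos (2 * t j) + a * b * sin (2 * t j)" if "j \<le> 2*N" for j
  proof -
    have sq: "(sin (t j))\<^sup>2 = (1 - cos (2 * t j)) / 2" "(cos (t j))\<^sup>2 = (1 + cos (2 * t j)) / 2"
      using sin_cos_squared_add[of "t j"] cos_double_cos[of "t j"]
      unfolding eq_divide_eq_numeral1 by (smt (verit))+
    have "(a * cos (t j) + b * sin (t j))\<^sup>2 =
        a\<^sup>2 * (cos (t j))\<^sup>2 + b\<^sup>2 * (sin (t j))\<^sup>2 + a * b * sin (2 * t j)"
      unfolding sin_double by (simp add: power2_eq_square algebra_simps)
    also have "\<dots> = (a\<^sup>2 + b\<^sup>2) / 2 + (a\<^sup>2 - b\<^sup>2) / 2 * cos (2 * t j) + a * b * sin (2 * t j)"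
      unfolding sq by (simp add: field_simps)
    finally show ?thesis using that by (simp add: u_vec_def v_vec_def t_def)
  qed
  then have "(\<Sum>j\<le>2*N. (a * u_vec N L j + b * v_vec N L j)\<^sup>2) =
      (\<Sum>j\<le>2*N. (a\<^sup>2 + b\<^sup>2) / 2 + (a\<^sup>2 - b\<^sup>2) / 2 * cos (2 * t j) + a * b * sin (2 * t j))"
    by (intro sum.cong) auto
  also have "\<dots> = (2 * real N + 1) / 2 * (a\<^sup>2 + b\<^sup>2)"
    unfolding sum.distrib sum_distrib_left[symmetric] c s by simp
  finally show ?thesis by (simp add: L2_set_def)
qed

lemma embed_plane_isometry:
  assumes L: "1 \<le> L" "L \<le> N"
  shows "L2_set (\<lambda>j. embed_plane N L x j - embed_plane N L y j) {..2*N} = dist x y"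
proof -
  obtain q p q' p' where xy: "x = (q, p)" "y = (q', p')" by fastforce
  define c where "c = sqrt (2 / (2 * real N + 1))"
  have c2: "(2 * real N + 1) / 2 * c\<^sup>2 = 1"
    by (auto simp: c_def)
  have "L2_set (\<lambda>j. embed_plane N L x j - embed_plane N L y j) {..2*N} =
      L2_set (\<lambda>j. (c * (q - q')) * u_vec N L j + (c * (p - p')) * v_vec N L j) {..2*N}"
    by (intro arg_cong2[of _ _ _ _ L2_set]) (auto simp: xy embed_plane_def c_def algebra_simps)
  also have "\<dots> = sqrt (((2 * real N + 1) / 2 * c\<^sup>2) * ((q - q')\<^sup>2 + (p - p')\<^sup>2))"
    unfolding L2_set_plane[OF L] power_mult_distrib by (rule arg_cong[of _ _ sqrt]) algebra
  also have "\<dots> = dist x y"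
    by (simp only: c2) (simp add: xy dist_Pair_Pair dist_real_def)
  finally show ?thesis .
qed

lemma embed_circle:
  assumes L: "1 \<le> L" "L \<le> N"
  shows "embed_plane N L ` {x. action x = (radius f L)\<^sup>2 / 2} =
    {y \<in> plane N L. L2_set y {..2*N} = radius f L}"
proof -
  have r: "radius f L \<ge> 0" by (simp add: radius_def)
  define c where "c = sqrt (2 / (2 * real N + 1))"
  have c: "c > 0" by (simp add: c_def)
  have norm: "L2_set (embed_plane N L x) {..2*N} = norm x" for x
  proof -
    have "embed_plane N L 0 j = 0" for j by (simp add: embed_plane_def zero_prod_def)
    then show ?thesis using embed_plane_isometry[OF L, of x 0] by simp
  qed
  have act: "action x = (radius f L)\<^sup>2 / 2 \<longleftrightarrow> norm x = radius f L" for x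
  proof -
    have "(norm x)\<^sup>2 = 2 * action x"
      by (cases x) (simp add: action_def norm_Pair algebra_simps)
    then show ?thesis using r power2_eq_iff_nonneg[of "norm x" "radius f L"] by auto
  qed
  have rng: "plane N L = range (embed_plane N L)"
  proof (intro equalityI subsetI)
    fix y assume "y \<in> plane N L"
    then obtain a b where "y = (\<lambda>j. a * u_vec N L j + b * v_vec N L j)"
      unfolding plane_def by blast
    then have "y = embed_plane N L (a / c, b / c)"
      using c unfolding embed_plane_def c_def[symmetric] by (auto simp: algebra_simps)
    then show "y \<in> range (embed_plane N L)" by blast
  next
    fix y assume "y \<in> range (embed_plane N L)"
    then obtain q p where "y = (\<lambda>j. (c * q) * u_vec N L j + (c * p) * v_vec N L j)"
      by (auto simp: embed_plane_def c_def algebra_simps)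
    then show "y \<in> plane N L" unfolding plane_def by blast
  qed
  show ?thesis unfolding rng act by (auto simp: norm)
qed

lemma psi_eq_circles:
  "psi N f = (\<Pi>\<^sub>E L\<in>{1..N}. {y \<in> plane N L. L2_set y {..2*N} = radius f L})"
proof -
  have "liouville_torus N f = (\<Pi>\<^sub>E L\<in>{1..N}. {x. action x = (radius f L)\<^sup>2 / 2})"
    by (auto simp: liouville_torus_def PiE_def Pi_def)
  then have "psi N f = (\<Pi>\<^sub>E L\<in>{1..N}. embed_plane N L ` {x. action x = (radius f L)\<^sup>2 / 2})"
    unfolding psi_def
  proof (intro equalityI subsetI, goal_cases)
    case (1 y)
    then show ?case by (auto simp: PiE_iff)
  next
    case (2 y)
    then have "\<forall>L\<in>{1..N}. \<exists>x. action x = (radius f L)\<^sup>2 / 2 \<and> y L = embed_plane N L x"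
      by (simp add: PiE_iff image_iff)
    then obtain x where x: "\<And>L. L \<in> {1..N} \<Longrightarrow>
        action (x L) = (radius f L)\<^sup>2 / 2 \<and> y L = embed_plane N L (x L)"
      using bchoice[of "{1..N}" "\<lambda>L x. action x = (radius f L)\<^sup>2 / 2 \<and> y L = embed_plane N L x"]
      by blast
    have "y = (\<lambda>L\<in>{1..N}. embed_plane N L (restrict x {1..N} L))"
    proof
      fix L show "y L = (\<lambda>L\<in>{1..N}. embed_plane N L (restrict x {1..N} L)) L"
        using 2(2) x[of L] by (cases "L \<in> {1..N}") (auto simp: PiE_iff extensional_def)
    qed
    moreover have "restrict x {1..N} \<in> liouville_torus N f"
      using x by (simp add: liouville_torus_def)
    ultimately show ?case using 2(1) by blast
  qed
  also have "\<dots> = (\<Pi>\<^sub>E L\<in>{1..N}. {y \<in> plane N L. L2_set y {..2*N} = radius f L})"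
    by (intro PiE_cong embed_circle) auto
  finally show ?thesis .
qed

end

theory Submission
  imports Defs "HOL-Library.Function_Algebras" "HOL-Library.Poly_Mapping" "HOL-Library.Nat_Bijection"
begin

text \<open>
  With the maximum metric, the Vietoris-Rips complex of a product of circles is the product of the
  complexes of the factors. Replacing the \<open>L\<close>th coordinate of every vertex by a base point defines
  commuting idempotents \<open>e L\<close> of the chain complex, so the persistence module \<open>H\<^sub>n\<close> of the torus is the
  direct sum, over the sets \<open>J\<close> of coordinates, of the parts killed by \<open>e L\<close> for \<open>L \<in> J\<close> and fixed by
  \<open>e L\<close> for \<open>L \<notin> J\<close>, and \<open>H\<^sub>n\<close> of the projection to \<open>I\<close> is the sum of the parts with \<open>J \<subseteq> I\<close>.
  The part of \<open>J = {}\<close> vanishes in positive degree, and, as circles are connected, the part of \<open>J\<close>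
  vanishes if \<open>J\<close> has more than \<open>n\<close> elements; the latter replaces the Kuenneth theorem. The remaining
  parts have barcodes because circles are totally bounded (so that \<open>H\<^sub>n(K \<epsilon>) \<rightarrow> H\<^sub>n(K \<epsilon>')\<close> has finite rank
  for \<open>\<epsilon> < \<epsilon>'\<close>) and the inequality in the Vietoris-Rips complex is strict (so that the module is
  continuous from the left). Hence no homology of a circle has to be computed.
\<close>

section \<open>Linear algebra modulo a subspace\<close>

text \<open>The union in the theorem is not disjoint: the bars of a projection occur again in every
  larger projection. The equality therefore needs a single interval basis of the whole torus whose
  members carry supports, such that for every \<open>I\<close> at once the members supported in
  \<open>I\<close> restrict to an interval basis of the projection to \<open>I\<close>. The
  idempotents yield one because they act on chains and so respect boundaries and all inclusions. The
  size restriction on \<open>J\<close> reflects degrees: a connected factor has no reduced homology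
  in degree 0, so every coordinate of \<open>J\<close> uses up at least one degree. The argument
  controls the rank of the homology between two parameters, not its dimension at one. Such tameness
  alone gives no barcode: the product of the interval modules of \<open>[0, 1/m]\<close>,
  \<open>m = 1, 2, ...\<close>, is tame, but it has uncountable dimension at 0 and is not a direct
  sum of interval modules. Continuity from the left excludes such births at a parameter; every bar
  opens on the left, and its generator is found in the inverse limit over the later
  parameters.\<close>

no_notation vector_scalar_mult (infixl "*s" 70)

context vector_space
begin

text \<open>The quotient of \<open>span (F \<union> U)\<close> by \<open>U\<close> has dimension at
  most \<open>card F\<close>, so a strictly increasing chain of intermediate subspaces has at most
  \<open>card F + 1\<close> members. Through this, tameness makes families of subspaces indexed by
  real parameters take finitely many values.\<close>

lemma finite_chain_between:
  assumes U: "subspace U" and F: "finite F"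
    and W: "\<And>W. W \<in> \<C> \<Longrightarrow> subspace W \<and> U \<subseteq> W \<and> W \<subseteq> span (F \<union> U)"
    and chain: "\<And>W W'. W \<in> \<C> \<Longrightarrow> W' \<in> \<C> \<Longrightarrow> W \<subseteq> W' \<or> W' \<subseteq> W"
  shows "finite \<C>"
proof (rule ccontr)
  assume inf: "infinite \<C>"
  obtain BU where BU: "independent BU" "span BU = U"
    using maximal_independent_subset[of U] span_subspace[OF _ _ U] by metis
  \<comment> \<open>Each member of a finite chain beyond the smallest contributes a vector outside
    the member below it. Independence of these vectors modulo \<open>U\<close> is recorded as
    independence jointly with a basis of \<open>U\<close>.\<close>
  have step: "\<exists>E. finite E \<and> Suc (card E) = card \<D> \<and> E \<subseteq> \<Union>\<D> \<and> E \<inter> BU = {} \<and> independent (E \<union> BU)"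
    if "finite \<D>" "\<D> \<noteq> {}" "\<D> \<subseteq> \<C>" for \<D>
    using that
  proof (induction "card \<D>" arbitrary: \<D>)
    case 0 then show ?case by simp
  next
    case (Suc m)
    show ?case
    proof (cases m)
      case 0
      then have "card \<D> = 1" using Suc.hyps by simp
      then show ?thesis using BU by (intro exI[of _ "{}"]) auto
    next
      case (Suc m')
      have ch: "subset.chain \<C> \<D>"
        using Suc.prems(3) chain by (auto simp: subset_chain_def)
      have top: "\<Union>\<D> \<in> \<D>"
        using Union_in_chain[OF Suc.prems(1,2) ch] .
      define \<D>' where "\<D>' = \<D> - {\<Union>\<D>}"
      have c': "card \<D>' = m" and fD': "finite \<D>'"
        using Suc.hyps(2) top Suc.prems(1) by (auto simp: \<D>'_def)
      then have ne: "\<D>' \<noteq> {}" using Suc by auto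
      have sub': "\<D>' \<subseteq> \<C>" using Suc.prems(3) by (auto simp: \<D>'_def)
      obtain E where E: "finite E" "Suc (card E) = card \<D>'" "E \<subseteq> \<Union>\<D>'" "E \<inter> BU = {}" "independent (E \<union> BU)"
        using Suc.hyps(1)[OF c'[symmetric] fD' ne sub'] by blast
      have top': "\<Union>\<D>' \<in> \<D>'"
        by (rule Union_in_chain[OF fD' ne]) (use ch in \<open>auto simp: subset_chain_def \<D>'_def\<close>)
      have "\<Union>\<D>' \<noteq> \<Union>\<D>" "\<Union>\<D>' \<subseteq> \<Union>\<D>" using top' by (auto simp: \<D>'_def)
      then obtain w where w: "w \<in> \<Union>\<D>" "w \<notin> \<Union>\<D>'" by blast
      have s: "subspace (\<Union>\<D>')" "U \<subseteq> \<Union>\<D>'" using W top' sub' by blast+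
      have "span (E \<union> BU) \<subseteq> \<Union>\<D>'"
        using s E(3) BU(2) span_superset[of BU] by (intro span_minimal) auto
      then have wn: "w \<notin> span (E \<union> BU)" using w by blast
      then have wnn: "w \<notin> E \<union> BU" using span_base by blast
      have "independent (insert w (E \<union> BU))" using independent_insertI[OF wn E(5)] .
      then show ?thesis
        using E w wnn \<open>\<Union>\<D>' \<subseteq> \<Union>\<D>\<close> c' Suc.hyps(2)
        by (intro exI[of _ "insert w E"]) auto
    qed
  qed
  \<comment> \<open>\<open>card F + 2\<close> members give \<open>card F + 1\<close> vectors, one
    too many.\<close>
  obtain \<D> where D: "\<D> \<subseteq> \<C>" "finite \<D>" "card \<D> = card F + 2"
    using infinite_arbitrarily_large[OF inf] by blast
  then have "\<D> \<noteq> {}" by auto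
  then obtain E where E: "finite E" "card E = Suc (card F)" "E \<subseteq> \<Union>\<D>" "E \<inter> BU = {}" "independent (E \<union> BU)"
    using step[of \<D>] D by auto
  have "E \<subseteq> span (F \<union> U)" using E(3) D(1) W by blast
  also have "\<dots> \<subseteq> span (F \<union> BU)"
  proof (rule span_minimal)
    show "F \<union> U \<subseteq> span (F \<union> BU)"
      using BU(2) span_mono[of BU "F \<union> BU"] span_superset[of "F \<union> BU"] by blast
  qed simp
  finally have Esp: "E \<subseteq> span (F \<union> BU)" .
  \<comment> \<open>Expressing the finitely many vectors of \<open>E\<close> involves a finite part
    of \<open>BU\<close> only, so cardinalities can be compared.\<close>
  have "\<exists>T. finite T \<and> T \<subseteq> BU \<and> E \<subseteq> span (F \<union> T)"
    using E(1) Esp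
  proof (induction E rule: finite_induct)
    case (insert x E)
    then obtain T where T: "finite T" "T \<subseteq> BU" "E \<subseteq> span (F \<union> T)" by auto
    have "x \<in> span (F \<union> BU)" using insert by auto
    then obtain t r where t: "finite t" "t \<subseteq> F \<union> BU" "x = (\<Sum>a\<in>t. r a *s a)"
      unfolding span_explicit by blast
    have "x \<in> span t" unfolding t(3) by (intro span_sum span_scale span_base)
    then have "x \<in> span (F \<union> (T \<union> (t \<inter> BU)))"
      using span_mono[of t "F \<union> (T \<union> (t \<inter> BU))"] t(2) by blast
    moreover have "E \<subseteq> span (F \<union> (T \<union> (t \<inter> BU)))"
      using T(3) span_mono[of "F \<union> T" "F \<union> (T \<union> (t \<inter> BU))"] by blast
    ultimately show ?case using T t by (intro exI[of _ "T \<union> (t \<inter> BU)"]) auto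
  qed auto
  then obtain T where T: "finite T" "T \<subseteq> BU" "E \<subseteq> span (F \<union> T)" by blast
  have "independent (E \<union> T)" using E(5) T(2) independent_mono by blast
  moreover have "E \<union> T \<subseteq> span (F \<union> T)" using T span_superset by blast
  ultimately have "card (E \<union> T) \<le> card (F \<union> T)"
    using independent_span_bound F T(1) by blast
  also have "\<dots> \<le> card F + card T" by (rule card_Un_le)
  finally show False
    using card_Un_disjoint[of E T] E T by force
qed

text \<open>Infinitely many members would make the spans \<open>W m\<close> of \<open>U\<close> and
  the first \<open>m\<close> of them strictly increasing, against
  \<open>finite_chain_between\<close>. The family is indexed since it is applied to the values of
  different curves at one parameter.\<close>

lemma finite_independent_mod:
  assumes U: "subspace U" and F: "finite F"
    and f: "\<And>i. i \<in> E \<Longrightarrow> f i \<in> span (F \<union> U)"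
    and ind: "\<And>A a. finite A \<Longrightarrow> A \<subseteq> E \<Longrightarrow> (\<Sum>i\<in>A. a i *s f i) \<in> U \<Longrightarrow> \<forall>i\<in>A. a i = 0"
  shows "finite E"
proof (rule ccontr)
  assume "infinite E"
  then obtain g :: "nat \<Rightarrow> _" where g: "inj g" "range g \<subseteq> E"
    using infinite_countable_subset by blast
  define W where "W m = span (f ` g ` {..<m} \<union> U)" for m
  have mono: "W m \<subseteq> W m'" if "m \<le> m'" for m m'
    unfolding W_def using that by (intro span_mono) auto
  have new: "f (g m) \<notin> W m" for m
  proof
    assume "f (g m) \<in> W m"
    have "W m = span (U \<union> (\<lambda>j. f (g j)) ` {..<m})"
      by (simp add: W_def image_image Un_commute)
    moreover have "span (U \<union> h ` {..<m}) \<subseteq> {x. \<exists>u a. x = u + (\<Sum>j<m. a j *s h j) \<and> u \<in> U}" (is "_ \<subseteq> ?R")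
      for h :: "nat \<Rightarrow> 'b" and m :: nat
    proof (rule span_minimal)
      have I: "x \<in> ?R" if "x = u + (\<Sum>j<m. a j *s h j)" "u \<in> U" for x u a
        using that by blast
      have "h j \<in> ?R" if "j < m" for j
      proof (rule I)
        show "h j = 0 + (\<Sum>i<m. (if i = j then 1 else 0) *s h i)"
          using that by (simp add: if_distrib[of "\<lambda>a. a *s _"] sum.delta cong: if_cong)
      qed (rule subspace_0[OF U])
      moreover have "u \<in> ?R" if "u \<in> U" for u
        by (rule I[of _ u "\<lambda>_. 0"]) (use that in auto)
      ultimately show "U \<union> h ` {..<m} \<subseteq> ?R" by blast
      show "subspace ?R"
      proof (rule subspaceI)
        show "0 \<in> ?R" by (rule I[of _ 0 "\<lambda>_. 0"]) (use subspace_0[OF U] in auto)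
      next
        fix x y assume "x \<in> ?R" "y \<in> ?R"
        then obtain u a v c where "x = u + (\<Sum>j<m. a j *s h j)" "y = v + (\<Sum>j<m. c j *s h j)" "u \<in> U" "v \<in> U"
          by blast
        then show "x + y \<in> ?R" using subspace_add[OF U]
          by (intro I[of _ "u + v" "\<lambda>j. a j + c j"]) (auto simp: scale_left_distrib sum.distrib algebra_simps)
      next
        fix c x assume "x \<in> ?R"
        then obtain u a where "x = u + (\<Sum>j<m. a j *s h j)" "u \<in> U" by blast
        then show "c *s x \<in> ?R" using subspace_scale[OF U]
          by (intro I[of _ "c *s u" "\<lambda>j. c * a j"]) (auto simp: scale_right_distrib scale_sum_right)
      qed
    qed
    ultimately obtain u a where u: "f (g m) = u + (\<Sum>j<m. a j *s f (g j))" "u \<in> U"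
      using \<open>f (g m) \<in> W m\<close> by blast
    define a' where "a' i = (if i = g m then 1 else - a (inv g i))" for i
    have "(\<Sum>i\<in>g ` {..m}. a' i *s f i) = (\<Sum>j\<le>m. a' (g j) *s f (g j))"
      using g(1) by (intro sum.reindex_cong[of g]) (auto simp: inj_on_def inj_def)
    also have "\<dots> = f (g m) + (\<Sum>j<m. a' (g j) *s f (g j))"
      by (simp add: lessThan_Suc_atMost[symmetric] a'_def)
    also have "(\<Sum>j<m. a' (g j) *s f (g j)) = (\<Sum>j<m. - (a j *s f (g j)))"
      using g(1) by (intro sum.cong) (auto simp: a'_def inj_eq)
    finally have "(\<Sum>i\<in>g ` {..m}. a' i *s f i) \<in> U"
      using u by (simp add: sum_negf)
    then have "a' (g m) = 0" using ind[of "g ` {..m}" a'] g(2) by blast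
    then show False by (simp add: a'_def)
  qed
  have "finite (range W)"
  proof (rule finite_chain_between[OF U F])
    fix V assume "V \<in> range W"
    then obtain m where V: "V = W m" by blast
    have "f ` g ` {..<m} \<union> U \<subseteq> span (F \<union> U)"
      using f g(2) span_superset[of "F \<union> U"] by blast
    then show "subspace V \<and> U \<subseteq> V \<and> V \<subseteq> span (F \<union> U)"
      unfolding V W_def using span_superset[of "f ` g ` {..<m} \<union> U"] span_minimal[of "f ` g ` {..<m} \<union> U" "span (F \<union> U)"] by auto
  next
    fix V V' assume "V \<in> range W" "V' \<in> range W"
    then show "V \<subseteq> V' \<or> V' \<subseteq> V" using mono by (metis imageE nle_le)
  qed
  moreover have "inj W"
  proof (rule linorder_inj_onI)
    fix m m' :: nat assume "m < m'"
    then have "f (g m) \<in> W m'" unfolding W_def by (intro span_base) auto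
    then show "W m \<noteq> W m'" using new by blast
  qed (rule linear)
  ultimately show False using finite_imageD by fastforce
qed

text \<open>The vectors added when a basis of \<open>U\<close> is extended inside \<open>K\<close>
  represent a basis of the quotient.\<close>

lemma basis_mod_subspace:
  assumes U: "subspace U" and "U \<subseteq> K"
  shows "\<exists>E\<subseteq>K. K \<subseteq> span (E \<union> U) \<and>
    (\<forall>A a. finite A \<and> A \<subseteq> E \<and> (\<Sum>e\<in>A. a e *s e) \<in> U \<longrightarrow> (\<forall>e\<in>A. a e = 0))"
proof -
  obtain BU where BU: "independent BU" "span BU = U" "BU \<subseteq> U"
    using maximal_independent_subset[of U] span_subspace[OF _ _ U] by metis
  obtain B where B: "BU \<subseteq> B" "B \<subseteq> K" "independent B" "K \<subseteq> span B"
    using maximal_independent_subset_extend[of BU K] BU assms(2) by blast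
  define E where "E = B - BU"
  have "\<forall>e\<in>A. a e = 0" if A: "finite A" "A \<subseteq> E" "(\<Sum>e\<in>A. a e *s e) \<in> U" for A a
  proof -
    obtain t r where t: "finite t" "t \<subseteq> BU" "(\<Sum>e\<in>A. a e *s e) = (\<Sum>e\<in>t. r e *s e)"
      using A(3) unfolding BU(2)[symmetric] span_explicit by blast
    have dis: "A \<inter> t = {}" using A t E_def by auto
    define u where "u e = (if e \<in> A then a e else - r e)" for e
    have "(\<Sum>e\<in>A \<union> t. u e *s e) = (\<Sum>e\<in>A. u e *s e) + (\<Sum>e\<in>t. u e *s e)"
      using sum.union_disjoint[OF A(1) t(1) dis] .
    also have "(\<Sum>e\<in>A. u e *s e) = (\<Sum>e\<in>A. a e *s e)" by (simp add: u_def)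
    also have "(\<Sum>e\<in>t. u e *s e) = (\<Sum>e\<in>t. - (r e *s e))"
      using dis by (intro sum.cong) (auto simp: u_def)
    finally have "(\<Sum>e\<in>A \<union> t. u e *s e) = 0" using t(3) by (simp add: sum_negf)
    moreover have "finite (A \<union> t)" "A \<union> t \<subseteq> B" using A(1,2) t(1,2) B(1) by (auto simp: E_def)
    ultimately have "u e = 0" if "e \<in> A" for e
      using independentD[OF B(3)] that by blast
    then show ?thesis by (auto simp: u_def)
  qed
  moreover have "K \<subseteq> span (E \<union> U)"
  proof -
    have "B \<subseteq> E \<union> U" using BU(3) by (auto simp: E_def)
    then show ?thesis using B(4) span_mono by blast
  qed
  moreover have "E \<subseteq> K" using B(2) by (auto simp: E_def)
  ultimately show ?thesis by blast
qed

end

section \<open>Interval decomposition of tame persistence modules\<close>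

text \<open>The persistence module of the quotients \<open>Z t / B t\<close>, with all cycles in one
  space so that the structure maps are induced by inclusions. \<open>left_Z\<close> and
  \<open>left_B\<close> are its continuity from the left; \<open>tame\<close> says that the map from
  \<open>s\<close> to \<open>t\<close> has finite rank; \<open>Z_nonpos\<close> makes the module
  vanish up to 0, so that births are bounded below.\<close>

locale filtered_quotient = vector_space scale
  for scale :: "'k::field \<Rightarrow> 'v::ab_group_add \<Rightarrow> 'v" (infixr "*s" 75) +
  fixes Z B :: "real \<Rightarrow> 'v set"
  assumes subspace_Z: "subspace (Z t)" and subspace_B: "subspace (B t)"
    and B_sub_Z: "B t \<subseteq> Z t"
    and mono_Z: "s \<le> t \<Longrightarrow> Z s \<subseteq> Z t" and mono_B: "s \<le> t \<Longrightarrow> B s \<subseteq> B t"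
    and left_Z: "x \<in> Z t \<Longrightarrow> \<exists>s<t. x \<in> Z s" and left_B: "x \<in> B t \<Longrightarrow> \<exists>s<t. x \<in> B s"
    and Z_nonpos: "t \<le> 0 \<Longrightarrow> Z t \<subseteq> B t"
    and tame: "s < t \<Longrightarrow> \<exists>F. finite F \<and> Z s \<subseteq> span (F \<union> B t)"
begin

sublocale curves: vector_space "\<lambda>a (w :: real \<Rightarrow> 'v) u. a *s w u"
  by standard (auto simp: scale_right_distrib scale_left_distrib fun_eq_iff)

lemma Z_add: "x \<in> Z t \<Longrightarrow> y \<in> Z t \<Longrightarrow> x + y \<in> Z t"
  and Z_diff: "x \<in> Z t \<Longrightarrow> y \<in> Z t \<Longrightarrow> x - y \<in> Z t"
  and Z_scale: "x \<in> Z t \<Longrightarrow> a *s x \<in> Z t" and Z_zero: "0 \<in> Z t"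
  and B_add: "x \<in> B t \<Longrightarrow> y \<in> B t \<Longrightarrow> x + y \<in> B t"
  and B_diff: "x \<in> B t \<Longrightarrow> y \<in> B t \<Longrightarrow> x - y \<in> B t"
  and B_scale: "x \<in> B t \<Longrightarrow> a *s x \<in> B t" and B_zero: "0 \<in> B t"
  using subspace_Z subspace_B subspace_add subspace_diff subspace_scale subspace_0 by blast+

lemma B_diff_trans: "x - y \<in> B t \<Longrightarrow> y - z \<in> B t \<Longrightarrow> x - z \<in> B t"
  using B_add[of "x - y" t "y - z"] by simp

lemma B_diff_sym: "x - y \<in> B t \<Longrightarrow> y - x \<in> B t"
  using B_diff[OF B_zero, of "x - y" t] by simp

lemma B_diff_cancel: "x - y \<in> B t \<Longrightarrow> y \<in> B t \<Longrightarrow> x \<in> B t"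
  using B_add[of "x - y" t y] by simp

text \<open>This is \<open>Z s + B t\<close>; for \<open>s \<le> t\<close> its quotient by
  \<open>B t\<close> is the image of the module at \<open>s\<close> in the module at
  \<open>t\<close>.\<close>

definition plus_B :: "real \<Rightarrow> real \<Rightarrow> 'v set" where
  "plus_B s t = {x. \<exists>y\<in>Z s. x - y \<in> B t}"

lemma subspace_plus_B: "subspace (plus_B s t)"
proof (rule subspaceI)
  show "0 \<in> plus_B s t" unfolding plus_B_def using Z_zero B_zero by force
next
  fix x x' assume "x \<in> plus_B s t" "x' \<in> plus_B s t"
  then obtain y y' where y: "y \<in> Z s" "x - y \<in> B t" "y' \<in> Z s" "x' - y' \<in> B t"
    unfolding plus_B_def by blast
  then have "(x + x') - (y + y') \<in> B t" using B_add[OF y(2,4)] by (simp add: algebra_simps)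
  then show "x + x' \<in> plus_B s t" unfolding plus_B_def using y Z_add by blast
next
  fix c x assume "x \<in> plus_B s t"
  then obtain y where y: "y \<in> Z s" "x - y \<in> B t" unfolding plus_B_def by blast
  then have "c *s x - c *s y \<in> B t" using B_scale[OF y(2), of c] by (simp add: scale_right_diff_distrib)
  then show "c *s x \<in> plus_B s t" unfolding plus_B_def using y Z_scale by blast
qed

lemma Z_sub_plus_B: "Z s \<subseteq> plus_B s t"
  unfolding plus_B_def using B_zero by force

lemma B_sub_plus_B: "B t \<subseteq> plus_B s t"
  unfolding plus_B_def using Z_zero by force

lemma plus_B_span: assumes "Z s \<subseteq> span (F \<union> B t)" shows "plus_B s t \<subseteq> span (F \<union> B t)"
proof
  fix x assume "x \<in> plus_B s t"
  then obtain y where y: "y \<in> Z s" "x - y \<in> B t" unfolding plus_B_def by blast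
  then have "y + (x - y) \<in> span (F \<union> B t)"
    using assms by (intro span_add span_base[of "x - y"]) auto
  then show "x \<in> span (F \<union> B t)" by simp
qed

text \<open>\<open>curve b\<close> is the inverse limit of the module from the right at \<open>b\<close>: a bar \<open>(b, d]\<close> is not born
  at any parameter of its own, so its generators live there.\<close>

definition curve :: "real \<Rightarrow> (real \<Rightarrow> 'v) set" where
  "curve b = {w. (\<forall>u>b. w u \<in> Z u) \<and> (\<forall>u>b. \<forall>u'\<ge>u. w u - w u' \<in> B u')}"

definition dying :: "real \<Rightarrow> ereal \<Rightarrow> (real \<Rightarrow> 'v) set" where
  "dying b d = {w \<in> curve b. \<forall>u>b. d < ereal u \<longrightarrow> w u \<in> B u}"

text \<open>Modulo a class that exists at \<open>b\<close> already, the curves in \<open>decomp b d\<close> are zero at \<open>d\<close>;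
  the quotient of \<open>dying b d\<close> by them counts the bars \<open>(b, d]\<close>.\<close>

definition decomp :: "real \<Rightarrow> ereal \<Rightarrow> (real \<Rightarrow> 'v) set" where
  "decomp b d = {w \<in> dying b d. \<exists>y\<in>Z b. \<exists>u>b. ereal u \<le> d \<and> w u - y \<in> B u}"

lemma curveD: "w \<in> curve b \<Longrightarrow> b < u \<Longrightarrow> w u \<in> Z u"
  and curve_coh: "w \<in> curve b \<Longrightarrow> b < u \<Longrightarrow> u \<le> u' \<Longrightarrow> w u - w u' \<in> B u'"
  by (auto simp: curve_def)

lemma curve_B_mono: "w \<in> curve b \<Longrightarrow> b < u \<Longrightarrow> u \<le> u' \<Longrightarrow> w u \<in> B u \<Longrightarrow> w u' \<in> B u'"
  using B_diff_cancel[OF B_diff_sym[OF curve_coh], of w b u u'] mono_B[of u u'] by blast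

lemma subspace_dying: "curves.subspace (dying b d)"
proof (rule curves.subspaceI)
  show "0 \<in> dying b d" by (auto simp: dying_def curve_def Z_zero B_zero)
next
  fix x y assume xy: "x \<in> dying b d" "y \<in> dying b d"
  have "x u + y u - (x u' + y u') \<in> B u'" if "b < u" "u \<le> u'" for u u'
    using B_add[of "x u - x u'" u' "y u - y u'"] xy that
    by (simp add: dying_def curve_def add_diff_add)
  then show "x + y \<in> dying b d"
    using xy by (simp add: dying_def curve_def Z_add B_add)
next
  fix c x assume "x \<in> dying b d"
  then show "(\<lambda>u. c *s x u) \<in> dying b d"
    by (auto simp: dying_def curve_def scale_right_diff_distrib[symmetric] intro: Z_scale B_scale)
qed

lemma decomp_sub: "decomp b d \<subseteq> dying b d"
  by (auto simp: decomp_def)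

lemma subspace_decomp: assumes "ereal b < d" shows "curves.subspace (decomp b d)"
proof (rule curves.subspaceI)
  obtain u where "b < u" "ereal u \<le> d"
    using ereal_dense2[OF assms] by force
  then show "0 \<in> decomp b d"
    using curves.subspace_0[OF subspace_dying] by (auto simp: decomp_def B_zero intro!: bexI[OF _ Z_zero])
next
  fix x x' assume x: "x \<in> decomp b d" "x' \<in> decomp b d"
  then obtain y u y' u' where y: "y \<in> Z b" "b < u" "ereal u \<le> d" "x u - y \<in> B u"
      and y': "y' \<in> Z b" "b < u'" "ereal u' \<le> d" "x' u' - y' \<in> B u'"
    unfolding decomp_def by blast
  have c: "x \<in> curve b" "x' \<in> curve b" using x by (auto simp: decomp_def dying_def)
  define m where "m = max u u'"
  have "x m - y \<in> B m"
    using B_diff_trans[OF B_diff_sym[OF curve_coh[OF c(1) y(2)]], of m y] y(4) mono_B[of u m] by (auto simp: m_def)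
  moreover have "x' m - y' \<in> B m"
    using B_diff_trans[OF B_diff_sym[OF curve_coh[OF c(2) y'(2)]], of m y'] y'(4) mono_B[of u' m] by (auto simp: m_def)
  ultimately have "(x + x') m - (y + y') \<in> B m"
    using B_add by (simp add: add_diff_add)
  moreover have "x + x' \<in> dying b d" using x decomp_sub curves.subspace_add[OF subspace_dying] by blast
  moreover have "b < m" "ereal m \<le> d" using y y' by (auto simp: m_def max_def)
  ultimately show "x + x' \<in> decomp b d"
    using Z_add y(1) y'(1) unfolding decomp_def by blast
next
  fix c x assume x: "x \<in> decomp b d"
  then obtain y u where y: "y \<in> Z b" "b < u" "ereal u \<le> d" "x u - y \<in> B u" unfolding decomp_def by blast
  then have "c *s x u - c *s y \<in> B u" "c *s y \<in> Z b"
    using B_scale Z_scale by (auto simp: scale_right_diff_distrib[symmetric])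
  moreover have "(\<lambda>u. c *s x u) \<in> dying b d" using x decomp_sub curves.subspace_scale[OF subspace_dying] by blast
  ultimately show "(\<lambda>u. c *s x u) \<in> decomp b d" unfolding decomp_def using y by blast
qed

text \<open>Lifts of a basis of the quotient of \<open>dying b d\<close> by
  \<open>decomp b d\<close>, hence one curve for each bar \<open>(b, d]\<close>.\<close>

definition gens :: "real \<Rightarrow> ereal \<Rightarrow> (real \<Rightarrow> 'v) set" where
  "gens b d = (SOME E. E \<subseteq> dying b d \<and> dying b d \<subseteq> curves.span (E \<union> decomp b d) \<and>
    (\<forall>A a. finite A \<and> A \<subseteq> E \<and> (\<Sum>e\<in>A. (\<lambda>u. a e *s e u)) \<in> decomp b d \<longrightarrow> (\<forall>e\<in>A. a e = 0)))"

lemma gens: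
  assumes "ereal b < d"
  shows "gens b d \<subseteq> dying b d" "dying b d \<subseteq> curves.span (gens b d \<union> decomp b d)"
    "\<And>A a. finite A \<Longrightarrow> A \<subseteq> gens b d \<Longrightarrow> (\<Sum>e\<in>A. (\<lambda>u. a e *s e u)) \<in> decomp b d \<Longrightarrow> (\<forall>e\<in>A. a e = 0)"
proof -
  have *: "gens b d \<subseteq> dying b d \<and> dying b d \<subseteq> curves.span (gens b d \<union> decomp b d) \<and>
    (\<forall>A a. finite A \<and> A \<subseteq> gens b d \<and> (\<Sum>e\<in>A. (\<lambda>u. a e *s e u)) \<in> decomp b d \<longrightarrow> (\<forall>e\<in>A. a e = 0))"
    using curves.basis_mod_subspace[OF subspace_decomp[OF assms] decomp_sub]
    unfolding gens_def by (rule someI_ex)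
  from * show "gens b d \<subseteq> dying b d" by (rule conjunct1)
  from conjunct1[OF conjunct2[OF *]] show "dying b d \<subseteq> curves.span (gens b d \<union> decomp b d)" .
  fix A a assume "finite A" "A \<subseteq> gens b d" "(\<Sum>e\<in>A. (\<lambda>u. a e *s e u)) \<in> decomp b d"
  then show "\<forall>e\<in>A. a e = 0"
    using conjunct2[OF conjunct2[OF *], rule_format, of A a] by metis
qed

lemma fun_sum_apply: "(\<Sum>i\<in>A. f i) u = (\<Sum>i\<in>A. f i u)" for f :: "'i \<Rightarrow> real \<Rightarrow> 'v"
  by (induction A rule: infinite_finite_induct) auto

definition index :: "(real \<times> ereal \<times> (real \<Rightarrow> 'v)) set" where
  "index = {(b, d, e). ereal b < d \<and> e \<in> gens b d}"

text \<open>Among the terms of a relation with nonzero coefficient, consider those of latest birth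
  \<open>bm\<close>, and among these the ones of latest death \<open>dm\<close>. At a parameter
  where the other terms born at \<open>bm\<close> have died, the terms born earlier amount to a
  class that exists at \<open>bm\<close> already. The remaining combination then lies in
  \<open>decomp bm dm\<close>, which the choice of \<open>gens bm dm\<close> forbids.\<close>

lemma independent_at:
  assumes "finite A" "A \<subseteq> index" "\<And>b d e. (b, d, e) \<in> A \<Longrightarrow> b < t \<and> ereal t \<le> d"
    and "(\<Sum>(b,d,e)\<in>A. a (b,d,e) *s e t) \<in> B t"
  shows "\<forall>i\<in>A. a i = 0"
proof (rule ccontr)
  assume "\<not> (\<forall>i\<in>A. a i = 0)"
  define A0 where "A0 = {i\<in>A. a i \<noteq> 0}"
  have A0: "finite A0" "A0 \<noteq> {}" "A0 \<subseteq> A" using assms(1) \<open>\<not> _\<close> by (auto simp: A0_def)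
  define bm where "bm = Max (fst ` A0)"
  define As where "As = {i\<in>A0. fst i = bm}"
  have "bm \<in> fst ` A0" unfolding bm_def using A0 by (intro Max_in) auto
  then have As: "finite As" "As \<noteq> {}" using A0 by (auto simp: As_def)
  define dm where "dm = Max ((fst \<circ> snd) ` As)"
  define A1 where "A1 = {i\<in>As. fst (snd i) = dm}"
  have "dm \<in> (fst \<circ> snd) ` As" unfolding dm_def using As by (intro Max_in) auto
  then have A1: "finite A1" "A1 \<noteq> {}" using As by (auto simp: A1_def)
  define A2 where "A2 = As - A1"
  define A3 where "A3 = A0 - As"
  have ble: "fst i \<le> bm" if "i \<in> A0" for i unfolding bm_def using A0 that by auto
  have dle: "fst (snd i) \<le> dm" if "i \<in> As" for i unfolding dm_def using As that by auto
  have bt: "bm < t" "ereal t \<le> dm" "ereal bm < dm"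
    using A1(2) assms(2,3) A0(3) by (auto simp: A1_def As_def index_def)
  have ed: "snd (snd i) \<in> dying (fst i) (fst (snd i))" if "i \<in> A0" for i
  proof -
    obtain b d e where i: "i = (b, d, e)" by (cases i)
    then have "ereal b < d" "e \<in> gens b d" using that A0(3) assms(2) by (auto simp: index_def)
    then show ?thesis using gens(1)[of b d] i by auto
  qed
  then have ec: "snd (snd i) \<in> curve (fst i)" if "i \<in> A0" for i
    using that by (auto simp: dying_def)
  have lt2: "fst (snd i) < dm" if "i \<in> A2" for i
    using dle[of i] that by (auto simp: A2_def A1_def)
  obtain u where u: "t \<le> u" "ereal u \<le> dm" "\<And>i. i \<in> A2 \<Longrightarrow> fst (snd i) < ereal u"
  proof (cases dm)
    case (real r)
    then show ?thesis using that[of r] bt lt2 by auto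
  next
    case PInf
    define S where "S = insert t (real_of_ereal ` (fst \<circ> snd) ` A2)"
    have "finite S" using As(1) by (auto simp: S_def A2_def)
    show ?thesis
    proof (rule that[of "Max S + 1"])
      have "t \<le> Max S" using \<open>finite S\<close> by (intro Max_ge) (auto simp: S_def)
      then show "t \<le> Max S + 1" by simp
      show "ereal (Max S + 1) \<le> dm" using PInf by simp
      fix i assume i: "i \<in> A2"
      then have "ereal (fst i) < fst (snd i)" "fst (snd i) < \<infinity>"
        using lt2[OF i] PInf assms(2) A0(3) by (auto simp: A2_def As_def index_def)
      then have "fst (snd i) = ereal (real_of_ereal (fst (snd i)))" by (cases "fst (snd i)") auto
      moreover have "real_of_ereal (fst (snd i)) \<le> Max S"
        using i \<open>finite S\<close> by (intro Max_ge) (auto simp: S_def)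
      ultimately show "fst (snd i) < ereal (Max S + 1)" by (metis less_add_one less_ereal.simps(1) order_le_less_trans)
    qed
  qed (use bt in auto)
  define g where "g i v = a i *s (snd (snd i)) v" for i v
  have split: "(\<Sum>i\<in>A0. g i v) = (\<Sum>i\<in>A1. g i v) + (\<Sum>i\<in>A2. g i v) + (\<Sum>i\<in>A3. g i v)" for v
  proof -
    have "As \<subseteq> A0" "A1 \<subseteq> As" by (auto simp: As_def A1_def)
    then show ?thesis
      using sum.subset_diff[of As A0 "\<lambda>i. g i v"] sum.subset_diff[of A1 As "\<lambda>i. g i v"] A0(1) As(1)
      by (simp add: A2_def A3_def algebra_simps)
  qed
  have "(\<Sum>i\<in>A0. g i t) = (\<Sum>i\<in>A. g i t)"
    using assms(1) by (intro sum.mono_neutral_left) (auto simp: A0_def g_def)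
  then have Bt: "(\<Sum>i\<in>A0. g i t) \<in> B t"
    using assms(4) by (simp add: g_def case_prod_beta)
  have "(\<Sum>i\<in>A0. g i t) - (\<Sum>i\<in>A0. g i u) = (\<Sum>i\<in>A0. a i *s (snd (snd i) t - snd (snd i) u))"
    by (simp add: g_def sum_subtractf scale_right_diff_distrib)
  also have "\<dots> \<in> B u"
  proof (intro subspace_sum[OF subspace_B] B_scale)
    fix i assume i: "i \<in> A0"
    then have "fst i < t" using ble[OF i] bt by auto
    then show "snd (snd i) t - snd (snd i) u \<in> B u" using curve_coh[OF ec[OF i]] u(1) by blast
  qed
  finally have "(\<Sum>i\<in>A0. g i u) \<in> B u"
    using B_diff_cancel[OF B_diff_sym] Bt mono_B[OF u(1)] by blast
  moreover have "(\<Sum>i\<in>A2. g i u) \<in> B u" unfolding g_def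
  proof (intro subspace_sum[OF subspace_B] B_scale)
    fix i assume i: "i \<in> A2"
    then have "i \<in> A0" "fst i < u" using bt u(1) by (auto simp: A2_def As_def)
    then show "snd (snd i) u \<in> B u" using ed[of i] u(3)[OF i] by (auto simp: dying_def)
  qed
  ultimately have "(\<Sum>i\<in>A0. g i u) - (\<Sum>i\<in>A2. g i u) \<in> B u" by (rule B_diff)
  then have "(\<Sum>i\<in>A1. g i u) + (\<Sum>i\<in>A3. g i u) \<in> B u"
    unfolding split by (simp add: algebra_simps)
  \<comment> \<open>Curves born before \<open>bm\<close> have a value at \<open>bm\<close>, and
    coherence permits exchanging the value at \<open>u\<close> for it.\<close>
  moreover have "(\<Sum>i\<in>A3. g i bm) - (\<Sum>i\<in>A3. g i u) \<in> B u"
  proof -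
    have "(\<Sum>i\<in>A3. g i bm) - (\<Sum>i\<in>A3. g i u) = (\<Sum>i\<in>A3. a i *s (snd (snd i) bm - snd (snd i) u))"
      by (simp add: g_def sum_subtractf scale_right_diff_distrib)
    also have "\<dots> \<in> B u"
    proof (intro subspace_sum[OF subspace_B] B_scale)
      fix i assume i: "i \<in> A3"
      then have "fst i < bm" "i \<in> A0" using ble[of i] by (auto simp: A3_def As_def)
      then show "snd (snd i) bm - snd (snd i) u \<in> B u" using curve_coh[OF ec, of i bm u] u(1) bt(1) by auto
    qed
    finally show ?thesis .
  qed
  ultimately have "((\<Sum>i\<in>A1. g i u) + (\<Sum>i\<in>A3. g i u)) + ((\<Sum>i\<in>A3. g i bm) - (\<Sum>i\<in>A3. g i u)) \<in> B u"
    by (rule B_add)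
  then have "(\<Sum>i\<in>A1. g i u) - - (\<Sum>i\<in>A3. g i bm) \<in> B u"
    by (simp add: algebra_simps)
  moreover have "- (\<Sum>i\<in>A3. g i bm) \<in> Z bm" unfolding g_def
  proof (intro subspace_neg[OF subspace_Z] subspace_sum[OF subspace_Z] Z_scale)
    fix i assume i: "i \<in> A3"
    then have "fst i < bm" "i \<in> A0" using ble[of i] by (auto simp: A3_def As_def)
    then show "snd (snd i) bm \<in> Z bm" using curveD[OF ec] by blast
  qed
  ultimately have ex: "\<exists>y\<in>Z bm. (\<Sum>i\<in>A1. g i u) - y \<in> B u" by blast
  have A1eq: "i = (bm, dm, snd (snd i))" if "i \<in> A1" for i
    using that by (cases i) (simp add: A1_def As_def)
  have aeq: "a (bm, dm, snd (snd i)) = a i" if "i \<in> A1" for i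
    by (rule arg_cong[OF A1eq[OF that], of a, symmetric])
  define E1 where "E1 = (\<lambda>i. snd (snd i)) ` A1"
  define a1 where "a1 e = a (bm, dm, e)" for e
  have inj: "inj_on (\<lambda>i. snd (snd i)) A1" by (rule inj_onI) (metis A1eq)
  have E1: "finite E1" "E1 \<subseteq> gens bm dm" "E1 \<noteq> {}"
  proof -
    have "snd (snd i) \<in> gens bm dm" if "i \<in> A1" for i
    proof -
      have "i \<in> index" using that A0(3) assms(2) by (auto simp: A1_def As_def)
      then show ?thesis using that by (cases i) (simp add: index_def A1_def As_def)
    qed
    then show "E1 \<subseteq> gens bm dm" by (auto simp: E1_def)
  qed (use A1 in \<open>auto simp: E1_def\<close>)
  have sum_eq: "(\<Sum>e\<in>E1. (\<lambda>v. a1 e *s e v)) v = (\<Sum>i\<in>A1. g i v)" for v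
    unfolding fun_sum_apply E1_def sum.reindex[OF inj] o_def g_def a1_def
    by (intro sum.cong refl) (simp add: aeq)
  have "(\<Sum>e\<in>E1. (\<lambda>v. a1 e *s e v)) \<in> dying bm dm"
  proof (rule curves.subspace_sum[OF subspace_dying])
    fix e assume "e \<in> E1"
    then have "e \<in> dying bm dm" using E1(2) gens(1)[OF bt(3)] by blast
    then show "(\<lambda>v. a1 e *s e v) \<in> dying bm dm" by (rule curves.subspace_scale[OF subspace_dying])
  qed
  then have "(\<Sum>e\<in>E1. (\<lambda>v. a1 e *s e v)) \<in> decomp bm dm"
  proof -
    obtain y where "y \<in> Z bm" "(\<Sum>e\<in>E1. (\<lambda>v. a1 e *s e v)) u - y \<in> B u"
      using ex unfolding sum_eq by blast
    moreover have "bm < u" using bt(1) u(1) by simp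
    ultimately show ?thesis using u(2) \<open>_ \<in> dying bm dm\<close> unfolding decomp_def by blast
  qed
  then have "\<forall>e\<in>E1. a1 e = 0" using gens(3)[OF bt(3) E1(1,2)] by blast
  moreover obtain i where "i \<in> A1" using A1(2) by blast
  ultimately have "a i = 0" using aeq[of i] by (simp add: E1_def a1_def)
  then show False using \<open>i \<in> A1\<close> by (auto simp: A1_def As_def A0_def)
qed

end

section \<open>Least births and deaths in families with finitely many values\<close>

lemma finite_chain_Inter_mem:
  assumes "finite \<A>" "\<A> \<noteq> {}" "\<And>V W. V \<in> \<A> \<Longrightarrow> W \<in> \<A> \<Longrightarrow> V \<subseteq> W \<or> W \<subseteq> V"
  shows "\<Inter>\<A> \<in> \<A>"
  using assms
proof (induction \<A> rule: finite_ne_induct)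
  case (insert V \<A>)
  then have "\<Inter>\<A> \<in> \<A>" by auto
  then have "V \<subseteq> \<Inter>\<A> \<or> \<Inter>\<A> \<subseteq> V" using insert.prems by blast
  then show ?case using \<open>\<Inter>\<A> \<in> \<A>\<close> by (auto simp: Int_absorb1 Int_absorb2)
qed auto

text \<open>As \<open>H\<close> has finitely many values, one element outside \<open>S\<close> lies
  in every \<open>H d\<close> that is not contained in \<open>S\<close>; right continuity keeps it
  at the infimum. With \<open>S\<close> the span of the bars alive, this finds the least birth, and
  then the least death, of a class that they miss.\<close>

lemma finite_family_Inf:
  fixes H :: "ereal \<Rightarrow> 'x set"
  assumes mono: "\<And>d d'. d \<le> d' \<Longrightarrow> H d \<subseteq> H d'"
    and rc: "\<And>d x. d < \<infinity> \<Longrightarrow> (\<And>d'. d < d' \<Longrightarrow> x \<in> H d') \<Longrightarrow> x \<in> H d"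
    and fin: "finite (range H)" and ne: "\<not> H d1 \<subseteq> S"
  shows "\<not> H (Inf {d. \<not> H d \<subseteq> S}) \<subseteq> S"
proof (cases "Inf {d. \<not> H d \<subseteq> S} = \<infinity>")
  case True
  moreover have "Inf {d. \<not> H d \<subseteq> S} \<le> d1" using ne by (intro Inf_lower) auto
  ultimately have "d1 = \<infinity>" by simp
  then show ?thesis using ne True by simp
next
  case False
  define D where "D = {d. \<not> H d \<subseteq> S}"
  have "finite (H ` D)" using fin finite_subset[of "H ` D" "range H"] by auto
  moreover have "H ` D \<noteq> {}" using ne by (auto simp: D_def)
  ultimately have "\<Inter>(H ` D) \<in> H ` D"
    by (rule finite_chain_Inter_mem) (metis imageE linear mono)
  then obtain d2 where d2: "d2 \<in> D" "H d2 = \<Inter>(H ` D)" by auto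
  then obtain x where x: "x \<in> H d2" "x \<notin> S" by (auto simp: D_def)
  have "x \<in> H (Inf D)"
  proof (rule rc)
    show "Inf D < \<infinity>" using False by (simp add: D_def)
    fix d' assume "Inf D < d'"
    then obtain d where "d \<in> D" "d < d'" by (auto simp: Inf_less_iff)
    then show "x \<in> H d'" using x(1) mono[OF less_imp_le] unfolding d2(2) by blast
  qed
  then show ?thesis using x(2) by (auto simp: D_def)
qed

context filtered_quotient
begin

text \<open>A Mittag-Leffler argument: by tameness the images of the sets of lifts stabilise.\<close>

lemma curve_lift:
  assumes bt: "b < t" and v: "\<And>u. b < u \<Longrightarrow> u \<le> t \<Longrightarrow> v \<in> plus_B u t"
  shows "\<exists>w\<in>curve b. w t - v \<in> B t"
proof -
  \<comment> \<open>A sequence decreasing to \<open>b\<close> from \<open>s 0 = t\<close>, so that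
    the inverse limit can be built by countably many choices.\<close>
  define s where "s k = b + (t - b) / (real k + 1)" for k
  have s0: "s 0 = t" by (simp add: s_def)
  have sb: "b < s k" for k using bt by (simp add: s_def)
  have santi: "s k' < s k" if "k < k'" for k k'
    using bt that by (simp add: s_def divide_strict_left_mono)
  then have santi': "s k' \<le> s k" if "k \<le> k'" for k k' using that by (metis le_less order_refl)
  have slim: "\<exists>k. s k \<le> u" if "b < u" for u
  proof -
    obtain k where "(t - b) / (u - b) < real k" using reals_Archimedean2 by blast
    then have "(t - b) / (real k + 1) \<le> u - b" using that by (simp add: field_simps)
    then show ?thesis by (auto simp: s_def intro!: exI[of _ k])
  qed
  define A where "A k = {w \<in> Z (s k). w - v \<in> B t}" for k
  have Ane: "\<exists>w. w \<in> A k" for k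
    using v[OF sb, of k] santi'[of 0 k] s0 B_diff_sym by (auto simp: plus_B_def A_def)
  have Aanti: "A k' \<subseteq> A k" if "k \<le> k'" for k k' using mono_Z[OF santi'[OF that]] by (auto simp: A_def)
  define N where "N j = {n \<in> Z (s j). n \<in> B t}" for j
  \<comment> \<open>\<open>N j\<close> consists of the differences of lifts in \<open>A j\<close>,
    and \<open>W k j\<close> represents its image in the module at \<open>s (Suc k)\<close>. These
    images shrink as \<open>j\<close> grows; that they become constant is the Mittag-Leffler
    condition.\<close>
  define W where "W k j = {x. \<exists>n\<in>N j. x - n \<in> B (s (Suc k))}" for k j
  have "\<exists>j0\<ge>k+2. \<forall>j\<ge>j0. W k j = W k j0" for k
  proof -
    \<comment> \<open>The shift by \<open>k + 2\<close> keeps \<open>N\<close> inside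
      \<open>Z (s (k + 2))\<close>, whose image at the strictly later parameter
      \<open>s (Suc k)\<close> is finite-dimensional by \<open>tame\<close>.\<close>
    define g where "g j = W k (j + k + 2)" for j
    have Nanti: "N j' \<subseteq> N j" if "j \<le> j'" for j j' using mono_Z[OF santi'[OF that]] by (auto simp: N_def)
    have ganti: "g j' \<subseteq> g j" if "j \<le> j'" for j j'
      using Nanti[of "j+k+2" "j'+k+2"] that by (auto simp: g_def W_def)
    obtain F where F: "finite F" "Z (s (k+2)) \<subseteq> span (F \<union> B (s (Suc k)))"
      using tame[OF santi[of "Suc k" "k+2"]] by auto
    have "finite (range g)"
    proof (rule finite_chain_between[OF subspace_B F(1)])
      fix V assume "V \<in> range g"
      then obtain j where V: "V = g j" by auto
      have sN: "subspace (N i)" for i unfolding N_def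
        using subspace_inter[OF subspace_Z subspace_B] by (simp add: Int_def)
      have "subspace V"
      proof (rule subspaceI)
        show "0 \<in> V" unfolding V g_def W_def using subspace_0[OF sN] B_zero by force
      next
        fix x x' assume "x \<in> V" "x' \<in> V"
        then obtain n n' where n: "n \<in> N (j+k+2)" "x - n \<in> B (s (Suc k))" "n' \<in> N (j+k+2)" "x' - n' \<in> B (s (Suc k))"
          unfolding V g_def W_def by blast
        then have "(x + x') - (n + n') \<in> B (s (Suc k))" using B_add[OF n(2,4)] by (simp add: algebra_simps)
        then show "x + x' \<in> V" unfolding V g_def W_def using subspace_add[OF sN n(1,3)] by blast
      next
        fix c x assume "x \<in> V"
        then obtain n where n: "n \<in> N (j+k+2)" "x - n \<in> B (s (Suc k))" unfolding V g_def W_def by blast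
        then have "c *s x - c *s n \<in> B (s (Suc k))"
          using B_scale[OF n(2), of c] by (simp add: scale_right_diff_distrib)
        then show "c *s x \<in> V" unfolding V g_def W_def using subspace_scale[OF sN n(1)] by blast
      qed
      moreover have "B (s (Suc k)) \<subseteq> V"
        unfolding V g_def W_def using subspace_0[OF sN] by force
      moreover have "V \<subseteq> plus_B (s (k+2)) (s (Suc k))"
        unfolding V g_def W_def plus_B_def N_def
        using mono_Z[OF santi'[of "k+2" "j+k+2"]] by auto
      ultimately show "subspace V \<and> B (s (Suc k)) \<subseteq> V \<and> V \<subseteq> span (F \<union> B (s (Suc k)))"
        using plus_B_span[OF F(2)] by blast
    next
      fix V V' assume "V \<in> range g" "V' \<in> range g"
      then show "V \<subseteq> V' \<or> V' \<subseteq> V" using ganti by (metis imageE linear)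
    qed
    then have "\<Inter>(range g) \<in> range g"
    proof (rule finite_chain_Inter_mem)
      fix V V' assume "V \<in> range g" "V' \<in> range g"
      then show "V \<subseteq> V' \<or> V' \<subseteq> V" using ganti by (metis imageE linear)
    qed simp
    then obtain j0 where "\<Inter>(range g) = g j0" by (rule rangeE)
    note j0 = this[symmetric]
    have "W k j = W k (j0 + k + 2)" if jj: "j \<ge> j0 + k + 2" for j
    proof -
      obtain i where i: "j = j0 + k + 2 + i" using le_iff_add[THEN iffD1, OF jj] by blast
      then have "W k j = g (j0 + i)" by (simp add: g_def ac_simps)
      moreover have "g (j0 + i) = g j0" using ganti[of j0 "j0 + i"] j0 by auto
      ultimately show ?thesis by (simp add: g_def)
    qed
    moreover have "k + 2 \<le> j0 + k + 2" by simp
    ultimately show ?thesis by blast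
  qed
  then obtain J where J: "\<And>k. J k \<ge> k + 2" "\<And>k j. j \<ge> J k \<Longrightarrow> W k j = W k (J k)" by metis
  \<comment> \<open>The elements at level \<open>k\<close> that agree modulo \<open>B (s k)\<close>
    with lifts from every deeper level. Restricted to them, each step of the inverse system is
    surjective.\<close>
  define A' where "A' k = {w \<in> Z (s k). \<forall>j\<ge>k. \<exists>a\<in>A j. a - w \<in> B (s k)}" for k
  have step: "\<exists>w'. w' \<in> A' (Suc k) \<and> w' - w \<in> B (s k)" if w: "w \<in> A' k" for k w
  proof -
    have "k \<le> J k" using J(1)[of k] by simp
    then obtain a where a: "a \<in> A (J k)" "a - w \<in> B (s k)" using w unfolding A'_def by blast
    have "\<exists>a'\<in>A j. a' - a \<in> B (s (Suc k))" if "j \<ge> Suc k" for j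
    proof (cases "j \<le> J k")
      case True
      then have "a \<in> A j" using a(1) Aanti by blast
      then show ?thesis using B_zero by force
    next
      case False
      \<comment> \<open>An arbitrary lift \<open>c\<close> from the deep level \<open>j\<close>
        differs from \<open>a\<close> by an element of \<open>N (J k)\<close>. By stability it can
        be replaced, modulo \<open>B (s (Suc k))\<close>, by an element of \<open>N j\<close>, and
        adding that to \<open>c\<close> corrects it.\<close>
      obtain c where c: "c \<in> A j" using Ane by blast
      have "c \<in> A (J k)" using c False Aanti[of "J k" j] by auto
      then have "a - c \<in> N (J k)"
        using a(1) Z_diff B_diff_trans[OF _ B_diff_sym, of a v t c] by (auto simp: A_def N_def)
      then have "a - c \<in> W k (J k)" unfolding W_def using B_zero by force
      then have "a - c \<in> W k j" using J(2)[of k j] False by auto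
      then obtain n where n: "n \<in> N j" "(a - c) - n \<in> B (s (Suc k))" by (auto simp: W_def)
      have "(c + n) - v \<in> B t" using B_add[of "c - v" t n] c n(1) by (simp add: A_def N_def algebra_simps)
      then have "c + n \<in> A j" using c n(1) Z_add by (auto simp: A_def N_def)
      moreover have "(c + n) - a \<in> B (s (Suc k))"
        using B_diff[OF B_zero n(2)] by (simp add: algebra_simps)
      ultimately show ?thesis by blast
    qed
    moreover have "a \<in> Z (s (Suc k))" using a(1) mono_Z[OF santi'[of "Suc k" "J k"]] J(1)[of k] by (auto simp: A_def)
    ultimately have "a \<in> A' (Suc k)" by (auto simp: A'_def)
    then show ?thesis using a(2) by blast
  qed
  obtain y0 where y0: "y0 \<in> A 0" using Ane by blast
  have "y0 \<in> A' 0"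
  proof -
    have "\<exists>a\<in>A j. a - y0 \<in> B t" for j
    proof -
      obtain a where "a \<in> A j" using Ane by blast
      then show ?thesis using y0 B_diff_trans[OF _ B_diff_sym, of a v t y0] by (auto simp: A_def)
    qed
    then show ?thesis using y0 s0 by (auto simp: A'_def A_def)
  qed
  then obtain x where x: "x 0 = y0" "\<And>k. x k \<in> A' k" "\<And>k. x (Suc k) - x k \<in> B (s k)"
    using dependent_nat_choice[of "\<lambda>n x. x \<in> A' n \<and> (n = 0 \<longrightarrow> x = y0)" "\<lambda>n x y. y - x \<in> B (s n)"] step
    by (metis nat.distinct(1))
  have xc: "x j - x k \<in> B (s k)" if "k \<le> j" for j k
    using that
  proof (induction j rule: dec_induct)
    case base then show ?case using B_zero by simp
  next
    case (step j)
    have "x (Suc j) - x j \<in> B (s k)" using x(3)[of j] mono_B[OF santi'[of k j]] step by auto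
    then show ?case using B_diff_trans step by blast
  qed
  \<comment> \<open>\<open>s (kk u)\<close> is the largest term of the sequence that does not exceed
    \<open>u\<close>; for \<open>u \<ge> t\<close> it is \<open>s 0 = t\<close>.\<close>
  define kk where "kk u = (LEAST k. s k \<le> u)" for u
  have kk: "s (kk u) \<le> u" if "b < u" for u unfolding kk_def by (rule LeastI_ex[OF slim[OF that]])
  have kkle: "kk u \<le> k" if "s k \<le> u" for k u unfolding kk_def using that by (rule Least_le)
  define w where "w u = x (kk u)" for u
  have "w \<in> curve b" unfolding curve_def
  proof (intro CollectI conjI allI impI)
    fix u assume u: "b < u"
    show "w u \<in> Z u" using x(2)[of "kk u"] mono_Z[OF kk[OF u]] by (auto simp: w_def A'_def)
    fix u' assume u': "u \<le> u'"
    then have "kk u' \<le> kk u" using kk[OF u] by (intro kkle) simp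
    then show "w u - w u' \<in> B u'"
      using xc[of "kk u'" "kk u"] mono_B[OF kk[of u']] u u' by (auto simp: w_def)
  qed
  moreover have "kk t = 0" using kkle[of 0 t] s0 by simp
  then have "w t - v \<in> B t" using y0 x(1) by (simp add: w_def A_def)
  ultimately show ?thesis by blast
qed

text \<open>Evaluation at a parameter \<open>t\<close> in \<open>(b, d]\<close> keeps the generators
  independent and lands in the image of the module at a parameter between \<open>b\<close> and
  \<open>t\<close>, which \<open>tame\<close> makes finite-dimensional. Finiteness permits natural
  numbers as tags.\<close>

lemma finite_gens:
  assumes bd: "ereal b < d"
  shows "finite (gens b d)"
proof -
  obtain t where t: "b < t" "ereal t \<le> d" using ereal_dense2[OF bd] by force
  define s where "s = (b + t) / 2"
  have s: "b < s" "s < t" using t by (auto simp: s_def)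
  obtain F where F: "finite F" "Z s \<subseteq> span (F \<union> B t)" using tame[OF s(2)] by blast
  show ?thesis
  proof (rule finite_independent_mod[OF subspace_B F(1), where f = "\<lambda>e. e t"])
    fix e assume "e \<in> gens b d"
    then have e: "e \<in> curve b" using gens(1)[OF bd] by (auto simp: dying_def)
    have "e t \<in> plus_B s t"
      unfolding plus_B_def using curveD[OF e s(1)] B_diff_sym[OF curve_coh[OF e s(1), of t]] s(2) by force
    then show "e t \<in> span (F \<union> B t)" using plus_B_span[OF F(2)] by blast
  next
    fix A a assume A: "finite A" "A \<subseteq> gens b d" "(\<Sum>e\<in>A. a e *s e t) \<in> B t"
    define A' where "A' = (\<lambda>e. (b, d, e)) ` A"
    have "(\<Sum>(b,d,e)\<in>A'. a e *s e t) = (\<Sum>e\<in>A. a e *s e t)"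
      unfolding A'_def by (subst sum.reindex) (auto simp: inj_on_def)
    then have "\<forall>i\<in>A'. (\<lambda>(b,d,e). a e) i = 0"
      using A t bd by (intro independent_at[of _ t]) (auto simp: A'_def index_def)
    then show "\<forall>e\<in>A. a e = 0" by (auto simp: A'_def)
  qed
qed

text \<open>Suppose that the bars alive at \<open>t\<close> miss a class. Take the least
  \<open>b\<close> such that a missed class extends back to all parameters after \<open>b\<close>,
  then the least death \<open>d0\<close> of a missed class among those. \<open>curve_lift\<close>
  turns it into a curve in \<open>dying b d0\<close>. Modulo generators this curve is in
  \<open>decomp b d0\<close>, so it is the sum of a class existing at \<open>b\<close> and one that
  is zero at some \<open>u \<le> d0\<close>. Continuity from the left moves both strictly below the
  minima, where nothing is missed.\<close>

lemma spanning_at: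
  "Z t \<subseteq> span ((\<lambda>(b,d,e). e t) ` {(b,d,e) \<in> index. b < t \<and> ereal t \<le> d} \<union> B t)" (is "_ \<subseteq> ?S")
proof (rule ccontr)
  assume "\<not> Z t \<subseteq> ?S"
  then obtain v where v: "v \<in> Z t" "v \<notin> ?S" by blast
  have BS: "B t \<subseteq> ?S" using span_superset by blast
  have tpos: "0 < t"
  proof (rule ccontr)
    assume "\<not> 0 < t"
    then show False using Z_nonpos[of t] v BS by auto
  qed
  obtain s where s: "s < t" "v \<in> Z s" using left_Z[OF v(1)] by blast
  \<comment> \<open>The second step back ensures that the birth \<open>b \<le> s'\<close> found
    below is less than \<open>s\<close>, so that curves starting at \<open>b\<close> take values at
    \<open>t\<close> in \<open>plus_B s t\<close>.\<close>
  obtain s' where s': "s' < s" "v \<in> Z s'" using left_Z[OF s(2)] by blast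
  obtain F where F: "finite F" "Z s \<subseteq> span (F \<union> B t)" using tame[OF s(1)] by blast
  define Fam where "Fam c = {x \<in> plus_B s t. \<forall>u\<le>t. c < ereal u \<longrightarrow> x \<in> plus_B u t}" for c
  have subsp_Fam: "subspace (Fam c)" for c
  proof (rule subspaceI)
    show "0 \<in> Fam c" using subspace_0[OF subspace_plus_B] by (auto simp: Fam_def)
  qed (auto simp: Fam_def intro: subspace_add[OF subspace_plus_B] subspace_scale[OF subspace_plus_B])
  have B_Fam: "B t \<subseteq> Fam c" for c using B_sub_plus_B by (auto simp: Fam_def)
  have Fam_span: "Fam c \<subseteq> span (F \<union> B t)" for c using plus_B_span[OF F(2)] by (auto simp: Fam_def)
  have Fam_mono: "Fam c \<subseteq> Fam c'" if "c \<le> c'" for c c' using that by (auto simp: Fam_def)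
  define b0 where "b0 = Inf {c. \<not> Fam c \<subseteq> ?S}"
  have "v \<in> Fam (ereal s')"
    using s s' Z_sub_plus_B mono_Z[of s'] by (auto simp: Fam_def intro!: Z_sub_plus_B[THEN subsetD] mono_Z[THEN subsetD, OF _ s'(2)])
  then have nFam: "\<not> Fam (ereal s') \<subseteq> ?S" using v(2) by blast
  have b0S: "\<not> Fam b0 \<subseteq> ?S" unfolding b0_def
  proof (rule finite_family_Inf[where H = Fam, OF Fam_mono _ _ nFam])
    fix c x assume "c < \<infinity>" and x: "\<And>c'. c < c' \<Longrightarrow> x \<in> Fam c'"
    have "x \<in> plus_B u t" if "u \<le> t" "c < ereal u" for u
      using ereal_dense2[OF that(2)] x that(1) by (auto simp: Fam_def)
    moreover have "x \<in> plus_B s t" using x[OF \<open>c < \<infinity>\<close>] by (auto simp: Fam_def)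
    ultimately show "x \<in> Fam c" by (auto simp: Fam_def)
  next
    show "finite (range Fam)"
    proof (rule finite_chain_between[OF subspace_B F(1)])
      fix V V' assume "V \<in> range Fam" "V' \<in> range Fam"
      then show "V \<subseteq> V' \<or> V' \<subseteq> V" using Fam_mono by (metis imageE linear)
    qed (use subsp_Fam B_Fam Fam_span in blast)
  qed
  have lower: "Fam c \<subseteq> ?S" if "c < b0" for c
    using that unfolding b0_def by (metis (mono_tags, lifting) Inf_lower mem_Collect_eq not_le)
  have "b0 \<le> ereal s'" unfolding b0_def using nFam by (intro Inf_lower) auto
  moreover have "0 \<le> b0" unfolding b0_def
  proof (rule Inf_greatest)
    fix c assume "c \<in> {c. \<not> Fam c \<subseteq> ?S}"
    show "0 \<le> c"
    proof (rule ccontr)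
      assume "\<not> 0 \<le> c"
      then have "Fam c \<subseteq> plus_B 0 t" using tpos by (auto simp: Fam_def not_le zero_ereal_def)
      also have "\<dots> \<subseteq> B t"
        using Z_nonpos[of 0] mono_B[of 0 t] tpos B_diff_cancel by (auto simp: plus_B_def)
      finally show False using \<open>c \<in> _\<close> BS by auto
    qed
  qed
  ultimately obtain b where b: "b0 = ereal b" "b \<le> s'" by (cases b0) auto
  have bs: "b < s" "b < t" using b s s' by auto
  have curve_Fam: "w t \<in> Fam (ereal b)" if w: "w \<in> curve b" for w
  proof -
    have "w t \<in> plus_B u t" if "b < u" "u \<le> t" for u
      unfolding plus_B_def using curveD[OF w that(1)] B_diff_sym[OF curve_coh[OF w that]] by blast
    then show ?thesis using bs s(1) by (auto simp: Fam_def)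
  qed
  \<comment> \<open>A class that exists at \<open>b\<close> exists already before \<open>b\<close>,
    where minimality applies.\<close>
  have Zb: "Z b \<subseteq> ?S"
  proof
    fix y assume "y \<in> Z b"
    then obtain c where c: "c < b" "y \<in> Z c" using left_Z by blast
    then have "y \<in> Fam (ereal c)"
      using bs by (auto simp: Fam_def intro!: Z_sub_plus_B[THEN subsetD] mono_Z[THEN subsetD, OF _ c(2)])
    then show "y \<in> ?S" using lower[of "ereal c"] c(1) b(1) by auto
  qed
  define H where "H d = {x \<in> Fam (ereal b). \<forall>u\<ge>t. d < ereal u \<longrightarrow> x \<in> B u}" for d
  have H_mono: "H d \<subseteq> H d'" if "d \<le> d'" for d d' using that by (auto simp: H_def)
  define d0 where "d0 = Inf {d. \<not> H d \<subseteq> ?S}"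
  have "H \<infinity> = Fam (ereal b)" by (auto simp: H_def)
  then have nH: "\<not> H \<infinity> \<subseteq> ?S" using b0S b(1) by simp
  have d0S: "\<not> H d0 \<subseteq> ?S" unfolding d0_def
  proof (rule finite_family_Inf[where H = H, OF H_mono _ _ nH])
    fix d x assume "d < \<infinity>" and x: "\<And>d'. d < d' \<Longrightarrow> x \<in> H d'"
    have "x \<in> B u" if "u \<ge> t" "d < ereal u" for u
      using ereal_dense2[OF that(2)] x that(1) by (auto simp: H_def)
    moreover have "x \<in> Fam (ereal b)" using x[OF \<open>d < \<infinity>\<close>] by (auto simp: H_def)
    ultimately show "x \<in> H d" by (auto simp: H_def)
  next
    show "finite (range H)"
    proof (rule finite_chain_between[OF subspace_B F(1)])
      fix V assume "V \<in> range H"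
      then obtain d where V: "V = H d" by auto
      have "subspace V" unfolding V
      proof (rule subspaceI)
        show "0 \<in> H d" using subspace_0[OF subsp_Fam] B_zero by (auto simp: H_def)
      qed (auto simp: H_def intro: subspace_add[OF subsp_Fam] subspace_scale[OF subsp_Fam] B_add B_scale)
      moreover have "B t \<subseteq> V" unfolding V H_def using B_Fam mono_B by blast
      moreover have "V \<subseteq> span (F \<union> B t)" unfolding V using Fam_span by (auto simp: H_def)
      ultimately show "subspace V \<and> B t \<subseteq> V \<and> V \<subseteq> span (F \<union> B t)" by blast
    next
      fix V V' assume "V \<in> range H" "V' \<in> range H"
      then show "V \<subseteq> V' \<or> V' \<subseteq> V" using H_mono by (metis imageE linear)
    qed
  qed
  have lowerH: "H d \<subseteq> ?S" if "d < d0" for d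
    using that unfolding d0_def by (metis (mono_tags, lifting) Inf_lower mem_Collect_eq not_le)
  have td: "ereal t \<le> d0" unfolding d0_def
  proof (rule Inf_greatest, rule ccontr)
    fix d assume "d \<in> {d. \<not> H d \<subseteq> ?S}" "\<not> ereal t \<le> d"
    then show False using BS by (auto simp: H_def not_le)
  qed
  have bd: "ereal b < d0" using bs td by (metis less_ereal.simps(1) order_less_le_trans)
  obtain x where x: "x \<in> H d0" "x \<notin> ?S" using d0S by blast
  obtain w where w: "w \<in> curve b" "w t - x \<in> B t"
    using curve_lift[OF bs(2), of x] x(1) by (auto simp: H_def Fam_def)
  have "w \<in> dying b d0" unfolding dying_def
  proof (intro CollectI conjI allI impI)
    fix u assume u: "b < u" "d0 < ereal u"
    then have "t \<le> u" using td by (metis ereal_less_eq(3) less_imp_le order_le_less_trans)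
    then have "w u - w t \<in> B u" "w t - x \<in> B u" "x \<in> B u"
      using B_diff_sym[OF curve_coh[OF w(1) bs(2)]] w(2) mono_B[of t u] x(1) u by (auto simp: H_def)
    then show "w u \<in> B u" using B_diff_cancel by blast
  qed (rule w(1))
  then have "w \<in> curves.span (gens b d0 \<union> decomp b d0)" using gens(2)[OF bd] by blast
  also have "curves.span (gens b d0 \<union> decomp b d0) \<subseteq> {w. w t \<in> ?S}"
  proof (rule curves.span_minimal)
    show "curves.subspace {w. w t \<in> ?S}"
      by (rule curves.subspaceI) (auto simp: span_zero intro: span_add span_scale)
    have "e t \<in> ?S" if "e \<in> gens b d0" for e
      using that bd bs td by (intro span_base UnI1) (force simp: index_def)
    moreover have "x t \<in> ?S" if xd: "x \<in> decomp b d0" for x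
    proof -
      obtain y u where y: "y \<in> Z b" "b < u" "ereal u \<le> d0" "x u - y \<in> B u"
        using xd unfolding decomp_def by blast
      have xc: "x \<in> curve b" using xd by (auto simp: decomp_def dying_def)
      define \<kappa> where "\<kappa> u = x u - y" for u
      have \<kappa>: "\<kappa> \<in> curve b"
        using xc y(1) mono_Z[OF less_imp_le, of b] by (auto simp: curve_def \<kappa>_def intro!: Z_diff)
      have "\<kappa> t \<in> ?S"
      proof (cases "u \<le> t")
        case True
        then have "\<kappa> t \<in> B t" using curve_B_mono[OF \<kappa> y(2)] y(4) by (auto simp: \<kappa>_def)
        then show ?thesis using BS by blast
      next
        case False
        then have "\<kappa> t \<in> B u"
          using B_diff_cancel[OF curve_coh[OF \<kappa> bs(2), of u]] y(4) by (auto simp: \<kappa>_def)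
        \<comment> \<open>Continuity of the boundaries makes the death strictly earlier than
          \<open>u \<le> d0\<close>, so that the minimality of \<open>d0\<close> applies.\<close>
        then obtain u' where u': "u' < u" "\<kappa> t \<in> B u'" using left_B by blast
        define m where "m = max t u'"
        have m: "m < u" "\<kappa> t \<in> B m" using u' False mono_B[of u' m] by (auto simp: m_def)
        then have "\<kappa> t \<in> H (ereal m)"
          using curve_Fam[OF \<kappa>] mono_B[OF less_imp_le, of m] by (auto simp: H_def)
        moreover have "ereal m < d0" using m(1) y(3) by (metis less_ereal.simps(1) order_less_le_trans)
        ultimately show ?thesis using lowerH by blast
      qed
      then show ?thesis using span_add[of "\<kappa> t" _ y] Zb y(1) by (auto simp: \<kappa>_def)
    qed
    ultimately show "gens b d0 \<union> decomp b d0 \<subseteq> {w. w t \<in> ?S}" by blast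
  qed
  finally have "w t \<in> ?S" by simp
  moreover have "w t - x \<in> ?S" using w(2) BS by blast
  ultimately have "w t - (w t - x) \<in> ?S" by (rule span_diff)
  then show False using x(2) by simp
qed

text \<open>Tags number the generators of one pair \<open>(b, d)\<close>, so that bars with equal
  endpoints stay apart. A curve has coherent values beyond its bar, which are boundaries there; this
  gives the condition on \<open>\<epsilon>'\<close> after the end of the bar.\<close>

theorem barcode_exists:
  "\<exists>(Bar :: tagged_bar set) (z :: tagged_bar \<Rightarrow> real \<Rightarrow> 'v).
    (\<forall>\<beta>\<in>Bar. ereal (fst (fst \<beta>)) < snd (fst \<beta>)) \<and>
    (\<forall>\<beta>\<in>Bar. \<forall>\<epsilon>\<in>bar_set (fst \<beta>). z \<beta> \<epsilon> \<in> Z \<epsilon>) \<and>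
    (\<forall>\<beta>\<in>Bar. \<forall>\<epsilon>\<in>bar_set (fst \<beta>). \<forall>\<epsilon>'\<ge>\<epsilon>.
       z \<beta> \<epsilon> - (if \<epsilon>' \<in> bar_set (fst \<beta>) then z \<beta> \<epsilon>' else 0) \<in> B \<epsilon>') \<and>
    (\<forall>\<epsilon>. Z \<epsilon> \<subseteq> span ((\<lambda>\<beta>. z \<beta> \<epsilon>) ` {\<beta>\<in>Bar. \<epsilon> \<in> bar_set (fst \<beta>)} \<union> B \<epsilon>)) \<and>
    (\<forall>\<epsilon> A a. finite A \<and> A \<subseteq> {\<beta>\<in>Bar. \<epsilon> \<in> bar_set (fst \<beta>)} \<and> (\<Sum>\<beta>\<in>A. a \<beta> *s z \<beta> \<epsilon>) \<in> B \<epsilon> \<longrightarrow>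
       (\<forall>\<beta>\<in>A. a \<beta> = 0))"
proof -
  define Bar :: "tagged_bar set" where
    "Bar = {((b, d), k). ereal b < d \<and> k \<in> to_nat_on (gens b d) ` gens b d}"
  define z :: "tagged_bar \<Rightarrow> real \<Rightarrow> 'v" where
    "z = (\<lambda>((b, d), k). from_nat_into (gens b d) k)"
  define h :: "tagged_bar \<Rightarrow> real \<times> ereal \<times> (real \<Rightarrow> 'v)" where
    "h \<beta> = (fst (fst \<beta>), snd (fst \<beta>), z \<beta>)" for \<beta>
  have cnt: "countable (gens b d)" if "ereal b < d" for b d
    using finite_gens[OF that] by (rule countable_finite)
  have inv: "from_nat_into (gens b d) (to_nat_on (gens b d) e) = e" if "ereal b < d" "e \<in> gens b d" for b d e
    using from_nat_into_to_nat_on[OF cnt[OF that(1)] that(2)] .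
  have z: "z ((b, d), to_nat_on (gens b d) e) = e" if "ereal b < d" "e \<in> gens b d" for b d e
    using inv that by (simp add: z_def)
  have h_index: "h ` Bar = index"
  proof (intro equalityI subsetI)
    fix i assume "i \<in> index"
    then obtain b d e where i: "i = (b, d, e)" "ereal b < d" "e \<in> gens b d" by (auto simp: index_def)
    then have "i = h ((b, d), to_nat_on (gens b d) e)" "((b, d), to_nat_on (gens b d) e) \<in> Bar"
      using z by (auto simp: h_def Bar_def)
    then show "i \<in> h ` Bar" by blast
  qed (auto simp: Bar_def h_def index_def z)
  have h_inj: "inj_on h Bar"
  proof (rule inj_onI)
    fix \<beta> \<gamma> assume "\<beta> \<in> Bar" "\<gamma> \<in> Bar" "h \<beta> = h \<gamma>"
    then show "\<beta> = \<gamma>" by (auto simp: Bar_def h_def z)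
  qed
  have zc: "z \<beta> \<in> dying (fst (fst \<beta>)) (snd (fst \<beta>))" if "\<beta> \<in> Bar" for \<beta>
  proof -
    have "h \<beta> \<in> index" using that h_index by blast
    then show ?thesis using gens(1) by (auto simp: h_def index_def)
  qed
  have bars: "\<epsilon> \<in> bar_set (fst \<beta>) \<longleftrightarrow> fst (h \<beta>) < \<epsilon> \<and> ereal \<epsilon> \<le> fst (snd (h \<beta>))" for \<epsilon> \<beta>
    by (auto simp: bar_set_def h_def)
  show ?thesis
  proof (intro exI[of _ Bar] exI[of _ z] conjI ballI allI impI)
    fix \<beta> assume "\<beta> \<in> Bar"
    then show "ereal (fst (fst \<beta>)) < snd (fst \<beta>)" by (auto simp: Bar_def)
  next
    fix \<beta> \<epsilon> assume \<beta>: "\<beta> \<in> Bar" "\<epsilon> \<in> bar_set (fst \<beta>)"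
    then have c: "z \<beta> \<in> curve (fst (fst \<beta>))" "fst (fst \<beta>) < \<epsilon>" using zc by (auto simp: dying_def bar_set_def)
    show "z \<beta> \<epsilon> \<in> Z \<epsilon>" using curveD[OF c] .
    fix \<epsilon>' assume \<epsilon>': "\<epsilon> \<le> \<epsilon>'"
    show "z \<beta> \<epsilon> - (if \<epsilon>' \<in> bar_set (fst \<beta>) then z \<beta> \<epsilon>' else 0) \<in> B \<epsilon>'"
    proof (cases "\<epsilon>' \<in> bar_set (fst \<beta>)")
      case True
      then show ?thesis using curve_coh[OF c \<epsilon>'] by simp
    next
      case False
      then have "snd (fst \<beta>) < ereal \<epsilon>'" "fst (fst \<beta>) < \<epsilon>'" using c(2) \<epsilon>' by (auto simp: bar_set_def)
      then have "z \<beta> \<epsilon>' \<in> B \<epsilon>'" using zc[OF \<beta>(1)] by (auto simp: dying_def)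
      then show ?thesis using False B_diff_cancel[OF curve_coh[OF c \<epsilon>']] by simp
    qed
  next
    fix \<epsilon>
    have "(\<lambda>(b,d,e). e \<epsilon>) ` {(b,d,e) \<in> index. b < \<epsilon> \<and> ereal \<epsilon> \<le> d} =
        (\<lambda>\<beta>. z \<beta> \<epsilon>) ` {\<beta>\<in>Bar. \<epsilon> \<in> bar_set (fst \<beta>)}"
      unfolding h_index[symmetric] bars by (force simp: h_def image_iff)
    then show "Z \<epsilon> \<subseteq> span ((\<lambda>\<beta>. z \<beta> \<epsilon>) ` {\<beta>\<in>Bar. \<epsilon> \<in> bar_set (fst \<beta>)} \<union> B \<epsilon>)"
      using spanning_at[of \<epsilon>] by simp
  next
    fix \<epsilon> A a \<beta>
    assume *: "finite A \<and> A \<subseteq> {\<beta>\<in>Bar. \<epsilon> \<in> bar_set (fst \<beta>)} \<and> (\<Sum>\<beta>\<in>A. a \<beta> *s z \<beta> \<epsilon>) \<in> B \<epsilon>" and "\<beta> \<in> A"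
    then have inj: "inj_on h A" using h_inj inj_on_subset by blast
    define a' where "a' = a \<circ> inv_into A h"
    have a'h: "a' (h \<beta>) = a \<beta>" if "\<beta> \<in> A" for \<beta> using that by (simp add: a'_def inv_into_f_f[OF inj])
    have hz: "snd (snd (h \<beta>)) = z \<beta>" for \<beta> by (simp add: h_def)
    have "(\<Sum>(b,d,e)\<in>h ` A. a' (b,d,e) *s e \<epsilon>) = (\<Sum>i\<in>h ` A. a' i *s snd (snd i) \<epsilon>)"
      by (simp add: case_prod_beta)
    also have "\<dots> = (\<Sum>\<beta>\<in>A. a \<beta> *s z \<beta> \<epsilon>)"
      unfolding sum.reindex[OF inj] o_def hz by (intro sum.cong refl) (simp add: a'h)
    finally have "(\<Sum>(b,d,e)\<in>h ` A. a' (b,d,e) *s e \<epsilon>) = (\<Sum>\<beta>\<in>A. a \<beta> *s z \<beta> \<epsilon>)" .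
    then have sumB: "(\<Sum>(b,d,e)\<in>h ` A. a' (b,d,e) *s e \<epsilon>) \<in> B \<epsilon>" using * by simp
    have "\<forall>i\<in>h ` A. a' i = 0"
    proof (rule independent_at[OF _ _ _ sumB])
      show "h ` A \<subseteq> index" using * h_index by blast
      fix b d e assume "(b, d, e) \<in> h ` A"
      then obtain \<gamma> where \<gamma>: "\<gamma> \<in> A" "(b, d, e) = h \<gamma>" by blast
      then have "\<epsilon> \<in> bar_set (fst \<gamma>)" using * by blast
      then show "b < \<epsilon> \<and> ereal \<epsilon> \<le> d" unfolding bars \<gamma>(2)[symmetric] by simp
    qed (use * in blast)
    then show "a \<beta> = 0" using \<open>\<beta> \<in> A\<close> a'h[of \<beta>] by simp
  qed
qed

end

section \<open>Chains\<close>

abbreviation lookup :: "('g \<Rightarrow>\<^sub>0 'k::zero) \<Rightarrow> 'g \<Rightarrow> 'k" where "lookup \<equiv> Poly_Mapping.lookup"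
abbreviation keys :: "('g \<Rightarrow>\<^sub>0 'k::zero) \<Rightarrow> 'g set" where "keys \<equiv> Poly_Mapping.keys"

text \<open>Chains are taken in the type of finitely supported functions, which as a whole is a
  vector space, so that the linear algebra needs no carrier sets; \<open>lookup\<close> leads back
  to coefficient functions.\<close>

definition smul :: "'k::field \<Rightarrow> ('g \<Rightarrow>\<^sub>0 'k) \<Rightarrow> ('g \<Rightarrow>\<^sub>0 'k)" where
  "smul a c = Poly_Mapping.map ((*) a) c"

lemma lookup_smul [simp]: "lookup (smul a c) g = a * lookup c g"
  by (simp add: smul_def Poly_Mapping.map.rep_eq when_def)

interpretation pm: vector_space "smul :: 'k::field \<Rightarrow> ('g \<Rightarrow>\<^sub>0 'k) \<Rightarrow> _"
  by standard (auto intro!: poly_mapping_eqI simp: lookup_add algebra_simps)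

definition bas :: "'g \<Rightarrow> ('g \<Rightarrow>\<^sub>0 'k::field)" where
  "bas g = Poly_Mapping.single g 1"

lemma lookup_bas: "lookup (bas g :: 'g \<Rightarrow>\<^sub>0 'k::field) h = (if g = h then 1 else 0)"
  by (simp add: bas_def lookup_single when_def)

lemma keys_bas [simp]: "keys (bas g :: 'g \<Rightarrow>\<^sub>0 'k::field) = {g}"
  by (simp add: bas_def)

text \<open>Linear extension from generators. Boundary, prism and pushforward have this form, so
  identities between their composites are checked on generators through
  \<open>lin_lin\<close>.\<close>

definition lin :: "('g \<Rightarrow> ('h \<Rightarrow>\<^sub>0 'k)) \<Rightarrow> ('g \<Rightarrow>\<^sub>0 'k::field) \<Rightarrow> ('h \<Rightarrow>\<^sub>0 'k)" where
  "lin \<phi> c = (\<Sum>g\<in>keys c. smul (lookup c g) (\<phi> g))"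

lemma lin_superset: "finite A \<Longrightarrow> keys c \<subseteq> A \<Longrightarrow> lin \<phi> c = (\<Sum>g\<in>A. smul (lookup c g) (\<phi> g))"
  unfolding lin_def by (intro sum.mono_neutral_left) (auto simp: in_keys_iff)

lemma linear_lin: "Vector_Spaces.linear smul smul (lin \<phi>)"
proof (rule Vector_Spaces.linear_iff[THEN iffD2], intro conjI allI)
  fix x y
  have "lin \<phi> (x + y) = (\<Sum>g\<in>keys x \<union> keys y. smul (lookup (x + y) g) (\<phi> g))"
    by (rule lin_superset) (auto simp: Poly_Mapping.keys_add)
  also have "\<dots> = lin \<phi> x + lin \<phi> y"
    by (simp add: lin_superset[of "keys x \<union> keys y"] lookup_add pm.scale_left_distrib sum.distrib)
  finally show "lin \<phi> (x + y) = lin \<phi> x + lin \<phi> y" .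
next
  fix a x
  have "lin \<phi> (smul a x) = (\<Sum>g\<in>keys x. smul (lookup (smul a x) g) (\<phi> g))"
    by (rule lin_superset) (auto simp: in_keys_iff)
  then show "lin \<phi> (smul a x) = smul a (lin \<phi> x)"
    by (simp add: lin_def pm.scale_sum_right)
qed (rule pm.vector_space_axioms)+

interpretation lin: Vector_Spaces.linear "smul :: 'k::field \<Rightarrow> ('g \<Rightarrow>\<^sub>0 'k) \<Rightarrow> _" "smul :: 'k \<Rightarrow> ('h \<Rightarrow>\<^sub>0 'k) \<Rightarrow> _" "lin \<phi>"
  for \<phi> :: "'g \<Rightarrow> ('h \<Rightarrow>\<^sub>0 'k::field)"
  by (rule linear_lin)

lemma lin_bas [simp]: "lin \<phi> (bas g) = \<phi> g"
  by (simp add: lin_def lookup_bas)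

lemma lin_bas_id [simp]: "lin bas c = c"
  by (rule poly_mapping_eqI) (simp add: lin_def lookup_sum lookup_bas if_distrib in_keys_iff cong: if_cong)

lemma lin_lin: "lin \<phi> (lin \<psi> c) = lin (\<lambda>g. lin \<phi> (\<psi> g)) c"
  unfolding lin_def[of \<psi>] lin_def[of "\<lambda>g. lin \<phi> (\<psi> g)"] by (simp add: lin.sum lin.scale)

lemma lin_cong: "(\<And>g. g \<in> keys c \<Longrightarrow> \<phi> g = \<psi> g) \<Longrightarrow> lin \<phi> c = lin \<psi> c"
  by (simp add: lin_def)

lemma lin_diff_fun: "lin (\<lambda>g. \<phi> g - \<psi> g) c = lin \<phi> c - lin \<psi> c"
  by (simp add: lin_def pm.scale_right_diff_distrib sum_subtractf)

lemma lin_add_fun: "lin (\<lambda>g. \<phi> g + \<psi> g) c = lin \<phi> c + lin \<psi> c"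
  by (simp add: lin_def pm.scale_right_distrib sum.distrib)

lemma lin_zero_fun [simp]: "lin (\<lambda>g. 0) c = 0"
  by (simp add: lin_def)

lemma keys_smul: "keys (smul a c) \<subseteq> keys c"
  by (auto simp: in_keys_iff)

lemma keys_sum: "keys (\<Sum>i\<in>A. f i) \<subseteq> (\<Union>i\<in>A. keys (f i))"
proof (induction A rule: infinite_finite_induct)
  case (insert i A)
  then show ?case using Poly_Mapping.keys_add[of "f i" "sum f A"] by auto
qed auto

lemma keys_lin: "keys (lin \<phi> c) \<subseteq> (\<Union>g\<in>keys c. keys (\<phi> g))"
proof -
  have "keys (lin \<phi> c) \<subseteq> (\<Union>g\<in>keys c. keys (smul (lookup c g) (\<phi> g)))"
    unfolding lin_def by (rule keys_sum)
  also have "\<dots> \<subseteq> (\<Union>g\<in>keys c. keys (\<phi> g))"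
    by (intro UN_mono order_refl keys_smul)
  finally show ?thesis .
qed

lemma keys_diff': "keys (x - y :: 'g \<Rightarrow>\<^sub>0 'k::field) \<subseteq> keys x \<union> keys y"
  by (auto simp: in_keys_iff lookup_minus)

definition push :: "('g \<Rightarrow> 'h) \<Rightarrow> ('g \<Rightarrow>\<^sub>0 'k::field) \<Rightarrow> ('h \<Rightarrow>\<^sub>0 'k)" where
  "push f = lin (\<lambda>g. bas (f g))"

lemma push_bas [simp]: "push f (bas g) = bas (f g)"
  by (simp add: push_def)

lemma lin_push: "lin \<phi> (push f c) = lin (\<lambda>g. \<phi> (f g)) c"
  by (simp add: push_def lin_lin)

lemma push_lin: "push f (lin \<phi> c) = lin (\<lambda>g. push f (\<phi> g)) c"
  by (simp add: push_def lin_lin)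

lemma push_push: "push f (push g c) = push (\<lambda>x. f (g x)) c"
  by (simp add: push_def lin_lin)

lemma push_cong: "(\<And>g. g \<in> keys c \<Longrightarrow> f g = h g) \<Longrightarrow> push f c = push h c"
  by (simp add: push_def lin_def)

lemma push_id_on: "(\<And>g. g \<in> keys c \<Longrightarrow> f g = g) \<Longrightarrow> push f c = c"
  using push_cong[of c f "\<lambda>g. g"] by (simp add: push_def)

lemma keys_push: "keys (push f c) \<subseteq> f ` keys c"
  using keys_lin[of "\<lambda>g. bas (f g)" c] by (auto simp: push_def)

lemma push_diff: "push f (x - y) = push f x - push f y"
  and push_add: "push f (x + y) = push f x + push f y"
  and push_uminus: "push f (- x) = - push f x"
  and push_smul: "push f (smul a x) = smul a (push f x)"
  and push_zero [simp]: "push f 0 = 0"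
  by (simp_all add: push_def lin.diff lin.add lin.neg lin.scale)

text \<open>The boundary of the augmented complex: \<open>bd [x] = bas []\<close>, in contrast to \<^const>\<open>boundary\<close>.
  The empty list serves as the base case of the induction on the degree.\<close>

fun bd :: "'v list \<Rightarrow> ('v list \<Rightarrow>\<^sub>0 'k::field)" where
  "bd [] = 0"
| "bd (x # s) = bas s - push (Cons x) (bd s)"

text \<open>Unfolded, the prism of \<open>[x0, ..., xm]\<close> is the alternating sum of the lists
  \<open>[x0, ..., xi, g xi, ..., g xm]\<close>, the standard homotopy between the identity and
  \<open>g\<close>.\<close>

fun prism :: "('v \<Rightarrow> 'v) \<Rightarrow> 'v list \<Rightarrow> ('v list \<Rightarrow>\<^sub>0 'k::field)" where
  "prism g [] = 0"
| "prism g (x # s) = bas (x # map g (x # s)) - push (Cons x) (prism g s)"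

lemma keys_bd: "t \<in> keys (bd s :: 'v list \<Rightarrow>\<^sub>0 'k::field) \<Longrightarrow> Suc (length t) = length s \<and> set t \<subseteq> set s"
proof (induction s arbitrary: t)
  case (Cons x s)
  have "keys (bd (x # s) :: 'v list \<Rightarrow>\<^sub>0 'k) \<subseteq> keys (bas s :: 'v list \<Rightarrow>\<^sub>0 'k) \<union> keys (push (Cons x) (bd s) :: 'v list \<Rightarrow>\<^sub>0 'k)"
    unfolding bd.simps by (rule keys_diff')
  then have "t = s \<or> t \<in> Cons x ` keys (bd s :: 'v list \<Rightarrow>\<^sub>0 'k)"
    using Cons.prems keys_push[of "Cons x" "bd s :: 'v list \<Rightarrow>\<^sub>0 'k"] by auto
  then show ?case
  proof
    assume "t \<in> Cons x ` keys (bd s :: 'v list \<Rightarrow>\<^sub>0 'k)"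
    then obtain u where "t = x # u" "u \<in> keys (bd s :: 'v list \<Rightarrow>\<^sub>0 'k)" by blast
    then show ?thesis using Cons.IH[of u] by auto
  qed auto
qed simp

lemma keys_prism:
  "t \<in> keys (prism g s :: 'v list \<Rightarrow>\<^sub>0 'k::field) \<Longrightarrow> length t = Suc (length s) \<and> set t \<subseteq> set s \<union> g ` set s"
proof (induction s arbitrary: t)
  case (Cons x s)
  have "keys (prism g (x # s) :: 'v list \<Rightarrow>\<^sub>0 'k) \<subseteq>
      keys (bas (x # map g (x # s)) :: 'v list \<Rightarrow>\<^sub>0 'k) \<union> keys (push (Cons x) (prism g s) :: 'v list \<Rightarrow>\<^sub>0 'k)"
    unfolding prism.simps by (rule keys_diff')
  then have "t = x # map g (x # s) \<or> t \<in> Cons x ` keys (prism g s :: 'v list \<Rightarrow>\<^sub>0 'k)"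
    using Cons.prems keys_push[of "Cons x" "prism g s :: 'v list \<Rightarrow>\<^sub>0 'k"] by auto
  then show ?case
  proof
    assume "t \<in> Cons x ` keys (prism g s :: 'v list \<Rightarrow>\<^sub>0 'k)"
    then obtain u where "t = x # u" "u \<in> keys (prism g s :: 'v list \<Rightarrow>\<^sub>0 'k)" by blast
    then show ?thesis using Cons.IH[of u] by auto
  qed auto
qed simp

lemma bd_map: "push (map f) (bd s :: 'v list \<Rightarrow>\<^sub>0 'k::field) = bd (map f s)"
proof (induction s)
  case (Cons x s)
  have "push (map f) (push (Cons x) (bd s :: 'v list \<Rightarrow>\<^sub>0 'k)) = push (Cons (f x)) (push (map f) (bd s))"
    by (simp add: push_push)
  then show ?case using Cons by (simp add: push_diff)
qed simp

text \<open>The cone formula with apex \<open>x\<close>; augmentation removes the exception in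
  degree 0.\<close>

lemma lin_bd_Cons: "lin bd (push (Cons x) c) = c - push (Cons x) (lin bd c)"
  by (simp add: lin_push lin_diff_fun push_lin)

lemma bd_bd: "lin bd (bd s) = 0"
  by (induction s) (simp_all add: lin.diff lin_bd_Cons)

lemma prism_bd:
  "lin bd (prism g s) + lin (prism g) (bd s) = (bas (map g s) - bas s :: 'v list \<Rightarrow>\<^sub>0 'k::field)"
proof (induction s)
  case (Cons x s)
  \<comment> \<open>Equations \<open>1\<close> and \<open>2\<close> both produce the lists
    \<open>x # g x # map g t\<close>, which cancel. What remains is the induction hypothesis with
    \<open>x\<close> prefixed.\<close>
  have 1: "lin (prism g) (push (Cons x) c) =
      push (\<lambda>t. x # g x # map g t) c - push (Cons x) (lin (prism g) c)" for c :: "'v list \<Rightarrow>\<^sub>0 'k"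
    by (simp add: lin_push lin_diff_fun push_lin) (simp add: push_def)
  have 2: "push (Cons x) (bd (g x # map g s)) =
      (bas (x # map g s) - push (\<lambda>t. x # g x # map g t) (bd s) :: 'v list \<Rightarrow>\<^sub>0 'k)"
    by (simp add: push_diff push_push bd_map[symmetric])
  have 3: "push (Cons x) (lin bd (prism g s)) + push (Cons x) (lin (prism g) (bd s)) =
      (bas (x # map g s) - bas (x # s) :: 'v list \<Rightarrow>\<^sub>0 'k)"
    unfolding push_add[symmetric] Cons.IH by (simp add: push_diff)
  have h1: "lin bd (prism g (x # s) :: 'v list \<Rightarrow>\<^sub>0 'k) = bas (map g (x # s)) - push (Cons x) (bd (g x # map g s))
      - (prism g s - push (Cons x) (lin bd (prism g s)))"
    by (simp add: lin.diff lin_bd_Cons)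
  have h2: "lin (prism g) (bd (x # s) :: 'v list \<Rightarrow>\<^sub>0 'k) = prism g s - (push (\<lambda>t. x # g x # map g t) (bd s)
      - push (Cons x) (lin (prism g) (bd s)))"
    by (simp add: lin.diff 1)
  show ?case unfolding h1 h2 2 using 3 by (simp add: algebra_simps)
qed simp

lemma prism_map:
  assumes "\<And>x. x \<in> set s \<Longrightarrow> f (g x) = g' (f x)"
  shows "push (map f) (prism g s :: 'v list \<Rightarrow>\<^sub>0 'k::field) = prism g' (map f s)"
  using assms
proof (induction s)
  case (Cons x s)
  have "push (map f) (push (Cons x) (prism g s :: 'v list \<Rightarrow>\<^sub>0 'k)) = push (Cons (f x)) (push (map f) (prism g s))"
    by (simp add: push_push)
  moreover have m: "map (\<lambda>x. f (g x)) s = map (\<lambda>x. g' (f x)) s" using Cons.prems by simp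
  ultimately show ?case using Cons by (simp add: push_diff o_def m)
qed simp

text \<open>A generator \<open>(s, a)\<close> is a simplex \<open>s\<close> together with an apex \<open>a\<close>, which is a parameter for the
  boundary.\<close>

definition bd2 :: "'v list \<times> 'w \<Rightarrow> ('v list \<times> 'w \<Rightarrow>\<^sub>0 'k::field)" where
  "bd2 p = push (\<lambda>t. (t, snd p)) (bd (fst p))"

definition prism2 :: "('w \<Rightarrow> 'v \<Rightarrow> 'v) \<Rightarrow> 'v list \<times> 'w \<Rightarrow> ('v list \<times> 'w \<Rightarrow>\<^sub>0 'k::field)" where
  "prism2 G p = push (\<lambda>t. (t, snd p)) (prism (G (snd p)) (fst p))"

lemma bd2_bd2: "lin bd2 (lin bd2 c) = (0 :: 'v list \<times> 'w \<Rightarrow>\<^sub>0 'k::field)"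
proof -
  have "lin bd2 (bd2 p) = (0 :: 'v list \<times> 'w \<Rightarrow>\<^sub>0 'k)" for p
    by (simp add: bd2_def lin_push push_lin[symmetric] bd_bd)
  then show ?thesis by (simp add: lin_lin)
qed

lemma prism2_bd2:
  "lin bd2 (lin (prism2 G) c) + lin (prism2 G) (lin bd2 c) =
    push (\<lambda>p. (map (G (snd p)) (fst p), snd p)) (c :: 'v list \<times> 'w \<Rightarrow>\<^sub>0 'k::field) - c"
proof -
  have "lin bd2 (prism2 G p) + lin (prism2 G) (bd2 p) =
    (bas (map (G (snd p)) (fst p), snd p) - bas p :: 'v list \<times> 'w \<Rightarrow>\<^sub>0 'k)" for p
  proof -
    have "lin bd2 (prism2 G p) + lin (prism2 G) (bd2 p :: 'v list \<times> 'w \<Rightarrow>\<^sub>0 'k) =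
      push (\<lambda>t. (t, snd p)) (lin bd (prism (G (snd p)) (fst p)) + lin (prism (G (snd p))) (bd (fst p)))"
      by (simp add: bd2_def prism2_def lin_push push_lin push_add)
    then show ?thesis unfolding prism_bd by (simp add: push_diff)
  qed
  then show ?thesis by (simp add: lin_lin lin_add_fun[symmetric] lin_diff_fun push_def)
qed

text \<open>The map induced by \<open>f\<close> on vertices and \<open>k\<close> on apexes. Below,
  \<open>nat2 (upd M) (\<lambda>a. a)\<close> resets a coordinate of the vertices, and
  \<open>nat2 (\<lambda>x. x) (upd M)\<close> forgets a coordinate of the apex.\<close>

definition nat2 :: "('v \<Rightarrow> 'v') \<Rightarrow> ('w \<Rightarrow> 'w') \<Rightarrow> ('v list \<times> 'w \<Rightarrow>\<^sub>0 'k::field) \<Rightarrow> ('v' list \<times> 'w' \<Rightarrow>\<^sub>0 'k)" where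
  "nat2 f k = push (\<lambda>p. (map f (fst p), k (snd p)))"

lemma nat2_bd2: "nat2 f k (lin bd2 c) = lin bd2 (nat2 f k c :: 'v list \<times> 'w \<Rightarrow>\<^sub>0 'k::field)"
proof -
  have "nat2 f k (bd2 p) = (bd2 (map f (fst p), k (snd p)) :: 'v list \<times> 'w \<Rightarrow>\<^sub>0 'k)" for p
    by (simp add: nat2_def bd2_def push_push bd_map[symmetric])
  then show ?thesis by (simp add: nat2_def push_lin lin_push)
qed

lemma nat2_prism2:
  assumes "\<And>p x. p \<in> keys c \<Longrightarrow> x \<in> set (fst p) \<Longrightarrow> f (G (snd p) x) = G' (k (snd p)) (f x)"
  shows "nat2 f k (lin (prism2 G) c) = lin (prism2 G') (nat2 f k c :: 'v list \<times> 'w \<Rightarrow>\<^sub>0 'k::field)"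
proof -
  have "nat2 f k (prism2 G p) = (prism2 G' (map f (fst p), k (snd p)) :: 'v list \<times> 'w \<Rightarrow>\<^sub>0 'k)" if "p \<in> keys c" for p
  proof -
    have "nat2 f k (prism2 G p :: _ \<Rightarrow>\<^sub>0 'k) = push (\<lambda>t. (t, k (snd p))) (push (map f) (prism (G (snd p)) (fst p)))"
      by (simp add: nat2_def prism2_def push_push)
    also have "push (map f) (prism (G (snd p)) (fst p) :: _ \<Rightarrow>\<^sub>0 'k) = prism (G' (k (snd p))) (map f (fst p))"
      by (rule prism_map) (rule assms[OF that])
    finally show ?thesis by (simp add: prism2_def)
  qed
  then have "lin (\<lambda>p. nat2 f k (prism2 G p)) c = lin (\<lambda>p. prism2 G' (map f (fst p), k (snd p)) :: _ \<Rightarrow>\<^sub>0 'k) c"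
    by (rule lin_cong)
  then show ?thesis by (simp add: nat2_def push_lin lin_push)
qed

section \<open>Products of connected complexes\<close>

lemma nat2_nat2: "nat2 f k (nat2 f' k' c) = nat2 (\<lambda>x. f (f' x)) (\<lambda>a. k (k' a)) c"
  by (simp add: nat2_def push_push o_def)

lemma nat2_diff: "nat2 f k (x - y) = nat2 f k x - nat2 f k y"
  and nat2_uminus: "nat2 f k (- x) = - nat2 f k x"
  and nat2_bas: "nat2 f k (bas p) = bas (map f (fst p), k (snd p))"
  and nat2_zero [simp]: "nat2 f k 0 = 0"
  by (simp_all add: nat2_def push_diff push_uminus)

lemma nat2_lin: "nat2 f k (lin \<phi> c) = lin (\<lambda>p. nat2 f k (\<phi> p)) c"
  by (simp add: nat2_def push_lin)

lemma keys_bd2: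
  assumes "q \<in> keys (bd2 p :: 'v list \<times> 'w \<Rightarrow>\<^sub>0 'k::field)"
  shows "snd q = snd p \<and> Suc (length (fst q)) = length (fst p) \<and> set (fst q) \<subseteq> set (fst p)"
proof -
  obtain t where "q = (t, snd p)" "t \<in> keys (bd (fst p) :: 'v list \<Rightarrow>\<^sub>0 'k)"
    using assms keys_push[of "\<lambda>t. (t, snd p)" "bd (fst p) :: 'v list \<Rightarrow>\<^sub>0 'k"] by (auto simp: bd2_def)
  then show ?thesis using keys_bd[of t "fst p"] by auto
qed

lemma keys_prism2:
  assumes "q \<in> keys (prism2 G p :: 'v list \<times> 'w \<Rightarrow>\<^sub>0 'k::field)"
  shows "snd q = snd p \<and> length (fst q) = Suc (length (fst p)) \<and>
    set (fst q) \<subseteq> set (fst p) \<union> G (snd p) ` set (fst p)"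
proof -
  obtain t where "q = (t, snd p)" "t \<in> keys (prism (G (snd p)) (fst p) :: 'v list \<Rightarrow>\<^sub>0 'k)"
    using assms keys_push[of "\<lambda>t. (t, snd p)" "prism (G (snd p)) (fst p) :: 'v list \<Rightarrow>\<^sub>0 'k"]
    by (auto simp: prism2_def)
  then show ?thesis using keys_prism[of t "G (snd p)" "fst p"] by auto
qed

lemma keys_linE:
  assumes "h \<in> keys (lin \<phi> c)"
  obtains g where "g \<in> keys c" "h \<in> keys (\<phi> g)"
  using subsetD[OF keys_lin assms] by blast

text \<open>A telescoping sum of edges: \<open>\<rho>\<close> is a 1-chain whose boundary is the
  difference of the ends of the path. The boundary is tested by \<open>F\<close> because it gets
  applied to simplices with apex that depend on a point of the path.\<close>

lemma path_chain:
  assumes "(x, z) \<in> R\<^sup>*"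
  shows "\<exists>\<rho> :: ('p \<times> 'p) \<Rightarrow>\<^sub>0 'k::field. keys \<rho> \<subseteq> R \<and>
    (\<forall>F :: 'p \<Rightarrow> ('h \<Rightarrow>\<^sub>0 'k). lin (\<lambda>q. F (fst q) - F (snd q)) \<rho> = F x - F z)"
  using assms
proof (induction rule: rtrancl_induct)
  case base
  show ?case by (rule exI[of _ 0]) (simp add: lin.zero)
next
  case (step y z)
  then obtain \<rho> :: "('p \<times> 'p) \<Rightarrow>\<^sub>0 'k" where \<rho>: "keys \<rho> \<subseteq> R"
    "\<And>F :: 'p \<Rightarrow> ('h \<Rightarrow>\<^sub>0 'k). lin (\<lambda>q. F (fst q) - F (snd q)) \<rho> = F x - F y" by blast
  have "keys (\<rho> + bas (y, z)) \<subseteq> R"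
    using \<rho>(1) step.hyps Poly_Mapping.keys_add[of \<rho> "bas (y, z)"] by auto
  moreover have "lin (\<lambda>q. F (fst q) - F (snd q)) (\<rho> + bas (y, z)) = F x - F z" for F :: "'p \<Rightarrow> ('h \<Rightarrow>\<^sub>0 'k)"
    by (simp add: lin.add \<rho>(2))
  ultimately show ?case by blast
qed

text \<open>A product of finitely many pseudometric spaces with base points. Of the circles it
  retains total boundedness and that any two points are joined by steps shorter than any given
  positive length.\<close>

locale rips_product =
  fixes A :: "'i set" and X :: "'i \<Rightarrow> 'p set" and d :: "'i \<Rightarrow> 'p \<Rightarrow> 'p \<Rightarrow> real" and b :: "'i \<Rightarrow> 'p"
  assumes finite_A: "finite A"
    and base: "L \<in> A \<Longrightarrow> b L \<in> X L"
    and d_refl [simp]: "d L x x = 0"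
    and d_sym: "d L x y = d L y x"
    and d_tri: "d L x z \<le> d L x y + d L y z"
    and connected: "L \<in> A \<Longrightarrow> 0 < \<epsilon> \<Longrightarrow> x \<in> X L \<Longrightarrow> y \<in> X L \<Longrightarrow>
      (x, y) \<in> {(y, y'). y \<in> X L \<and> y' \<in> X L \<and> d L y y' < \<epsilon>}\<^sup>*"
    and totally_bounded: "L \<in> A \<Longrightarrow> 0 < \<epsilon> \<Longrightarrow> \<exists>Y. finite Y \<and> Y \<subseteq> X L \<and> (\<forall>x\<in>X L. \<exists>y\<in>Y. d L x y < \<epsilon>)"
begin

text \<open>Coordinates outside \<open>A\<close> are base points instead of undefined: then
  \<open>b\<close> itself is a point, resetting all coordinates yields \<open>b\<close>, and
  subproducts embed by base points.\<close>

definition T :: "('i \<Rightarrow> 'p) set" where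
  "T = {x. \<forall>L. if L \<in> A then x L \<in> X L else x L = b L}"

text \<open>The empty set is a clique at every \<open>\<epsilon>\<close>, as the augmented complex
  has the empty list as a generator.\<close>

definition clique :: "real \<Rightarrow> ('i \<Rightarrow> 'p) set \<Rightarrow> bool" where
  "clique \<epsilon> S \<longleftrightarrow> S \<subseteq> T \<and> (\<forall>x\<in>S. \<forall>y\<in>S. \<forall>L\<in>A. d L (x L) (y L) < \<epsilon>)"

definition upd :: "'i \<Rightarrow> ('i \<Rightarrow> 'p) \<Rightarrow> 'i \<Rightarrow> 'p" where
  "upd L x = x(L := b L)"

lemma clique_mono: "clique \<epsilon> S \<Longrightarrow> S' \<subseteq> S \<Longrightarrow> clique \<epsilon> S'"
  unfolding clique_def by blast

lemma clique_eps_mono: "clique \<epsilon> S \<Longrightarrow> \<epsilon> \<le> \<epsilon>' \<Longrightarrow> clique \<epsilon>' S"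
  unfolding clique_def by (meson less_le_trans)

text \<open>For \<open>Q \<subseteq> A\<close>, the apex may replace the coordinates in
  \<open>Q\<close> of any vertices without destroying the clique, and this makes the cone
  contraction possible.\<close>

definition apexed :: "'i set \<Rightarrow> real \<Rightarrow> ('i \<Rightarrow> 'p) list \<times> ('i \<Rightarrow> 'p) \<Rightarrow> bool" where
  "apexed Q \<epsilon> p \<longleftrightarrow> clique \<epsilon> (set (fst p)) \<and> (\<forall>L. L \<notin> Q \<longrightarrow> snd p L = b L) \<and>
     (\<forall>L\<in>Q. snd p L \<in> X L \<and> (\<forall>x\<in>set (fst p). d L (x L) (snd p L) < \<epsilon>))"

lemma apexed_mono:
  "apexed Q \<epsilon> p \<Longrightarrow> snd q = snd p \<Longrightarrow> set (fst q) \<subseteq> set (fst p) \<Longrightarrow> apexed Q \<epsilon> q"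
  unfolding apexed_def using clique_mono[of \<epsilon> "set (fst p)" "set (fst q)"] by auto

lemma clique_upd:
  assumes "0 < \<epsilon>" "clique \<epsilon> S" "L \<in> A" "y \<in> X L"
  shows "clique \<epsilon> ((\<lambda>x. x(L := y)) ` S)"
  using assms unfolding clique_def T_def by auto

text \<open>The coordinates in \<open>J - Q\<close> are traded one at a time for coordinates with an apex: the path
  components make the projection from the simplices with apex surjective on reduced chains, and the
  cone on the apex contracts them. Each trade lowers the degree by one.\<close>

lemma reduced_cycle_is_boundary:
  fixes c :: "('i \<Rightarrow> 'p) list \<times> ('i \<Rightarrow> 'p) \<Rightarrow>\<^sub>0 'k::field"
  assumes eps: "0 < \<epsilon>" and J: "J \<subseteq> A" "J \<noteq> {}"
    and "Q \<subseteq> J" "l \<le> card (J - Q)"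
    and "\<And>p. p \<in> keys c \<Longrightarrow> length (fst p) = l \<and> apexed Q \<epsilon> p"
    and "\<And>M. M \<in> J \<Longrightarrow> nat2 (upd M) (\<lambda>a. a) c = 0"
    and "\<And>M. M \<in> Q \<Longrightarrow> nat2 (\<lambda>x. x) (upd M) c = 0"
    and "lin bd2 c = 0"
  shows "\<exists>v. (\<forall>p\<in>keys v. length (fst p) = Suc l \<and> apexed Q \<epsilon> p) \<and>
    (\<forall>M\<in>J. nat2 (upd M) (\<lambda>a. a) v = 0) \<and> (\<forall>M\<in>Q. nat2 (\<lambda>x. x) (upd M) v = 0) \<and> lin bd2 v = c"
  using assms(4-)
proof (induction l arbitrary: Q c)
  case 0
  \<comment> \<open>The list of length 0 is fixed by every \<open>upd M\<close>, while
    \<open>c\<close> is killed by one of them as \<open>J\<close> is nonempty.\<close>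
  obtain M where "M \<in> J" using J by blast
  moreover have "nat2 (upd M) (\<lambda>a. a) c = c"
    unfolding nat2_def
  proof (rule push_id_on)
    fix p assume "p \<in> keys c"
    then have "fst p = []" using "0.prems"(3) by simp
    then show "(map (upd M) (fst p), snd p) = p" by (cases p) simp
  qed
  ultimately have "c = 0" using "0.prems"(4) by metis
  then show ?case by (intro exI[of _ 0]) (simp add: lin.zero)
next
  case (Suc l)
  have finJ: "finite J" using J(1) finite_A finite_subset by blast
  have "J - Q \<noteq> {}" using Suc.prems(2) by force
  then obtain L where L: "L \<in> J" "L \<notin> Q" by blast
  have LA: "L \<in> A" using L J by blast
  define R where "R = {(y, y'). y \<in> X L \<and> y' \<in> X L \<and> d L y y' < \<epsilon>}"
  define ok :: "'p \<Rightarrow> ('p \<times> 'p \<Rightarrow>\<^sub>0 'k) \<Rightarrow> bool" where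
    "ok x r \<longleftrightarrow> keys r \<subseteq> R \<and> (\<forall>F :: 'p \<Rightarrow> (('i \<Rightarrow> 'p) list \<times> ('i \<Rightarrow> 'p) \<Rightarrow>\<^sub>0 'k).
       lin (\<lambda>q. F (fst q) - F (snd q)) r = F x - F (b L))" for x r
  define \<rho> where "\<rho> x = (SOME r. ok x r)" for x
  have "ok x (\<rho> x)" if "x \<in> X L" for x
  proof -
    have "\<exists>r. ok x r"
      unfolding ok_def R_def by (rule path_chain[OF connected[OF LA eps that base[OF LA]]])
    then show ?thesis unfolding \<rho>_def by (rule someI_ex)
  qed
  then have \<rho>: "\<And>x. x \<in> X L \<Longrightarrow> keys (\<rho> x) \<subseteq> R"
    "\<And>x (F :: 'p \<Rightarrow> (('i \<Rightarrow> 'p) list \<times> ('i \<Rightarrow> 'p) \<Rightarrow>\<^sub>0 'k)). x \<in> X L \<Longrightarrow>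
       lin (\<lambda>q. F (fst q) - F (snd q)) (\<rho> x) = F x - F (b L)"
    unfolding ok_def by simp_all
  \<comment> \<open>For an edge \<open>q\<close> of the path, both of its ends are admissible apexes
    for the simplex moved to the second end. The difference vanishes when the apex coordinate is
    forgotten and telescopes along the path when the vertices are reset.\<close>
  define g :: "'p \<times> 'p \<Rightarrow> ('i \<Rightarrow> 'p) list \<times> ('i \<Rightarrow> 'p) \<Rightarrow> (('i \<Rightarrow> 'p) list \<times> ('i \<Rightarrow> 'p) \<Rightarrow>\<^sub>0 'k)" where
    "g q p = bas (map (\<lambda>x. x(L := snd q)) (fst p), (snd p)(L := fst q)) -
       bas (map (\<lambda>x. x(L := snd q)) (fst p), (snd p)(L := snd q))" for q p
  \<comment> \<open>A lift of \<open>p\<close> to simplices with an apex in coordinate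
    \<open>L\<close>. The first term takes the coordinate of a vertex as apex. The correction along
    the path from it to \<open>b L\<close> makes the lift compatible with resetting the vertices, so
    that \<open>z\<close> is again killed by \<open>upd L\<close>.\<close>
  define \<sigma> where "\<sigma> p = bas (fst p, (snd p)(L := last (fst p) L)) - lin (\<lambda>q. g q p) (\<rho> (last (fst p) L))" for p
  define z where "z = lin \<sigma> c"
  have ne: "fst p \<noteq> []" if "p \<in> keys c" for p using Suc.prems(3)[OF that] by auto
  have lastX: "last (fst p) L \<in> X L" if "p \<in> keys c" for p
  proof -
    have "last (fst p) \<in> T"
      using Suc.prems(3)[OF that] last_in_set[OF ne[OF that]] by (auto simp: apexed_def clique_def)
    then show ?thesis using LA by (auto simp: T_def dest: spec[of _ L])
  qed
  have apL: "snd p L = b L" if "p \<in> keys c" for p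
    using Suc.prems(3)[OF that] L by (auto simp: apexed_def)
  then have updL: "(snd p)(L := b L) = snd p" if "p \<in> keys c" for p using that by (metis fun_upd_triv)
  have z_keys: "length (fst q) = Suc l \<and> apexed (insert L Q) \<epsilon> q" if q: "q \<in> keys z" for q
  proof -
    obtain p where p: "p \<in> keys c" "q \<in> keys (\<sigma> p)" using q unfolding z_def by (rule keys_linE)
    have ap: "length (fst p) = Suc l" "apexed Q \<epsilon> p" using Suc.prems(3)[OF p(1)] by auto
    have "q \<in> keys (bas (fst p, (snd p)(L := last (fst p) L)) :: _ \<Rightarrow>\<^sub>0 'k) \<union>
        keys (lin (\<lambda>q. g q p) (\<rho> (last (fst p) L)))"
      using p(2) unfolding \<sigma>_def by (rule subsetD[OF keys_diff'])
    then show ?thesis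
    proof
      assume "q \<in> keys (bas (fst p, (snd p)(L := last (fst p) L)) :: _ \<Rightarrow>\<^sub>0 'k)"
      then have q: "q = (fst p, (snd p)(L := last (fst p) L))" by simp
      have "d L (x L) (last (fst p) L) < \<epsilon>" if "x \<in> set (fst p)" for x
        using ap(2) that LA last_in_set[OF ne[OF p(1)]] by (auto simp: apexed_def clique_def)
      then show ?thesis using ap lastX[OF p(1)] unfolding q by (auto simp: apexed_def)
    next
      assume "q \<in> keys (lin (\<lambda>q. g q p) (\<rho> (last (fst p) L)))"
      then obtain e where e: "e \<in> keys (\<rho> (last (fst p) L))" "q \<in> keys (g e p)" by (rule keys_linE)
      then have "e \<in> R" using \<rho>(1)[OF lastX[OF p(1)]] by blast
      then have eR: "fst e \<in> X L" "snd e \<in> X L" "d L (snd e) (fst e) < \<epsilon>"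
        using d_sym[of L "fst e" "snd e"] by (auto simp: R_def)
      have "q = (map (\<lambda>x. x(L := snd e)) (fst p), (snd p)(L := fst e)) \<or>
          q = (map (\<lambda>x. x(L := snd e)) (fst p), (snd p)(L := snd e))"
        using subsetD[OF keys_diff' e(2)[unfolded g_def]] by auto
      moreover have "apexed (insert L Q) \<epsilon> (map (\<lambda>x. x(L := snd e)) (fst p), (snd p)(L := y))"
        if "y \<in> X L" "d L (snd e) y < \<epsilon>" for y
        using that ap(2) clique_upd[OF eps _ LA eR(2), of "set (fst p)"] L by (auto simp: apexed_def)
      ultimately show ?thesis using eR ap(1) eps by auto
    qed
  qed
  have z_Ap: "nat2 (\<lambda>x. x) (upd L) z = c"
  proof -
    have "nat2 (\<lambda>x. x) (upd L) (\<sigma> p) = bas p" if "p \<in> keys c" for p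
      using updL[OF that] by (simp add: \<sigma>_def nat2_diff nat2_lin g_def nat2_bas upd_def)
    then have "lin (\<lambda>p. nat2 (\<lambda>x. x) (upd L) (\<sigma> p)) c = lin bas c" by (rule lin_cong)
    then show ?thesis by (simp add: z_def nat2_lin)
  qed
  have z_EL: "nat2 (upd L) (\<lambda>a. a) z = 0"
  proof -
    have "nat2 (upd L) (\<lambda>a. a) (\<sigma> p) = bas (map (upd L) (fst p), snd p)" if "p \<in> keys c" for p
    proof -
      define F :: "'p \<Rightarrow> (('i \<Rightarrow> 'p) list \<times> ('i \<Rightarrow> 'p) \<Rightarrow>\<^sub>0 'k)" where
        "F y = bas (map (upd L) (fst p), (snd p)(L := y))" for y
      have "nat2 (upd L) (\<lambda>a. a) (g q p) = F (fst q) - F (snd q)" for q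
        by (simp add: g_def F_def nat2_diff nat2_bas upd_def[abs_def] o_def)
      then have "nat2 (upd L) (\<lambda>a. a) (\<sigma> p) =
          F (last (fst p) L) - lin (\<lambda>q. F (fst q) - F (snd q)) (\<rho> (last (fst p) L))"
        by (simp add: \<sigma>_def nat2_diff nat2_lin nat2_bas) (simp add: F_def)
      also have "\<dots> = F (b L)" using \<rho>(2)[OF lastX[OF that], of F] by simp
      finally show ?thesis using updL[OF that] by (simp add: F_def)
    qed
    then have "lin (\<lambda>p. nat2 (upd L) (\<lambda>a. a) (\<sigma> p)) c = lin (\<lambda>p. bas (map (upd L) (fst p), snd p)) c"
      by (rule lin_cong)
    also have "\<dots> = nat2 (upd L) (\<lambda>a. a) c" by (simp add: nat2_def push_def)
    also have "\<dots> = 0" by (rule Suc.prems(4)[OF L(1)])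
    finally show ?thesis by (simp add: z_def nat2_lin)
  qed
  have z_E: "nat2 (upd M) (\<lambda>a. a) z = 0" if M: "M \<in> J" for M
  proof (cases "M = L")
    case False
    have "nat2 (upd M) (\<lambda>a. a) (\<sigma> p) = \<sigma> (map (upd M) (fst p), snd p)" if "p \<in> keys c" for p
    proof -
      have "last (map (upd M) (fst p)) L = last (fst p) L"
        using ne[OF that] False by (simp add: last_map upd_def)
      moreover have "nat2 (upd M) (\<lambda>a. a) (g q p) = g q (map (upd M) (fst p), snd p)" for q
        using False by (simp add: g_def nat2_diff nat2_bas upd_def[abs_def] o_def fun_upd_twist)
      ultimately show ?thesis by (simp add: \<sigma>_def nat2_diff nat2_lin nat2_bas)
    qed
    then have "lin (\<lambda>p. nat2 (upd M) (\<lambda>a. a) (\<sigma> p)) c = lin (\<lambda>p. \<sigma> (map (upd M) (fst p), snd p)) c"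
      by (rule lin_cong)
    also have "\<dots> = lin \<sigma> (nat2 (upd M) (\<lambda>a. a) c)" by (simp add: nat2_def lin_push)
    also have "\<dots> = 0" by (simp add: Suc.prems(4)[OF M] lin.zero)
    finally show ?thesis by (simp add: z_def nat2_lin)
  qed (use z_EL in simp)
  have z_A: "nat2 (\<lambda>x. x) (upd M) z = 0" if M: "M \<in> Q" for M
  proof -
    have False: "M \<noteq> L" using M L by blast
    have "nat2 (\<lambda>x. x) (upd M) (\<sigma> p) = \<sigma> (fst p, upd M (snd p))" for p
    proof -
      have "nat2 (\<lambda>x. x) (upd M) (g q p) = g q (fst p, upd M (snd p))" for q
        using False by (simp add: g_def nat2_diff nat2_bas upd_def[abs_def] fun_upd_twist)
      then show ?thesis using False by (simp add: \<sigma>_def nat2_diff nat2_lin nat2_bas upd_def[abs_def] fun_upd_twist)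
    qed
    then have "lin (\<lambda>p. nat2 (\<lambda>x. x) (upd M) (\<sigma> p)) c = lin \<sigma> (nat2 (\<lambda>x. x) (upd M) c)"
      by (simp add: nat2_def lin_push)
    also have "\<dots> = 0" by (simp add: Suc.prems(5)[OF M] lin.zero)
    finally show ?thesis by (simp add: z_def nat2_lin)
  qed
  \<comment> \<open>The boundary of the lift \<open>z\<close> need not vanish, but it has one vertex
    less and projects to the boundary of \<open>c\<close>, which is 0. The induction hypothesis
    fills it by some \<open>v\<close> over 0, and \<open>z - v\<close> is a cycle over
    \<open>c\<close>.\<close>
  have "\<exists>v. (\<forall>p\<in>keys v. length (fst p) = Suc l \<and> apexed (insert L Q) \<epsilon> p) \<and>
    (\<forall>M\<in>J. nat2 (upd M) (\<lambda>a. a) v = 0) \<and> (\<forall>M\<in>insert L Q. nat2 (\<lambda>x. x) (upd M) v = 0) \<and>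
    lin bd2 v = lin bd2 z"
  proof (rule Suc.IH)
    show "insert L Q \<subseteq> J" using Suc.prems(1) L by blast
    have "J - insert L Q = (J - Q) - {L}" by blast
    then have "card (J - insert L Q) = card (J - Q) - 1" using L finJ by simp
    then show "l \<le> card (J - insert L Q)" using Suc.prems(2) by simp
    show "length (fst p) = l \<and> apexed (insert L Q) \<epsilon> p" if pz: "p \<in> keys (lin bd2 z)" for p
    proof -
      obtain q where q: "q \<in> keys z" "p \<in> keys (bd2 q :: _ \<Rightarrow>\<^sub>0 'k)" using pz by (rule keys_linE)
      then show ?thesis using keys_bd2[OF q(2)] z_keys[OF q(1)] apexed_mono[of _ _ q p] by auto
    qed
    show "nat2 (upd M) (\<lambda>a. a) (lin bd2 z) = 0" if "M \<in> J" for M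
      using z_E[OF that] by (simp add: nat2_bd2 lin.zero)
    show "nat2 (\<lambda>x. x) (upd M) (lin bd2 z) = 0" if "M \<in> insert L Q" for M
      using that z_A z_Ap Suc.prems(6) by (auto simp: nat2_bd2 lin.zero)
    show "lin bd2 (lin bd2 z) = 0" by (rule bd2_bd2)
  qed
  then obtain v where v: "\<And>p. p \<in> keys v \<Longrightarrow> length (fst p) = Suc l \<and> apexed (insert L Q) \<epsilon> p"
    "\<And>M. M \<in> J \<Longrightarrow> nat2 (upd M) (\<lambda>a. a) v = 0"
    "\<And>M. M \<in> insert L Q \<Longrightarrow> nat2 (\<lambda>x. x) (upd M) v = 0" "lin bd2 v = lin bd2 z" by blast
  define u where "u = z - v"
  \<comment> \<open>\<open>G a\<close> moves the \<open>L\<close>-coordinate of a vertex to the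
    apex; its prism is the contraction to the apex.\<close>
  define G :: "('i \<Rightarrow> 'p) \<Rightarrow> ('i \<Rightarrow> 'p) \<Rightarrow> 'i \<Rightarrow> 'p" where "G a x = x(L := a L)" for a x
  define P where "P = lin (prism2 G) u"
  define w where "w = - nat2 (\<lambda>x. x) (upd L) P"
  have u_keys: "length (fst p) = Suc l \<and> apexed (insert L Q) \<epsilon> p" if "p \<in> keys u" for p
    using subsetD[OF keys_diff' that[unfolded u_def]] z_keys v(1) by blast
  have u_E: "nat2 (upd M) (\<lambda>a. a) u = 0" if "M \<in> J" for M
    using z_E[OF that] v(2)[OF that] by (simp add: u_def nat2_diff)
  have u_A: "nat2 (\<lambda>x. x) (upd M) u = 0" if "M \<in> Q" for M
    using z_A[OF that] v(3)[of M] that by (simp add: u_def nat2_diff)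
  have u_AL: "nat2 (\<lambda>x. x) (upd L) u = c"
    using z_Ap v(3)[of L] by (simp add: u_def nat2_diff)
  \<comment> \<open>\<open>G\<close> overwrites the \<open>L\<close>-coordinate, so resetting that
    coordinate first makes no difference, and resetting kills \<open>u\<close>. Only the identity
    end of the prism survives.\<close>
  have "push (\<lambda>p. (map (G (snd p)) (fst p), snd p)) u =
      push (\<lambda>p. (map (G (snd p)) (fst p), snd p)) (nat2 (upd L) (\<lambda>a. a) u)"
    by (simp add: nat2_def push_push o_def G_def[abs_def] upd_def[abs_def])
  then have "push (\<lambda>p. (map (G (snd p)) (fst p), snd p)) u = 0" by (simp add: u_E[OF L(1)])
  moreover have "lin bd2 u = 0" by (simp add: u_def lin.diff v(4))
  ultimately have bdP: "lin bd2 P = - u"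
    using prism2_bd2[of G u] by (simp add: P_def lin.zero)
  have "lin bd2 w = c"
    by (simp add: w_def lin.neg nat2_bd2[symmetric] bdP nat2_uminus u_AL)
  moreover have "length (fst q) = Suc (Suc l) \<and> apexed Q \<epsilon> q" if "q \<in> keys w" for q
  proof -
    have "q \<in> keys (nat2 (\<lambda>x. x) (upd L) P)" using that by (simp add: w_def in_keys_iff)
    then obtain p where p: "q = (fst p, upd L (snd p))" "p \<in> keys P"
      using keys_push[of "\<lambda>p. (map (\<lambda>x. x) (fst p), upd L (snd p))" P] by (auto simp: nat2_def)
    obtain r where r: "r \<in> keys u" "p \<in> keys (prism2 G r :: _ \<Rightarrow>\<^sub>0 'k)"
      using p(2) unfolding P_def by (rule keys_linE)
    have r': "length (fst r) = Suc l" "apexed (insert L Q) \<epsilon> r" using u_keys[OF r(1)] by auto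
    have p': "snd p = snd r" "length (fst p) = Suc (length (fst r))"
      "set (fst p) \<subseteq> set (fst r) \<union> G (snd r) ` set (fst r)" using keys_prism2[OF r(2)] by auto
    have aX: "snd r L \<in> X L" "\<And>x. x \<in> set (fst r) \<Longrightarrow> d L (x L) (snd r L) < \<epsilon>"
      and cl: "clique \<epsilon> (set (fst r))" using r'(2) by (auto simp: apexed_def)
    have "clique \<epsilon> (G (snd r) ` set (fst r))"
      unfolding G_def by (rule clique_upd[OF eps cl LA aX(1)])
    moreover have "d M (x M) (G (snd r) y M) < \<epsilon> \<and> d M (G (snd r) y M) (x M) < \<epsilon>"
      if "x \<in> set (fst r)" "y \<in> set (fst r)" "M \<in> A" for x y M
      using aX(2)[OF that(1)] cl that d_sym[of L "snd r L" "x L"] by (auto simp: G_def clique_def)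
    ultimately have "clique \<epsilon> (set (fst r) \<union> G (snd r) ` set (fst r))"
      using cl unfolding clique_def by blast
    then have "clique \<epsilon> (set (fst p))" using p'(3) by (rule clique_mono)
    moreover have "d M (x M) (snd r M) < \<epsilon>" if M: "M \<in> Q" and x: "x \<in> set (fst p)" for x M
    proof -
      have "M \<noteq> L" using M L by blast
      then have "\<exists>y\<in>set (fst r). x M = y M" using x p'(3) by (force simp: G_def)
      then show ?thesis using r'(2) M by (auto simp: apexed_def)
    qed
    ultimately show ?thesis
      using r' L p' p(1) by (auto simp: apexed_def upd_def)
  qed
  moreover have "nat2 (upd M) (\<lambda>a. a) w = 0" if M: "M \<in> J" for M
  proof -
    have "nat2 (upd M) (\<lambda>a. a) P = 0"
    proof (cases "M = L")
      case True
      have "nat2 (upd L) (\<lambda>a. a) P = lin (prism2 (\<lambda>a x. x)) (nat2 (upd L) (\<lambda>a. a) u)"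
        unfolding P_def by (rule nat2_prism2) (simp add: G_def upd_def[abs_def])
      then show ?thesis using True by (simp add: u_E[OF L(1)] lin.zero)
    next
      case False
      have "nat2 (upd M) (\<lambda>a. a) P = lin (prism2 G) (nat2 (upd M) (\<lambda>a. a) u)"
        unfolding P_def by (rule nat2_prism2) (use False in \<open>simp add: G_def upd_def[abs_def] fun_upd_twist\<close>)
      then show ?thesis by (simp add: u_E[OF M] lin.zero)
    qed
    moreover have "nat2 (upd M) (\<lambda>a. a) (nat2 (\<lambda>x. x) (upd L) P) =
        nat2 (\<lambda>x. x) (upd L) (nat2 (upd M) (\<lambda>a. a) P)"
      by (simp add: nat2_nat2)
    ultimately show ?thesis by (simp add: w_def nat2_uminus)
  qed
  moreover have "nat2 (\<lambda>x. x) (upd M) w = 0" if M: "M \<in> Q" for M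
  proof -
    have neq: "M \<noteq> L" using M L by blast
    have "nat2 (\<lambda>x. x) (upd M) P = lin (prism2 G) (nat2 (\<lambda>x. x) (upd M) u)"
      unfolding P_def by (rule nat2_prism2) (use neq in \<open>simp add: G_def upd_def[abs_def]\<close>)
    also have "\<dots> = 0" by (simp add: u_A[OF M] lin.zero)
    finally have "nat2 (\<lambda>x. x) (upd M) P = 0" .
    moreover have "nat2 (\<lambda>x. x) (upd M) (nat2 (\<lambda>x. x) (upd L) P) =
        nat2 (\<lambda>x. x) (upd L) (nat2 (\<lambda>x. x) (upd M) P)"
      using neq by (simp add: nat2_nat2 upd_def[abs_def] fun_upd_twist)
    ultimately show ?thesis by (simp add: w_def nat2_uminus)
  qed
  ultimately show ?case by blast
qed

end

section \<open>The decomposition by coordinates\<close>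

lemma prism_chain:
  "lin bd (lin (prism g) c) + lin (prism g) (lin bd c) = push (map g) (c :: 'v list \<Rightarrow>\<^sub>0 'k::field) - c"
  by (simp add: lin_lin lin_add_fun[symmetric] prism_bd lin_diff_fun push_def)

lemma lin_bd_push: "lin bd (push (map f) c) = push (map f) (lin bd (c :: 'v list \<Rightarrow>\<^sub>0 'k::field))"
  by (simp add: lin_push push_lin bd_map)

lemma lin_bd_bd: "lin bd (lin bd c) = (0 :: 'v list \<Rightarrow>\<^sub>0 'k::field)"
  by (simp add: lin_lin bd_bd)

lemma keys_pushE:
  assumes "h \<in> keys (push f c)"
  obtains g where "g \<in> keys c" "h = f g"
  using subsetD[OF keys_push assms] by blast

context rips_product
begin

text \<open>Indexed by list length, one more than the simplicial degree. As \<open>bd\<close> is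
  augmented, \<open>cyc 0\<close> consists of the reduced cycles.\<close>

definition chn :: "nat \<Rightarrow> real \<Rightarrow> (('i \<Rightarrow> 'p) list \<Rightarrow>\<^sub>0 'k::field) set" where
  "chn l \<epsilon> = {c. \<forall>s\<in>keys c. length s = l \<and> clique \<epsilon> (set s)}"

definition cyc :: "nat \<Rightarrow> real \<Rightarrow> (('i \<Rightarrow> 'p) list \<Rightarrow>\<^sub>0 'k::field) set" where
  "cyc n \<epsilon> = {c \<in> chn (Suc n) \<epsilon>. lin bd c = 0}"

definition bdr :: "nat \<Rightarrow> real \<Rightarrow> (('i \<Rightarrow> 'p) list \<Rightarrow>\<^sub>0 'k::field) set" where
  "bdr n \<epsilon> = lin bd ` chn (Suc (Suc n)) \<epsilon>"

definition e :: "'i \<Rightarrow> (('i \<Rightarrow> 'p) list \<Rightarrow>\<^sub>0 'k::field) \<Rightarrow> (('i \<Rightarrow> 'p) list \<Rightarrow>\<^sub>0 'k)" where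
  "e L = push (map (upd L))"

definition effect :: "'i set \<Rightarrow> (('i \<Rightarrow> 'p) list \<Rightarrow>\<^sub>0 'k::field) set" where
  "effect J = {c. (\<forall>L\<in>J. e L c = 0) \<and> (\<forall>L\<in>A - J. e L c = c)}"

lemma e_add: "e L (x + y) = e L x + e L y"
  and e_diff: "e L (x - y) = e L x - e L y"
  and e_smul: "e L (smul a x) = smul a (e L x)"
  and e_zero [simp]: "e L 0 = 0"
  by (simp_all add: e_def push_add push_diff push_smul)

lemma e_idem: "e L (e L c) = e L c"
  by (simp add: e_def push_push o_def upd_def[abs_def])

lemma e_commute: "e L (e M c) = e M (e L c)"
  by (cases "L = M") (simp_all add: e_def push_push o_def upd_def[abs_def] fun_upd_twist)

lemma subspace_chn: "pm.subspace (chn l \<epsilon>)"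
  by (rule pm.subspaceI)
    (auto simp: chn_def dest: subsetD[OF Poly_Mapping.keys_add] subsetD[OF keys_smul])

lemma subspace_cyc: "pm.subspace (cyc n \<epsilon>)"
  using subspace_chn[of "Suc n" \<epsilon>] unfolding pm.subspace_def cyc_def
  by (auto simp: lin.add lin.scale lin.zero)

lemma subspace_bdr: "pm.subspace (bdr n \<epsilon>)"
  unfolding bdr_def by (rule lin.subspace_image[OF subspace_chn])

lemma subspace_effect: "pm.subspace (effect J)"
  by (rule pm.subspaceI) (auto simp: effect_def e_add e_smul)

lemma chn_mono: "\<epsilon> \<le> \<epsilon>' \<Longrightarrow> chn l \<epsilon> \<subseteq> chn l \<epsilon>'"
  unfolding chn_def using clique_eps_mono by blast

lemma chn_bd: "c \<in> chn (Suc l) \<epsilon> \<Longrightarrow> lin bd c \<in> chn l \<epsilon>"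
  unfolding chn_def
proof (intro CollectI ballI)
  fix t assume c: "c \<in> {c. \<forall>s\<in>keys c. length s = Suc l \<and> clique \<epsilon> (set s)}" and t: "t \<in> keys (lin bd c)"
  obtain s where "s \<in> keys c" "t \<in> keys (bd s :: _ \<Rightarrow>\<^sub>0 'a)" using t by (rule keys_linE)
  then show "length t = l \<and> clique \<epsilon> (set t)"
    using c keys_bd[of t s] clique_mono[of \<epsilon> "set s" "set t"] by auto
qed

lemma bdr_sub_cyc: "bdr n \<epsilon> \<subseteq> cyc n \<epsilon>"
  unfolding bdr_def cyc_def using chn_bd lin_bd_bd by blast

text \<open>Finitely many distances occur in a chain, each strictly less than \<open>t\<close>; any
  \<open>s\<close> between their maximum and \<open>t\<close> serves.\<close>

lemma chn_left: assumes c: "c \<in> chn l t" shows "\<exists>s<t. c \<in> chn l s"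
proof -
  define D where "D = (\<Union>s\<in>keys c. \<Union>x\<in>set s. \<Union>y\<in>set s. (\<lambda>L. d L (x L) (y L)) ` A)"
  \<comment> \<open>The element \<open>t - 1\<close> keeps the set nonempty for chains without
    distances.\<close>
  have fin: "finite (insert (t - 1) D)" using finite_A by (auto simp: D_def)
  have "r < t" if "r \<in> insert (t - 1) D" for r
    using that c by (auto simp: D_def chn_def clique_def)
  then have "Max (insert (t - 1) D) < t" using fin by (subst Max_less_iff) auto
  then obtain s where s: "Max (insert (t - 1) D) < s" "s < t" using dense by blast
  have "r < s" if "r \<in> D" for r using Max_ge[OF fin, of r] that s(1) by simp
  then have "d L (x L) (y L) < s" if "\<sigma> \<in> keys c" "x \<in> set \<sigma>" "y \<in> set \<sigma>" "L \<in> A" for \<sigma> x y L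
    using that unfolding D_def by blast
  then have "c \<in> chn l s" using c unfolding chn_def clique_def by blast
  then show ?thesis using s(2) by blast
qed

lemma cyc_left: "c \<in> cyc n t \<Longrightarrow> \<exists>s<t. c \<in> cyc n s"
  using chn_left unfolding cyc_def by blast

lemma bdr_left: assumes "c \<in> bdr n t" shows "\<exists>s<t. c \<in> bdr n s"
proof -
  obtain y where "c = lin bd y" "y \<in> chn (Suc (Suc n)) t" using assms unfolding bdr_def by blast
  then show ?thesis using chn_left[of y] unfolding bdr_def by blast
qed

lemma bdr_mono: "\<epsilon> \<le> \<epsilon>' \<Longrightarrow> bdr n \<epsilon> \<subseteq> bdr n \<epsilon>'"
  unfolding bdr_def using chn_mono by blast

lemma cyc_mono: "\<epsilon> \<le> \<epsilon>' \<Longrightarrow> cyc n \<epsilon> \<subseteq> cyc n \<epsilon>'"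
  unfolding cyc_def using chn_mono by blast

lemma clique_pos: assumes "A \<noteq> {}" "clique \<epsilon> S" "S \<noteq> {}" shows "0 < \<epsilon>"
  using assms d_refl unfolding clique_def by (metis ex_in_conv)

lemma chn_nonpos: assumes "A \<noteq> {}" "\<epsilon> \<le> 0" "c \<in> chn (Suc l) \<epsilon>" shows "c = 0"
proof -
  have False if "s \<in> keys c" for s
    using clique_pos[OF assms(1), of \<epsilon> "set s"] that assms by (cases s) (auto simp: chn_def)
  then have "keys c = {}" by blast
  then show ?thesis by simp
qed

lemma clique_image_upd: assumes "L \<in> A" "clique \<epsilon> S" shows "clique \<epsilon> (upd L ` S)"
proof (cases "S = {}")
  case False
  have "A \<noteq> {}" using assms(1) by blast
  then have "0 < \<epsilon>" using assms(2) False by (rule clique_pos)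
  then show ?thesis using clique_upd[OF _ assms(2,1) base[OF assms(1)]] by (simp add: upd_def[abs_def])
qed (simp add: clique_def)

lemma e_chn: assumes "L \<in> A" "c \<in> chn l \<epsilon>" shows "e L c \<in> chn l \<epsilon>"
  unfolding chn_def e_def
proof (intro CollectI ballI)
  fix t assume "t \<in> keys (push (map (upd L)) c)"
  then obtain s where "s \<in> keys c" "t = map (upd L) s" by (rule keys_pushE)
  then show "length t = l \<and> clique \<epsilon> (set t)"
    using assms clique_image_upd by (auto simp: chn_def)
qed

lemma e_bd: "lin bd (e L c) = e L (lin bd c)"
  by (simp add: e_def lin_bd_push)

lemma e_cyc: "L \<in> A \<Longrightarrow> c \<in> cyc n \<epsilon> \<Longrightarrow> e L c \<in> cyc n \<epsilon>"
  using e_chn by (auto simp: cyc_def e_bd)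

lemma e_bdr: "L \<in> A \<Longrightarrow> c \<in> bdr n \<epsilon> \<Longrightarrow> e L c \<in> bdr n \<epsilon>"
  using e_chn unfolding bdr_def by (force simp: e_bd[symmetric])

section \<open>Joint projections for the commuting idempotents\<close>

fun pr :: "'i list \<Rightarrow> 'i set \<Rightarrow> (('i \<Rightarrow> 'p) list \<Rightarrow>\<^sub>0 'k::field) \<Rightarrow> (('i \<Rightarrow> 'p) list \<Rightarrow>\<^sub>0 'k)" where
  "pr [] J c = c"
| "pr (L # xs) J c = (if L \<in> J then pr xs J c - e L (pr xs J c) else e L (pr xs J c))"

lemma pr_linear: "Vector_Spaces.linear smul smul (pr xs J)"
proof (rule Vector_Spaces.linear_iff[THEN iffD2], intro conjI allI)
  fix x y :: "('i \<Rightarrow> 'p) list \<Rightarrow>\<^sub>0 'a" and a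
  show "pr xs J (x + y) = pr xs J x + pr xs J y" by (induction xs) (simp_all add: e_add algebra_simps)
  show "pr xs J (smul a x) = smul a (pr xs J x)"
    by (induction xs) (simp_all add: e_smul pm.scale_right_diff_distrib)
qed (rule pm.vector_space_axioms)+

lemma e_pr: "e M (pr xs J c) = pr xs J (e M c)"
  by (induction xs) (auto simp: e_diff e_commute)

lemma pr_closed:
  assumes "pm.subspace W" "\<And>L c. L \<in> set xs \<Longrightarrow> c \<in> W \<Longrightarrow> e L c \<in> W" "c \<in> W"
  shows "pr xs J c \<in> W"
  using assms(2,3) by (induction xs) (auto intro: pm.subspace_diff[OF assms(1)])

lemma e_pr_in: "M \<in> set xs \<Longrightarrow> M \<in> J \<Longrightarrow> e M (pr xs J c) = 0"
  by (induction xs) (auto simp: e_diff e_idem e_commute)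

lemma e_pr_out: "M \<in> set xs \<Longrightarrow> M \<notin> J \<Longrightarrow> e M (pr xs J c) = pr xs J c"
proof (induction xs)
  case (Cons L xs)
  then show ?case by (cases "M = L") (auto simp: e_diff e_idem e_commute[of M L])
qed simp

lemma pr_fixed: "(\<And>L. L \<in> set xs \<Longrightarrow> if L \<in> J then e L c = 0 else e L c = c) \<Longrightarrow> pr xs J c = c"
  by (induction xs) (auto split: if_splits)

lemma pr_cong: "(\<And>L. L \<in> set xs \<Longrightarrow> L \<in> J \<longleftrightarrow> L \<in> J') \<Longrightarrow> pr xs J c = pr xs J' c"
  by (induction xs) auto

text \<open>The expansion of the product of the identities \<open>c = e L c + (c - e L c)\<close>
  over the list.\<close>

lemma sum_pr: "distinct xs \<Longrightarrow> (\<Sum>J\<in>Pow (set xs). pr xs J c) = c"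
proof (induction xs)
  case (Cons L xs)
  have "(\<Sum>J\<in>Pow (set (L # xs)). pr (L # xs) J c) =
      (\<Sum>J\<in>Pow (set xs). pr (L # xs) J c) + (\<Sum>J\<in>insert L ` Pow (set xs). pr (L # xs) J c)"
    unfolding list.set Pow_insert using Cons.prems by (intro sum.union_disjoint) auto
  also have "(\<Sum>J\<in>insert L ` Pow (set xs). pr (L # xs) J c) = (\<Sum>J\<in>Pow (set xs). pr (L # xs) (insert L J) c)"
    using Cons.prems by (intro sum.reindex_cong[of "insert L"]) (auto simp: inj_on_def)
  also have "\<dots> = (\<Sum>J\<in>Pow (set xs). pr xs J c - e L (pr xs J c))"
  proof (intro sum.cong refl)
    fix J
    have "pr xs (insert L J) c = pr xs J c" using Cons.prems by (intro pr_cong) auto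
    then show "pr (L # xs) (insert L J) c = pr xs J c - e L (pr xs J c)" by simp
  qed
  also have "(\<Sum>J\<in>Pow (set xs). pr (L # xs) J c) = (\<Sum>J\<in>Pow (set xs). e L (pr xs J c))"
    using Cons.prems by (intro sum.cong) auto
  finally show ?case using Cons by (simp add: sum_subtractf)
qed simp

definition proj :: "'i set \<Rightarrow> (('i \<Rightarrow> 'p) list \<Rightarrow>\<^sub>0 'k::field) \<Rightarrow> (('i \<Rightarrow> 'p) list \<Rightarrow>\<^sub>0 'k)" where
  "proj = pr (SOME xs. set xs = A \<and> distinct xs)"

lemma A_list: "set (SOME xs. set xs = A \<and> distinct xs) = A \<and> distinct (SOME xs. set xs = A \<and> distinct xs)"
  by (rule someI_ex) (rule finite_distinct_list[OF finite_A])

lemma proj_linear: "Vector_Spaces.linear smul smul (proj J)"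
  unfolding proj_def by (rule pr_linear)

interpretation proj: Vector_Spaces.linear "smul :: 'k::field \<Rightarrow> _" smul "proj J" for J
  by (rule proj_linear)

lemma proj_effect: "proj J c \<in> effect J" if "J \<subseteq> A"
  using A_list that unfolding effect_def proj_def by (auto intro!: e_pr_in e_pr_out)

lemma proj_id: "c \<in> effect J \<Longrightarrow> proj J c = c"
  unfolding proj_def using A_list by (intro pr_fixed) (auto simp: effect_def)

lemma e_proj: "e M (proj J c) = proj J (e M c)"
  unfolding proj_def by (rule e_pr)

lemma sum_proj: "(\<Sum>J\<in>Pow A. proj J c) = c"
  using sum_pr[OF conjunct2[OF A_list], of c] unfolding conjunct1[OF A_list] proj_def .

lemma proj_cyc: "c \<in> cyc n \<epsilon> \<Longrightarrow> proj J c \<in> cyc n \<epsilon>"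
  unfolding proj_def using A_list by (intro pr_closed[OF subspace_cyc]) (auto intro: e_cyc)

lemma proj_bdr: "c \<in> bdr n \<epsilon> \<Longrightarrow> proj J c \<in> bdr n \<epsilon>"
  unfolding proj_def using A_list by (intro pr_closed[OF subspace_bdr]) (auto intro: e_bdr)

lemma proj_other: assumes "c \<in> effect J'" "J \<subseteq> A" "J' \<subseteq> A" "J \<noteq> J'" shows "proj J c = 0"
proof -
  have pe: "proj J c \<in> effect J" using assms(2) by (rule proj_effect)
  obtain L where "L \<in> J - J' \<or> L \<in> J' - J" using assms(4) by blast
  then show ?thesis
  proof
    assume L: "L \<in> J - J'"
    then have "e L c = c" "e L (proj J c) = 0" using assms pe by (auto simp: effect_def)
    then show ?thesis by (simp add: e_proj)
  next
    assume L: "L \<in> J' - J"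
    then have "e L c = 0" "e L (proj J c) = proj J c" using assms pe by (auto simp: effect_def)
    then show ?thesis by (simp add: e_proj proj.zero)
  qed
qed

text \<open>The case \<open>Q = {}\<close> of \<open>reduced_cycle_is_boundary\<close>: every apex
  is \<open>b\<close> and imposes no condition. A simplex of degree \<open>n\<close> has
  \<open>Suc n\<close> vertices, so \<open>n < card J\<close> leaves a coordinate for each step of
  that induction.\<close>

lemma effect_boundary:
  assumes J: "J \<subseteq> A" "J \<noteq> {}" "n < card J" and c: "c \<in> cyc n \<epsilon>" "c \<in> effect J"
  shows "c \<in> bdr n \<epsilon>"
proof (cases "0 < \<epsilon>")
  case False
  have "c = 0" using chn_nonpos[of \<epsilon> c n] False J c(1) by (auto simp: cyc_def)
  then show ?thesis using pm.subspace_0[OF subspace_bdr] by simp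
next
  case True
  define c' where "c' = push (\<lambda>s. (s, b)) c"
  have "\<exists>v. (\<forall>p\<in>keys v. length (fst p) = Suc (Suc n) \<and> apexed {} \<epsilon> p) \<and>
    (\<forall>M\<in>J. nat2 (upd M) (\<lambda>a. a) v = 0) \<and> (\<forall>M\<in>{}. nat2 (\<lambda>x. x) (upd M) v = 0) \<and> lin bd2 v = c'"
  proof (rule reduced_cycle_is_boundary[OF True J(1,2)])
    fix p assume "p \<in> keys c'"
    then obtain s where "s \<in> keys c" "p = (s, b)" unfolding c'_def by (rule keys_pushE)
    then show "length (fst p) = Suc n \<and> apexed {} \<epsilon> p"
      using c(1) by (auto simp: cyc_def chn_def apexed_def)
  next
    fix M assume "M \<in> J"
    have "nat2 (upd M) (\<lambda>a. a) c' = push (\<lambda>s. (s, b)) (e M c)"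
      by (simp add: c'_def nat2_def e_def push_push)
    then show "nat2 (upd M) (\<lambda>a. a) c' = 0" using c(2) \<open>M \<in> J\<close> by (simp add: effect_def)
  next
    have "lin bd2 c' = push (\<lambda>s. (s, b)) (lin bd c)"
      by (simp add: c'_def lin_push push_lin bd2_def)
    then show "lin bd2 c' = 0" using c(1) by (simp add: cyc_def)
  qed (use J in auto)
  then obtain v where v: "\<And>p. p \<in> keys v \<Longrightarrow> length (fst p) = Suc (Suc n) \<and> apexed {} \<epsilon> p" "lin bd2 v = c'" by blast
  have fb: "push fst (bd2 p) = bd (fst p)" for p :: "('i \<Rightarrow> 'p) list \<times> ('i \<Rightarrow> 'p)"
    unfolding bd2_def push_push by (rule push_id_on) simp
  have "lin bd (push fst v) = push fst (lin bd2 v)" by (simp add: lin_push push_lin fb)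
  also have "\<dots> = c" unfolding v(2) c'_def push_push by (rule push_id_on) simp
  finally have "c = lin bd (push fst v)" by simp
  moreover have "push fst v \<in> chn (Suc (Suc n)) \<epsilon>" unfolding chn_def
  proof (intro CollectI ballI)
    fix s assume "s \<in> keys (push fst v)"
    then obtain p where "p \<in> keys v" "s = fst p" by (rule keys_pushE)
    then show "length s = Suc (Suc n) \<and> clique \<epsilon> (set s)" using v(1) by (auto simp: apexed_def)
  qed
  ultimately show ?thesis unfolding bdr_def by blast
qed

text \<open>A chain fixed by \<open>e L\<close> is a pushforward under \<open>upd L\<close>, so all
  its simplices are images.\<close>

lemma fixed_keys:
  assumes "e L c = c" "s \<in> keys c" "x \<in> set s"
  shows "x L = b L"
proof -
  have "s \<in> keys (push (map (upd L)) c)" using assms(1,2) by (simp add: e_def)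
  then obtain t where "t \<in> keys c" "s = map (upd L) t" by (rule keys_pushE)
  then show ?thesis using assms(3) by (auto simp: upd_def)
qed

text \<open>With all coordinates reset every vertex is \<open>b\<close>, and the cone with apex
  \<open>b\<close> adds no new vertex.\<close>

lemma effect_empty_boundary:
  assumes c: "c \<in> cyc n \<epsilon>" "c \<in> effect {}"
  shows "c \<in> bdr n \<epsilon>"
proof -
  have "lin bd (push (Cons b) c) = c" using c(1) by (simp add: lin_bd_Cons cyc_def)
  moreover have "push (Cons b) c \<in> chn (Suc (Suc n)) \<epsilon>" unfolding chn_def
  proof (intro CollectI ballI)
    fix t assume "t \<in> keys (push (Cons b) c)"
    then obtain s where s: "s \<in> keys c" "t = b # s" by (rule keys_pushE)
    have cs: "length s = Suc n" "clique \<epsilon> (set s)" using c(1) s(1) by (auto simp: cyc_def chn_def)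
    have "x = b" if x: "x \<in> set s" for x
    proof
      fix L
      show "x L = b L"
      proof (cases "L \<in> A")
        case True
        then show ?thesis using fixed_keys[OF _ s(1) x] c(2) by (auto simp: effect_def)
      next
        case False
        then show ?thesis using cs(2) x by (force simp: clique_def T_def)
      qed
    qed
    then have "set s = {b}" using cs(1) by (cases s) auto
    then show "length t = Suc (Suc n) \<and> clique \<epsilon> (set t)" using cs s(2) by auto
  qed
  ultimately show ?thesis unfolding bdr_def by (metis imageI)
qed

text \<open>Rounding the vertices to a finite net changes distances by less than
  \<open>t - s\<close>, so the prism between the identity and the rounding lives at
  \<open>t\<close>. It moves every cycle at \<open>s\<close> to a chain on the finitely many rounded
  lists.\<close>

lemma cyc_tame:
  assumes st: "s < t"
  shows "\<exists>F. finite F \<and> (\<forall>z\<in>cyc n s. \<exists>x\<in>pm.span F. z - x \<in> (bdr n t :: (_ \<Rightarrow>\<^sub>0 'k::field) set))"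
proof -
  \<comment> \<open>Both ends of an edge may move, each by less than half of the gap.\<close>
  define \<delta> where "\<delta> = (t - s) / 2"
  have \<delta>: "0 < \<delta>" using st by (simp add: \<delta>_def)
  obtain Y where Y: "\<And>L. L \<in> A \<Longrightarrow> finite (Y L) \<and> Y L \<subseteq> X L \<and> (\<forall>x\<in>X L. \<exists>y\<in>Y L. d L x y < \<delta>)"
    using totally_bounded[OF _ \<delta>] by metis
  define g where "g L x = (SOME y. y \<in> Y L \<and> d L x y < \<delta>)" for L x
  have g: "g L x \<in> Y L \<and> d L x (g L x) < \<delta>" if "L \<in> A" "x \<in> X L" for L x
    unfolding g_def by (rule someI_ex) (use Y[OF that(1)] that(2) in blast)
  define r where "r x = (\<lambda>L. if L \<in> A then g L (x L) else b L)" for x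
  define TY where "TY = (\<lambda>f L. if L \<in> A then f L else b L) ` PiE A Y"
  have finTY: "finite TY" unfolding TY_def using Y finite_A by (intro finite_imageI finite_PiE) auto
  have TX: "x L \<in> X L" if "x \<in> T" "L \<in> A" for x L using that by (auto simp: T_def dest: spec[of _ L])
  have rTY: "r x \<in> TY" if "x \<in> T" for x
  proof -
    have "r x = (\<lambda>f L. if L \<in> A then f L else b L) (restrict (r x) A)" by (auto simp: r_def)
    moreover have "restrict (r x) A \<in> PiE A Y" using g TX[OF that] by (auto simp: r_def)
    ultimately show ?thesis unfolding TY_def by blast
  qed
  have rT: "r x \<in> T" if "x \<in> T" for x
    using g TX[OF that] Y by (auto simp: r_def T_def) blast
  define F :: "(('i \<Rightarrow> 'p) list \<Rightarrow>\<^sub>0 'k) set" where "F = bas ` {l. set l \<subseteq> TY \<and> length l = Suc n}"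
  have "finite F" unfolding F_def by (intro finite_imageI finite_lists_length_eq finTY)
  moreover have "\<exists>x\<in>pm.span F. z - x \<in> bdr n t" if z: "z \<in> cyc n s" for z :: "('i \<Rightarrow> 'p) list \<Rightarrow>\<^sub>0 'k"
  proof (intro bexI)
    define P where "P = lin (prism r) z"
    have "lin bd P = push (map r) z - z"
      using prism_chain[of r z] z by (simp add: P_def cyc_def lin.zero)
    then have "z - push (map r) z = lin bd (- P)" by (simp add: lin.neg)
    moreover have "- P \<in> chn (Suc (Suc n)) t"
    proof (rule pm.subspace_neg[OF subspace_chn])
      show "P \<in> chn (Suc (Suc n)) t" unfolding chn_def
      proof (intro CollectI ballI)
        fix u assume "u \<in> keys P"
        then obtain l where l: "l \<in> keys z" "u \<in> keys (prism r l :: _ \<Rightarrow>\<^sub>0 'k)" unfolding P_def by (rule keys_linE)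
        have u: "length u = Suc (length l)" "set u \<subseteq> set l \<union> r ` set l" using keys_prism[OF l(2)] by auto
        have cl: "length l = Suc n" "clique s (set l)" using z l(1) by (auto simp: cyc_def chn_def)
        have lT: "set l \<subseteq> T" using cl(2) by (simp add: clique_def)
        have near: "d L (x L) (r x L) < \<delta>" if "x \<in> set l" "L \<in> A" for x L
          using g[OF that(2) TX[of x L]] lT that by (auto simp: r_def)
        have "clique t (set l \<union> r ` set l)" unfolding clique_def
        proof (intro conjI ballI)
          show "set l \<union> r ` set l \<subseteq> T" using lT rT by blast
          fix p q L assume p: "p \<in> set l \<union> r ` set l" and q: "q \<in> set l \<union> r ` set l" and L: "L \<in> A"
          obtain x where x: "x \<in> set l" "d L (p L) (x L) < \<delta>"
          proof -
            from p consider "p \<in> set l" | x where "x \<in> set l" "p = r x" by blast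
            then show ?thesis
            proof cases
              case 1 then show ?thesis using that \<delta> by auto
            next
              case 2 then show ?thesis using that near[OF _ L] d_sym[of L] by auto
            qed
          qed
          obtain y where y: "y \<in> set l" "d L (y L) (q L) < \<delta>"
          proof -
            from q consider "q \<in> set l" | y where "y \<in> set l" "q = r y" by blast
            then show ?thesis
            proof cases
              case 1 then show ?thesis using that \<delta> by auto
            next
              case 2 then show ?thesis using that near[OF _ L] by auto
            qed
          qed
          have "d L (x L) (y L) < s" using cl(2) x(1) y(1) L by (auto simp: clique_def)
          moreover have "d L (p L) (q L) \<le> d L (p L) (x L) + (d L (x L) (y L) + d L (y L) (q L))"
            using d_tri[of L "p L" "q L" "x L"] d_tri[of L "x L" "q L" "y L"] by linarith
          ultimately show "d L (p L) (q L) < t" using x(2) y(2) by (simp add: \<delta>_def)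
        qed
        then show "length u = Suc (Suc n) \<and> clique t (set u)" using u cl(1) clique_mono by auto
      qed
    qed
    ultimately show "z - push (map r) z \<in> bdr n t" unfolding bdr_def by blast
    have "smul (lookup z l) (bas (map r l)) \<in> pm.span F" if "l \<in> keys z" for l
    proof (intro pm.span_scale pm.span_base)
      have "length l = Suc n" "set l \<subseteq> T" using z that by (auto simp: cyc_def chn_def clique_def)
      then have "map r l \<in> {l. set l \<subseteq> TY \<and> length l = Suc n}" using rTY by auto
      then show "bas (map r l) \<in> F" unfolding F_def by (rule imageI)
    qed
    then show "push (map r) z \<in> pm.span F" unfolding push_def lin_def by (intro pm.span_sum)
  qed
  ultimately show ?thesis by blast
qed

lemma effect_filtered_quotient:
  assumes "A \<noteq> {}" "J \<subseteq> A"
  shows "filtered_quotient (smul :: 'k::field \<Rightarrow> _) (\<lambda>t. cyc n t \<inter> effect J) (\<lambda>t. bdr n t \<inter> effect J)"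
proof (intro filtered_quotient.intro filtered_quotient_axioms.intro)
  fix t s :: real
  show "pm.subspace (cyc n t \<inter> effect J :: (_ \<Rightarrow>\<^sub>0 'k) set)" "pm.subspace (bdr n t \<inter> effect J :: (_ \<Rightarrow>\<^sub>0 'k) set)"
    by (intro pm.subspace_inter subspace_cyc subspace_bdr subspace_effect)+
  show "bdr n t \<inter> effect J \<subseteq> (cyc n t \<inter> effect J :: (_ \<Rightarrow>\<^sub>0 'k) set)" using bdr_sub_cyc by blast
  show "cyc n s \<inter> effect J \<subseteq> (cyc n t \<inter> effect J :: (_ \<Rightarrow>\<^sub>0 'k) set)" if "s \<le> t" using cyc_mono[OF that] by blast
  show "bdr n s \<inter> effect J \<subseteq> (bdr n t \<inter> effect J :: (_ \<Rightarrow>\<^sub>0 'k) set)" if "s \<le> t" using bdr_mono[OF that] by blast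
  show "\<exists>s<t. x \<in> cyc n s \<inter> effect J" if "x \<in> cyc n t \<inter> effect J" for x :: "_ \<Rightarrow>\<^sub>0 'k"
    using cyc_left[of x n t] that by blast
  show "\<exists>s<t. x \<in> bdr n s \<inter> effect J" if "x \<in> bdr n t \<inter> effect J" for x :: "_ \<Rightarrow>\<^sub>0 'k"
    using bdr_left[of x n t] that by blast
  show "cyc n t \<inter> effect J \<subseteq> (bdr n t \<inter> effect J :: (_ \<Rightarrow>\<^sub>0 'k) set)" if "t \<le> 0"
  proof
    fix x :: "_ \<Rightarrow>\<^sub>0 'k" assume x: "x \<in> cyc n t \<inter> effect J"
    then have "x = 0" using chn_nonpos[OF assms(1) that, of x n] by (simp add: cyc_def)
    then show "x \<in> bdr n t \<inter> effect J" using pm.subspace_0[OF subspace_bdr] x by simp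
  qed
  show "\<exists>F. finite F \<and> cyc n s \<inter> effect J \<subseteq> pm.span (F \<union> (bdr n t \<inter> effect J :: (_ \<Rightarrow>\<^sub>0 'k) set))" if st: "s < t"
  proof -
    obtain F where F: "finite F" "\<forall>z\<in>cyc n s. \<exists>x\<in>pm.span F. z - x \<in> (bdr n t :: (_ \<Rightarrow>\<^sub>0 'k) set)"
      using cyc_tame[OF st, of n] by (elim exE conjE)
    \<comment> \<open>The elements of \<open>F\<close> need not lie in \<open>effect J\<close>;
      \<open>proj J\<close> takes them there, fixes \<open>z\<close> and preserves
      boundaries.\<close>
    have "z \<in> pm.span (proj J ` F \<union> (bdr n t \<inter> effect J))" if z: "z \<in> cyc n s \<inter> effect J" for z :: "_ \<Rightarrow>\<^sub>0 'k"
    proof -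
      obtain x where x: "x \<in> pm.span F" "z - x \<in> bdr n t" using bspec[OF F(2), of z] z by blast
      have "proj J x \<in> pm.span (proj J ` F)" using x(1) unfolding proj.span_image by blast
      moreover have "proj J (z - x) \<in> bdr n t \<inter> effect J" using proj_bdr[OF x(2)] proj_effect[OF assms(2)] by blast
      ultimately have "proj J x + proj J (z - x) \<in> pm.span (proj J ` F \<union> (bdr n t \<inter> effect J))"
        using pm.span_mono[of "proj J ` F" "proj J ` F \<union> (bdr n t \<inter> effect J)"]
        by (intro pm.span_add pm.span_base[of "proj J (z - x)"]) auto
      moreover have "proj J x + proj J (z - x) = z" using proj_id[of z J] z by (simp add: proj.diff)
      ultimately show ?thesis by simp
    qed
    then show ?thesis using F(1) by (intro exI[of _ "proj J ` F"]) auto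
  qed
qed (rule pm.vector_space_axioms)

end

section \<open>Barcodes of products\<close>

text \<open>The coefficients are attached to indices and not to vectors, since the coefficient
  functions in \<open>interval_basis\<close> are defined on bars.\<close>

lemma (in vector_space) span_coefficients:
  assumes U: "subspace U" and x: "x \<in> span (f ` S \<union> U)"
  shows "\<exists>A a. finite A \<and> A \<subseteq> S \<and> x - (\<Sum>i\<in>A. scale (a i) (f i)) \<in> U"
proof -
  define W where "W = {x. \<exists>A a. finite A \<and> A \<subseteq> S \<and> x - (\<Sum>i\<in>A. scale (a i) (f i)) \<in> U}"
  have WI: "x \<in> W" if "finite A" "A \<subseteq> S" "x - (\<Sum>i\<in>A. scale (a i) (f i)) \<in> U" for x A a
    using that unfolding W_def by blast
  have "span (f ` S \<union> U) \<subseteq> W"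
  proof (rule span_minimal)
    have "f i \<in> W" if "i \<in> S" for i
      by (rule WI[of "{i}" _ "\<lambda>_. 1"]) (use that subspace_0[OF U] in auto)
    moreover have "u \<in> W" if "u \<in> U" for u
      by (rule WI[of "{}"]) (use that in auto)
    ultimately show "f ` S \<union> U \<subseteq> W" by blast
    show "subspace W"
    proof (rule subspaceI)
      show "0 \<in> W" by (rule WI[of "{}"]) (use subspace_0[OF U] in auto)
    next
      fix x y assume "x \<in> W" "y \<in> W"
      then obtain A a A' a' where A: "finite A" "A \<subseteq> S" "x - (\<Sum>i\<in>A. scale (a i) (f i)) \<in> U"
        and A': "finite A'" "A' \<subseteq> S" "y - (\<Sum>i\<in>A'. scale (a' i) (f i)) \<in> U" unfolding W_def by blast
      define c where "c i = (if i \<in> A then a i else 0)" for i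
      define c' where "c' i = (if i \<in> A' then a' i else 0)" for i
      have 1: "(\<Sum>i\<in>A. scale (a i) (f i)) = (\<Sum>i\<in>A \<union> A'. scale (c i) (f i))"
        using A(1) A'(1) by (intro sum.mono_neutral_cong_left) (auto simp: c_def)
      have 2: "(\<Sum>i\<in>A'. scale (a' i) (f i)) = (\<Sum>i\<in>A \<union> A'. scale (c' i) (f i))"
        using A(1) A'(1) by (intro sum.mono_neutral_cong_left) (auto simp: c'_def)
      have "(x - (\<Sum>i\<in>A. scale (a i) (f i))) + (y - (\<Sum>i\<in>A'. scale (a' i) (f i))) \<in> U"
        using subspace_add[OF U A(3) A'(3)] .
      then have "x + y - (\<Sum>i\<in>A \<union> A'. scale (c i + c' i) (f i)) \<in> U"
        unfolding 1 2 by (simp add: scale_left_distrib sum.distrib algebra_simps)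
      then show "x + y \<in> W" using A A' by (intro WI[of "A \<union> A'"]) auto
    next
      fix k x assume "x \<in> W"
      then obtain A a where A: "finite A" "A \<subseteq> S" "x - (\<Sum>i\<in>A. scale (a i) (f i)) \<in> U" unfolding W_def by blast
      have "scale k x - (\<Sum>i\<in>A. scale (k * a i) (f i)) = scale k (x - (\<Sum>i\<in>A. scale (a i) (f i)))"
        by (simp add: scale_right_diff_distrib scale_sum_right)
      then show "scale k x \<in> W" using A subspace_scale[OF U A(3), of k] by (intro WI[of A _ "\<lambda>i. k * a i"]) auto
    qed
  qed
  then show ?thesis using x unfolding W_def by blast
qed

section \<open>Comparison with chains given by coefficient functions\<close>

lemma bd_eq_sum: "bd s = (\<Sum>i<length s. smul ((-1) ^ i) (bas (face i s)) :: 'v list \<Rightarrow>\<^sub>0 'k::field)"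
proof (induction s)
  case (Cons x s)
  have "push (Cons x) (bd s :: 'v list \<Rightarrow>\<^sub>0 'k) = (\<Sum>i<length s. smul ((-1) ^ i) (bas (x # face i s)))"
    unfolding Cons.IH by (simp add: push_def lin.sum lin.scale)
  then show ?case
    by (simp add: sum.lessThan_Suc_shift face_def sum_negf[symmetric] del: sum.lessThan_Suc)
qed simp

definition kchains :: "nat \<Rightarrow> 'v set set \<Rightarrow> ('v list \<Rightarrow>\<^sub>0 'k::field) set" where
  "kchains l K = {c. \<forall>s\<in>keys c. length s = l \<and> set s \<in> K}"

lemma subspace_kchains: "pm.subspace (kchains l K)"
  by (rule pm.subspaceI)
    (auto simp: kchains_def dest: subsetD[OF Poly_Mapping.keys_add] subsetD[OF keys_smul])

lemma chains_lookup: "chains n K = lookup ` kchains (Suc n) K"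
proof (intro equalityI subsetI)
  fix c assume c: "c \<in> chains n K"
  then have "finite {s. c s \<noteq> 0}" by (simp add: chains_def)
  then have "lookup (Abs_poly_mapping c) = c" by simp
  moreover from this have "Abs_poly_mapping c \<in> kchains (Suc n) K"
    using c by (auto simp: kchains_def chains_def in_keys_iff)
  ultimately show "c \<in> lookup ` kchains (Suc n) K" by (metis imageI)
qed (auto simp: chains_def kchains_def in_keys_iff)

text \<open>\<open>bd\<close> is augmented while \<open>boundary\<close> is 0 in degree 0; from
  degree 1 on both are the alternating sum of faces.\<close>

lemma boundary_lookup:
  assumes "1 \<le> n" "c \<in> kchains (Suc n) K"
  shows "boundary n (lookup c) = lookup (lin bd c)"
proof
  fix t
  have "lookup (lin bd c) t = (\<Sum>s\<in>keys c. lookup c s * (\<Sum>i<length s. (-1) ^ i * (if face i s = t then 1 else 0)))"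
    by (simp add: lin_def lookup_sum bd_eq_sum lookup_bas)
  also have "\<dots> = (\<Sum>s\<in>keys c. \<Sum>i\<le>n. if face i s = t then (-1) ^ i * lookup c s else 0)"
  proof (rule sum.cong[OF refl])
    fix s assume "s \<in> keys c"
    then have "length s = Suc n" using assms(2) by (auto simp: kchains_def)
    then show "lookup c s * (\<Sum>i<length s. (-1) ^ i * (if face i s = t then 1 else 0)) =
        (\<Sum>i\<le>n. if face i s = t then (-1) ^ i * lookup c s else 0)"
      unfolding sum_distrib_left lessThan_Suc_atMost[symmetric] by (intro sum.cong) auto
  qed
  also have "keys c = {s. lookup c s \<noteq> 0}" by (auto simp: in_keys_iff)
  finally show "boundary n (lookup c) t = lookup (lin bd c) t" using assms(1) by (simp add: boundary_def)
qed

lemma boundaries_lookup: "1 \<le> n \<Longrightarrow> boundaries n K = lookup ` lin bd ` kchains (Suc (Suc n)) K"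
  unfolding boundaries_def chains_lookup image_image
  by (intro image_cong refl boundary_lookup) auto

lemma cycles_lookup: "1 \<le> n \<Longrightarrow> cycles n K = lookup ` {c \<in> kchains (Suc n) K. lin bd c = 0}"
  unfolding cycles_def chains_lookup
proof (intro equalityI subsetI)
  fix c assume n: "1 \<le> n" and "c \<in> {c \<in> lookup ` kchains (Suc n) K. boundary n c = (\<lambda>_. 0)}"
  then obtain c' where c': "c = lookup c'" "c' \<in> kchains (Suc n) K" "boundary n (lookup c') = (\<lambda>_. 0)" by blast
  then have "lookup (lin bd c') = lookup 0" using boundary_lookup[OF n c'(2)] by (auto simp: fun_eq_iff)
  then show "c \<in> lookup ` {c \<in> kchains (Suc n) K. lin bd c = 0}" using c' by (auto simp: lookup_inject)
qed (auto simp: boundary_lookup)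

text \<open>The unique coefficient function is split into spanning and independence over finite sets
  of bars. Uniqueness follows by subtracting two coefficient functions on the union of their
  supports.\<close>

lemma interval_basisI:
  fixes z :: "tagged_bar \<Rightarrow> real \<Rightarrow> ('v list \<Rightarrow>\<^sub>0 'k::field)"
  assumes n: "1 \<le> n"
    and cyc: "\<And>\<beta> \<epsilon>. \<beta> \<in> B \<Longrightarrow> \<epsilon> \<in> bar_set (fst \<beta>) \<Longrightarrow> z \<beta> \<epsilon> \<in> kchains (Suc n) (K \<epsilon>) \<and> lin bd (z \<beta> \<epsilon>) = 0"
    and coh: "\<And>\<beta> \<epsilon> \<epsilon>'. \<beta> \<in> B \<Longrightarrow> \<epsilon> \<in> bar_set (fst \<beta>) \<Longrightarrow> \<epsilon> \<le> \<epsilon>' \<Longrightarrow>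
      z \<beta> \<epsilon> - (if \<epsilon>' \<in> bar_set (fst \<beta>) then z \<beta> \<epsilon>' else 0) \<in> lin bd ` kchains (Suc (Suc n)) (K \<epsilon>')"
    and span: "\<And>\<epsilon> c. c \<in> kchains (Suc n) (K \<epsilon>) \<Longrightarrow> lin bd c = 0 \<Longrightarrow> \<exists>A a. finite A \<and>
      A \<subseteq> {\<beta>\<in>B. \<epsilon> \<in> bar_set (fst \<beta>)} \<and> c - (\<Sum>\<beta>\<in>A. smul (a \<beta>) (z \<beta> \<epsilon>)) \<in> lin bd ` kchains (Suc (Suc n)) (K \<epsilon>)"
    and ind: "\<And>\<epsilon> A a. finite A \<Longrightarrow> A \<subseteq> {\<beta>\<in>B. \<epsilon> \<in> bar_set (fst \<beta>)} \<Longrightarrow>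
      (\<Sum>\<beta>\<in>A. smul (a \<beta>) (z \<beta> \<epsilon>)) \<in> lin bd ` kchains (Suc (Suc n)) (K \<epsilon>) \<Longrightarrow> \<forall>\<beta>\<in>A. a \<beta> = 0"
  shows "interval_basis n K B (\<lambda>\<beta> \<epsilon>. lookup (z \<beta> \<epsilon>))"
proof -
  define Bd where "Bd \<epsilon> = lin bd ` (kchains (Suc (Suc n)) (K \<epsilon>) :: ('v list \<Rightarrow>\<^sub>0 'k) set)" for \<epsilon>
  have sub: "pm.subspace (Bd \<epsilon>)" for \<epsilon>
    unfolding Bd_def by (rule lin.subspace_image[OF subspace_kchains])
  have hom: "homologous n (K \<epsilon>) (lookup x) (lookup y) \<longleftrightarrow> x - y \<in> Bd \<epsilon>" for x y :: "'v list \<Rightarrow>\<^sub>0 'k" and \<epsilon>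
  proof -
    have "(\<lambda>s. lookup x s - lookup y s) = lookup (x - y)" by (simp add: fun_eq_iff lookup_minus)
    then show ?thesis
      unfolding homologous_def boundaries_lookup[OF n] Bd_def by (metis (no_types, lifting) image_iff lookup_inject)
  qed
  have comb: "(\<lambda>s. \<Sum>\<beta> | a \<beta> \<noteq> 0. a \<beta> * lookup (z \<beta> \<epsilon>) s) = lookup (\<Sum>\<beta> | a \<beta> \<noteq> 0. smul (a \<beta>) (z \<beta> \<epsilon>))" for a \<epsilon>
    by (simp add: fun_eq_iff lookup_sum)
  show ?thesis unfolding interval_basis_def
  proof (intro conjI ballI allI impI)
    fix \<beta> \<epsilon> assume "\<beta> \<in> B" "\<epsilon> \<in> bar_set (fst \<beta>)"
    then show "lookup (z \<beta> \<epsilon>) \<in> cycles n (K \<epsilon>)" using cyc unfolding cycles_lookup[OF n] by blast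
  next
    fix \<beta> \<epsilon> \<epsilon>' assume \<beta>: "\<beta> \<in> B" "\<epsilon> \<in> bar_set (fst \<beta>)" "\<epsilon> \<le> \<epsilon>'"
    have "(if \<epsilon>' \<in> bar_set (fst \<beta>) then lookup (z \<beta> \<epsilon>') else (\<lambda>_. 0)) =
        lookup (if \<epsilon>' \<in> bar_set (fst \<beta>) then z \<beta> \<epsilon>' else 0)" by (auto simp: fun_eq_iff)
    then show "homologous n (K \<epsilon>') (lookup (z \<beta> \<epsilon>)) (if \<epsilon>' \<in> bar_set (fst \<beta>) then lookup (z \<beta> \<epsilon>') else (\<lambda>_. 0))"
      using coh[OF \<beta>] by (simp only: hom Bd_def)
  next
    fix \<epsilon> and c :: "'v list \<Rightarrow> 'k" assume "c \<in> cycles n (K \<epsilon>)"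
    then obtain c' where c': "c = lookup c'" "c' \<in> kchains (Suc n) (K \<epsilon>)" "lin bd c' = 0"
      unfolding cycles_lookup[OF n] by blast
    obtain A a where A: "finite A" "A \<subseteq> {\<beta>\<in>B. \<epsilon> \<in> bar_set (fst \<beta>)}" "c' - (\<Sum>\<beta>\<in>A. smul (a \<beta>) (z \<beta> \<epsilon>)) \<in> Bd \<epsilon>"
      using span[OF c'(2,3)] unfolding Bd_def by blast
    define a' where "a' \<beta> = (if \<beta> \<in> A then a \<beta> else 0)" for \<beta>
    have a'A: "{\<beta>. a' \<beta> \<noteq> 0} \<subseteq> A" by (auto simp: a'_def)
    have "(\<Sum>\<beta> | a' \<beta> \<noteq> 0. smul (a' \<beta>) (z \<beta> \<epsilon>)) = (\<Sum>\<beta>\<in>A. smul (a \<beta>) (z \<beta> \<epsilon>))"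
      using A(1) a'A by (intro sum.mono_neutral_cong_left) (auto simp: a'_def)
    then have ex: "finite {\<beta>. a' \<beta> \<noteq> 0} \<and> {\<beta>. a' \<beta> \<noteq> 0} \<subseteq> {\<beta>\<in>B. \<epsilon> \<in> bar_set (fst \<beta>)} \<and>
        homologous n (K \<epsilon>) c (\<lambda>s. \<Sum>\<beta> | a' \<beta> \<noteq> 0. a' \<beta> * lookup (z \<beta> \<epsilon>) s)"
      using A a'A finite_subset[OF a'A A(1)] unfolding comb c'(1) hom by auto
    have uniq: "f = a'" if "finite {\<beta>. f \<beta> \<noteq> 0}" "{\<beta>. f \<beta> \<noteq> 0} \<subseteq> {\<beta>\<in>B. \<epsilon> \<in> bar_set (fst \<beta>)}"
      "homologous n (K \<epsilon>) c (\<lambda>s. \<Sum>\<beta> | f \<beta> \<noteq> 0. f \<beta> * lookup (z \<beta> \<epsilon>) s)" for f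
    proof -
      define D where "D = {\<beta>. f \<beta> \<noteq> 0} \<union> {\<beta>. a' \<beta> \<noteq> 0}"
      have D: "finite D" "D \<subseteq> {\<beta>\<in>B. \<epsilon> \<in> bar_set (fst \<beta>)}" using that ex by (auto simp: D_def)
      have "(c' - (\<Sum>\<beta> | f \<beta> \<noteq> 0. smul (f \<beta>) (z \<beta> \<epsilon>))) \<in> Bd \<epsilon>" "(c' - (\<Sum>\<beta> | a' \<beta> \<noteq> 0. smul (a' \<beta>) (z \<beta> \<epsilon>))) \<in> Bd \<epsilon>"
        using that(3) ex unfolding comb c'(1) hom by auto
      from pm.subspace_diff[OF sub this(2,1)]
      have "(\<Sum>\<beta> | f \<beta> \<noteq> 0. smul (f \<beta>) (z \<beta> \<epsilon>)) - (\<Sum>\<beta> | a' \<beta> \<noteq> 0. smul (a' \<beta>) (z \<beta> \<epsilon>)) \<in> Bd \<epsilon>" by simp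
      moreover have "(\<Sum>\<beta> | f \<beta> \<noteq> 0. smul (f \<beta>) (z \<beta> \<epsilon>)) = (\<Sum>\<beta>\<in>D. smul (f \<beta>) (z \<beta> \<epsilon>))"
        using D(1) by (intro sum.mono_neutral_left) (auto simp: D_def)
      moreover have "(\<Sum>\<beta> | a' \<beta> \<noteq> 0. smul (a' \<beta>) (z \<beta> \<epsilon>)) = (\<Sum>\<beta>\<in>D. smul (a' \<beta>) (z \<beta> \<epsilon>))"
        using D(1) by (intro sum.mono_neutral_left) (auto simp: D_def)
      ultimately have "(\<Sum>\<beta>\<in>D. smul (f \<beta> - a' \<beta>) (z \<beta> \<epsilon>)) \<in> Bd \<epsilon>"
        by (simp add: pm.scale_left_diff_distrib sum_subtractf)
      then have eq: "\<forall>\<beta>\<in>D. f \<beta> - a' \<beta> = 0" by (intro ind[OF D]) (simp add: Bd_def)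
      show ?thesis
      proof
        fix \<beta> show "f \<beta> = a' \<beta>"
          using bspec[OF eq, of \<beta>] by (cases "\<beta> \<in> D") (simp_all add: D_def)
      qed
    qed
    show "\<exists>!a. finite {\<beta>. a \<beta> \<noteq> 0} \<and> {\<beta>. a \<beta> \<noteq> 0} \<subseteq> {\<beta>\<in>B. \<epsilon> \<in> bar_set (fst \<beta>)} \<and>
        homologous n (K \<epsilon>) c (\<lambda>s. \<Sum>\<beta> | a \<beta> \<noteq> 0. a \<beta> * lookup (z \<beta> \<epsilon>) s)"
    proof (rule ex1I)
      show "finite {\<beta>. a' \<beta> \<noteq> 0} \<and> {\<beta>. a' \<beta> \<noteq> 0} \<subseteq> {\<beta>\<in>B. \<epsilon> \<in> bar_set (fst \<beta>)} \<and>
        homologous n (K \<epsilon>) c (\<lambda>s. \<Sum>\<beta> | a' \<beta> \<noteq> 0. a' \<beta> * lookup (z \<beta> \<epsilon>) s)" by (rule ex)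
    qed (elim conjE, rule uniq)
  qed
qed

context rips_product
begin

interpretation proj: Vector_Spaces.linear "smul :: 'k::field \<Rightarrow> _" smul "proj J" for J
  by (rule proj_linear)

text \<open>The interval bases of the parts of all nonempty \<open>J\<close> with at most
  \<open>n\<close> elements are put together. The spanning clause concerns cycles with the
  coordinates outside \<open>I\<close> reset and uses bars supported in \<open>I\<close> only; this
  is what serves all projections with a single basis.\<close>

theorem product_barcode:
  assumes ne: "A \<noteq> {}"
  shows "\<exists>(Bar :: tagged_bar set) (supp :: tagged_bar \<Rightarrow> 'i set)
      (z :: tagged_bar \<Rightarrow> real \<Rightarrow> (('i \<Rightarrow> 'p) list \<Rightarrow>\<^sub>0 'k::field)).
    (\<forall>\<beta>\<in>Bar. ereal (fst (fst \<beta>)) < snd (fst \<beta>) \<and> supp \<beta> \<subseteq> A \<and> supp \<beta> \<noteq> {} \<and> card (supp \<beta>) \<le> n) \<and>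
    (\<forall>\<beta>\<in>Bar. \<forall>\<epsilon>\<in>bar_set (fst \<beta>). z \<beta> \<epsilon> \<in> cyc n \<epsilon> \<inter> effect (supp \<beta>)) \<and>
    (\<forall>\<beta>\<in>Bar. \<forall>\<epsilon>\<in>bar_set (fst \<beta>). \<forall>\<epsilon>'\<ge>\<epsilon>.
       z \<beta> \<epsilon> - (if \<epsilon>' \<in> bar_set (fst \<beta>) then z \<beta> \<epsilon>' else 0) \<in> bdr n \<epsilon>') \<and>
    (\<forall>I\<subseteq>A. \<forall>\<epsilon>. \<forall>c\<in>cyc n \<epsilon>. (\<forall>L\<in>A - I. e L c = c) \<longrightarrow>
       c \<in> pm.span ((\<lambda>\<beta>. z \<beta> \<epsilon>) ` {\<beta>\<in>Bar. supp \<beta> \<subseteq> I \<and> \<epsilon> \<in> bar_set (fst \<beta>)} \<union> bdr n \<epsilon>)) \<and>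
    (\<forall>\<epsilon> S a. finite S \<and> S \<subseteq> {\<beta>\<in>Bar. \<epsilon> \<in> bar_set (fst \<beta>)} \<and> (\<Sum>\<beta>\<in>S. smul (a \<beta>) (z \<beta> \<epsilon>)) \<in> bdr n \<epsilon> \<longrightarrow>
       (\<forall>\<beta>\<in>S. a \<beta> = 0))"
proof -
  define good :: "'i set \<Rightarrow> tagged_bar set \<times> (tagged_bar \<Rightarrow> real \<Rightarrow> (('i \<Rightarrow> 'p) list \<Rightarrow>\<^sub>0 'k)) \<Rightarrow> bool" where
    "good J Bz \<longleftrightarrow>
      (\<forall>\<beta>\<in>fst Bz. ereal (fst (fst \<beta>)) < snd (fst \<beta>)) \<and>
      (\<forall>\<beta>\<in>fst Bz. \<forall>\<epsilon>\<in>bar_set (fst \<beta>). snd Bz \<beta> \<epsilon> \<in> cyc n \<epsilon> \<inter> effect J) \<and>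
      (\<forall>\<beta>\<in>fst Bz. \<forall>\<epsilon>\<in>bar_set (fst \<beta>). \<forall>\<epsilon>'\<ge>\<epsilon>.
         snd Bz \<beta> \<epsilon> - (if \<epsilon>' \<in> bar_set (fst \<beta>) then snd Bz \<beta> \<epsilon>' else 0) \<in> bdr n \<epsilon>' \<inter> effect J) \<and>
      (\<forall>\<epsilon>. cyc n \<epsilon> \<inter> effect J \<subseteq>
         pm.span ((\<lambda>\<beta>. snd Bz \<beta> \<epsilon>) ` {\<beta>\<in>fst Bz. \<epsilon> \<in> bar_set (fst \<beta>)} \<union> (bdr n \<epsilon> \<inter> effect J))) \<and>
      (\<forall>\<epsilon> S a. finite S \<and> S \<subseteq> {\<beta>\<in>fst Bz. \<epsilon> \<in> bar_set (fst \<beta>)} \<and>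
         (\<Sum>\<beta>\<in>S. smul (a \<beta>) (snd Bz \<beta> \<epsilon>)) \<in> bdr n \<epsilon> \<inter> effect J \<longrightarrow> (\<forall>\<beta>\<in>S. a \<beta> = 0))" for J Bz
  have "\<exists>Bz. good J Bz" if "J \<subseteq> A" for J
    using filtered_quotient.barcode_exists[OF effect_filtered_quotient[OF ne that]]
    unfolding good_def split_paired_Ex fst_conv snd_conv .
  then have "\<forall>J. \<exists>Bz. J \<subseteq> A \<longrightarrow> good J Bz" by blast
  from choice[OF this] obtain f where f: "\<And>J. J \<subseteq> A \<Longrightarrow> good J (f J)" by blast
  define BB where "BB J = fst (f J)" for J
  define zz where "zz J = snd (f J)" for J
  note f' = f[unfolded good_def, folded BB_def zz_def]
  note gd =
    bspec[OF conjunct1[OF f']]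
    bspec[OF bspec[OF conjunct1[OF conjunct2[OF f']]]]
    mp[OF spec[OF bspec[OF bspec[OF conjunct1[OF conjunct2[OF conjunct2[OF f']]]]]]]
    spec[OF conjunct1[OF conjunct2[OF conjunct2[OF conjunct2[OF f']]]]]
    mp[OF spec[OF spec[OF spec[OF conjunct2[OF conjunct2[OF conjunct2[OF conjunct2[OF f']]]]]]]]
  obtain enc :: "'i set \<Rightarrow> nat" where enc: "inj_on enc (Pow A)"
    using finite_imp_inj_to_nat_seg[of "Pow A"] finite_A by auto
  define JJ where "JJ = {J. J \<subseteq> A \<and> J \<noteq> {} \<and> card J \<le> n}"
  \<comment> \<open>The new tag encodes \<open>J\<close> along with the old tag, so that bars of
    different parts stay apart and the support can be read off.\<close>
  define mk where "mk J \<gamma> = (fst \<gamma>, prod_encode (enc J, snd \<gamma>))" for J and \<gamma> :: tagged_bar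
  define Bar where "Bar = (\<Union>J\<in>JJ. mk J ` BB J)"
  define supp where "supp \<beta> = the_inv_into (Pow A) enc (fst (prod_decode (snd \<beta>)))" for \<beta> :: tagged_bar
  define tg :: "tagged_bar \<Rightarrow> tagged_bar" where "tg \<beta> = (fst \<beta>, snd (prod_decode (snd \<beta>)))" for \<beta>
  define z where "z \<beta> = zz (supp \<beta>) (tg \<beta>)" for \<beta>
  have supp_mk: "supp (mk J \<gamma>) = J" if "J \<subseteq> A" for J \<gamma>
    using that by (simp add: supp_def mk_def the_inv_into_f_f[OF enc])
  have tg_mk: "tg (mk J \<gamma>) = \<gamma>" for J \<gamma> by (simp add: tg_def mk_def)
  have fst_mk: "fst (mk J \<gamma>) = fst \<gamma>" for J \<gamma> by (simp add: mk_def)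
  have z_mk: "z (mk J \<gamma>) = zz J \<gamma>" if "J \<subseteq> A" for J \<gamma> by (simp add: z_def supp_mk[OF that] tg_mk)
  have BarD: "\<exists>J \<gamma>. J \<in> JJ \<and> J \<subseteq> A \<and> \<gamma> \<in> BB J \<and> \<beta> = mk J \<gamma>" if \<beta>: "\<beta> \<in> Bar" for \<beta>
  proof -
    obtain J where J: "J \<in> JJ" "\<beta> \<in> mk J ` BB J" using \<beta> unfolding Bar_def by (rule UN_E)
    obtain \<gamma> where "\<beta> = mk J \<gamma>" "\<gamma> \<in> BB J" using J(2) by (rule imageE)
    moreover have "J \<subseteq> A" using J(1) by (simp add: JJ_def)
    ultimately show ?thesis using J(1) by blast
  qed
  show ?thesis
  proof (intro exI[of _ Bar] exI[of _ supp] exI[of _ z] conjI ballI allI impI)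
    fix \<beta> assume "\<beta> \<in> Bar"
    then obtain J \<gamma> where J: "J \<in> JJ" "J \<subseteq> A" "\<gamma> \<in> BB J" "\<beta> = mk J \<gamma>" using BarD by blast
    show "ereal (fst (fst \<beta>)) < snd (fst \<beta>)" using gd(1)[OF J(2,3)] by (simp add: J(4) fst_mk)
    show "supp \<beta> \<subseteq> A" "supp \<beta> \<noteq> {}" "card (supp \<beta>) \<le> n" using J by (simp_all add: supp_mk JJ_def)
    fix \<epsilon> assume "\<epsilon> \<in> bar_set (fst \<beta>)"
    then have \<epsilon>: "\<epsilon> \<in> bar_set (fst \<gamma>)" by (simp add: J(4) fst_mk)
    show "z \<beta> \<epsilon> \<in> cyc n \<epsilon> \<inter> effect (supp \<beta>)"
      unfolding J(4) z_mk[OF J(2)] supp_mk[OF J(2)] by (rule gd(2)[OF J(2,3) \<epsilon>])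
    fix \<epsilon>' assume "\<epsilon> \<le> \<epsilon>'"
    from gd(3)[OF J(2,3) \<epsilon> this]
    show "z \<beta> \<epsilon> - (if \<epsilon>' \<in> bar_set (fst \<beta>) then z \<beta> \<epsilon>' else 0) \<in> bdr n \<epsilon>'"
      unfolding J(4) z_mk[OF J(2)] fst_mk by blast
  next
    fix I \<epsilon> and c :: "('i \<Rightarrow> 'p) list \<Rightarrow>\<^sub>0 'k"
    assume I: "I \<subseteq> A" and c: "c \<in> cyc n \<epsilon>" and fixed: "\<forall>L\<in>A - I. e L c = c"
    let ?W = "pm.span ((\<lambda>\<beta>. z \<beta> \<epsilon>) ` {\<beta>\<in>Bar. supp \<beta> \<subseteq> I \<and> \<epsilon> \<in> bar_set (fst \<beta>)} \<union> bdr n \<epsilon>)"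
    have bW: "bdr n \<epsilon> \<subseteq> ?W" using pm.span_superset by blast
    have "proj J c \<in> ?W" if J: "J \<subseteq> A" for J
    proof -
      have p: "proj J c \<in> cyc n \<epsilon>" "proj J c \<in> effect J" using proj_cyc[OF c] proj_effect[OF J] by auto
      \<comment> \<open>If some coordinate \<open>L\<close> of \<open>J\<close> lies outside
        \<open>I\<close>, then \<open>e L\<close> both kills and fixes the component, which is
        therefore 0. For \<open>J\<close> empty or too large the component is a boundary.\<close>
      consider "\<not> J \<subseteq> I" | "J = {}" | "J \<noteq> {}" "n < card J" | "J \<in> JJ" "J \<subseteq> I" using J unfolding JJ_def by force
      then show ?thesis
      proof cases
        case 1
        then obtain L where "L \<in> J" "L \<in> A - I" using J by blast
        then have "proj J c = 0" using e_proj[of L J c] p(2) fixed by (auto simp: effect_def)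
        then show ?thesis by (simp add: pm.span_zero)
      next
        case 2
        then show ?thesis using effect_empty_boundary[OF p(1)] p(2) bW by auto
      next
        case 3
        then show ?thesis using effect_boundary[OF J 3 p] bW by blast
      next
        case 4
        have "(\<lambda>\<beta>. zz J \<beta> \<epsilon>) ` {\<beta>\<in>BB J. \<epsilon> \<in> bar_set (fst \<beta>)} \<subseteq>
            (\<lambda>\<beta>. z \<beta> \<epsilon>) ` {\<beta>\<in>Bar. supp \<beta> \<subseteq> I \<and> \<epsilon> \<in> bar_set (fst \<beta>)}"
        proof (rule image_subsetI)
          fix \<gamma> assume "\<gamma> \<in> {\<beta>\<in>BB J. \<epsilon> \<in> bar_set (fst \<beta>)}"
          then have "mk J \<gamma> \<in> {\<beta>\<in>Bar. supp \<beta> \<subseteq> I \<and> \<epsilon> \<in> bar_set (fst \<beta>)}"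
            using 4 supp_mk[OF J] by (auto simp: Bar_def fst_mk)
          then show "zz J \<gamma> \<epsilon> \<in> (\<lambda>\<beta>. z \<beta> \<epsilon>) ` {\<beta>\<in>Bar. supp \<beta> \<subseteq> I \<and> \<epsilon> \<in> bar_set (fst \<beta>)}"
            using z_mk[OF J, of \<gamma>] by (metis (no_types, lifting) image_eqI)
        qed
        then have "pm.span ((\<lambda>\<beta>. zz J \<beta> \<epsilon>) ` {\<beta>\<in>BB J. \<epsilon> \<in> bar_set (fst \<beta>)} \<union> (bdr n \<epsilon> \<inter> effect J)) \<subseteq> ?W"
          by (intro pm.span_mono) blast
        then show ?thesis using gd(4)[OF J, of \<epsilon>] p by blast
      qed
    qed
    then have "(\<Sum>J\<in>Pow A. proj J c) \<in> ?W" by (intro pm.span_sum) auto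
    then show "c \<in> ?W" by (simp add: sum_proj)
  next
    fix \<epsilon> S a \<beta>
    assume S: "finite S \<and> S \<subseteq> {\<beta>\<in>Bar. \<epsilon> \<in> bar_set (fst \<beta>)} \<and> (\<Sum>\<beta>\<in>S. smul (a \<beta>) (z \<beta> \<epsilon>)) \<in> bdr n \<epsilon>"
      and \<beta>: "\<beta> \<in> S"
    define J where "J = supp \<beta>"
    have SD: "\<exists>\<gamma>. \<gamma> \<in> BB (supp \<alpha>) \<and> \<alpha> = mk (supp \<alpha>) \<gamma> \<and> supp \<alpha> \<subseteq> A \<and> \<epsilon> \<in> bar_set (fst \<gamma>)" if \<alpha>: "\<alpha> \<in> S" for \<alpha>
    proof -
      have "\<alpha> \<in> Bar" "\<epsilon> \<in> bar_set (fst \<alpha>)" using S \<alpha> by auto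
      then show ?thesis using BarD[of \<alpha>] supp_mk fst_mk by metis
    qed
    have JA: "J \<subseteq> A" using SD[OF \<beta>] unfolding J_def by blast
    define S' where "S' = {\<alpha>\<in>S. supp \<alpha> = J}"
    have S': "finite S'" "S' \<subseteq> S" using S by (auto simp: S'_def)
    have zeff: "z \<alpha> \<epsilon> \<in> effect (supp \<alpha>)" if "\<alpha> \<in> S" for \<alpha>
      using SD[OF that] gd(2) z_mk by (metis IntD2)
    \<comment> \<open>\<open>proj J\<close> preserves boundaries and deletes the terms of other
      supports, so a relation among all bars yields one within the part of \<open>J\<close>.\<close>
    have "proj J (\<Sum>\<alpha>\<in>S. smul (a \<alpha>) (z \<alpha> \<epsilon>)) = (\<Sum>\<alpha>\<in>S. smul (a \<alpha>) (proj J (z \<alpha> \<epsilon>)))"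
      by (simp add: proj.sum proj.scale)
    also have "\<dots> = (\<Sum>\<alpha>\<in>S'. smul (a \<alpha>) (z \<alpha> \<epsilon>))"
    proof (rule sum.mono_neutral_cong_right)
      show "\<forall>\<alpha>\<in>S - S'. smul (a \<alpha>) (proj J (z \<alpha> \<epsilon>)) = 0"
      proof
        fix \<alpha> assume "\<alpha> \<in> S - S'"
        then have \<alpha>: "\<alpha> \<in> S" "J \<noteq> supp \<alpha>" "supp \<alpha> \<subseteq> A" using SD[of \<alpha>] by (auto simp: S'_def)
        then have "proj J (z \<alpha> \<epsilon>) = 0" using proj_other[OF zeff[OF \<alpha>(1)] JA \<alpha>(3,2)] by simp
        then show "smul (a \<alpha>) (proj J (z \<alpha> \<epsilon>)) = 0" by simp
      qed
      show "smul (a \<alpha>) (proj J (z \<alpha> \<epsilon>)) = smul (a \<alpha>) (z \<alpha> \<epsilon>)" if "\<alpha> \<in> S'" for \<alpha>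
        using zeff[of \<alpha>] proj_id[of "z \<alpha> \<epsilon>" J] that by (auto simp: S'_def)
    qed (use S S' in auto)
    finally have eq: "proj J (\<Sum>\<alpha>\<in>S. smul (a \<alpha>) (z \<alpha> \<epsilon>)) = (\<Sum>\<alpha>\<in>S'. smul (a \<alpha>) (z \<alpha> \<epsilon>))" .
    have "proj J (\<Sum>\<alpha>\<in>S. smul (a \<alpha>) (z \<alpha> \<epsilon>)) \<in> bdr n \<epsilon> \<inter> effect J"
      using proj_bdr S proj_effect[OF JA] by blast
    then have mem: "(\<Sum>\<alpha>\<in>S'. smul (a \<alpha>) (z \<alpha> \<epsilon>)) \<in> bdr n \<epsilon> \<inter> effect J" unfolding eq .
    have mktg: "mk J (tg \<alpha>) = \<alpha> \<and> tg \<alpha> \<in> BB J \<and> \<epsilon> \<in> bar_set (fst (tg \<alpha>))" if "\<alpha> \<in> S'" for \<alpha>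
    proof -
      have "\<alpha> \<in> S" "supp \<alpha> = J" using that by (auto simp: S'_def)
      then show ?thesis using SD[of \<alpha>] tg_mk by metis
    qed
    have inj: "inj_on tg S'" by (rule inj_onI) (metis mktg)
    have "\<forall>\<gamma>\<in>tg ` S'. a (mk J \<gamma>) = 0"
    proof (rule gd(5)[OF JA], intro conjI)
      have "(\<Sum>\<gamma>\<in>tg ` S'. smul (a (mk J \<gamma>)) (zz J \<gamma> \<epsilon>)) = (\<Sum>\<alpha>\<in>S'. smul (a \<alpha>) (z \<alpha> \<epsilon>))"
        unfolding sum.reindex[OF inj] o_def
      proof (rule sum.cong[OF refl])
        fix \<alpha> assume "\<alpha> \<in> S'"
        then have "mk J (tg \<alpha>) = \<alpha>" "z \<alpha> = zz J (tg \<alpha>)" using mktg by (auto simp: z_def S'_def)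
        then show "smul (a (mk J (tg \<alpha>))) (zz J (tg \<alpha>) \<epsilon>) = smul (a \<alpha>) (z \<alpha> \<epsilon>)" by simp
      qed
      then show "(\<Sum>\<gamma>\<in>tg ` S'. smul (a (mk J \<gamma>)) (zz J \<gamma> \<epsilon>)) \<in> bdr n \<epsilon> \<inter> effect J" using mem by simp
    qed (use S' mktg in auto)
    moreover have "\<beta> \<in> S'" using \<beta> by (simp add: S'_def J_def)
    ultimately show "a \<beta> = 0" using mktg[of \<beta>] by auto
  qed
qed

end

section \<open>The torus\<close>

context rips_product
begin

definition max_dist :: "'i set \<Rightarrow> ('i \<Rightarrow> 'p) \<Rightarrow> ('i \<Rightarrow> 'p) \<Rightarrow> real" where
  "max_dist I x y = (MAX L\<in>I. d L (x L) (y L))"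

text \<open>Base points in the other coordinates embed the projection to \<open>I\<close> in the
  whole product. Filling and restriction are then inverse to each other between its chains and the
  chains fixed by \<open>e L\<close> for all \<open>L\<close> in \<open>A - I\<close>.\<close>

definition fill :: "'i set \<Rightarrow> ('i \<Rightarrow> 'p) \<Rightarrow> 'i \<Rightarrow> 'p" where
  "fill I x = (\<lambda>L. if L \<in> I then x L else b L)"

lemma max_dist_less: "I \<subseteq> A \<Longrightarrow> I \<noteq> {} \<Longrightarrow> max_dist I x y < \<epsilon> \<longleftrightarrow> (\<forall>L\<in>I. d L (x L) (y L) < \<epsilon>)"
  using finite_subset[OF _ finite_A] by (simp add: max_dist_def)

lemma push_restrict_kchains:
  assumes I: "I \<subseteq> A" "I \<noteq> {}" and c: "c \<in> chn (Suc l) \<epsilon>"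
  shows "push (map (\<lambda>x. restrict x I)) c \<in> kchains (Suc l) (vietoris_rips (max_dist I) (PiE I X) \<epsilon>)"
  unfolding kchains_def
proof (intro CollectI ballI)
  fix t assume "t \<in> keys (push (map (\<lambda>x. restrict x I)) c)"
  then obtain s where s: "s \<in> keys c" "t = map (\<lambda>x. restrict x I) s" by (rule keys_pushE)
  have cl: "length s = Suc l" "clique \<epsilon> (set s)" using c s(1) by (auto simp: chn_def)
  have PiE: "restrict x I \<in> PiE I X" if "x \<in> set s" for x
  proof -
    have "x \<in> T" using cl(2) that by (auto simp: clique_def)
    then show ?thesis using I(1) by (auto simp: T_def dest: spec)
  qed
  have close: "max_dist I (restrict x I) (restrict y I) < \<epsilon>" if "x \<in> set s" "y \<in> set s" for x y
    using cl(2) that I by (auto simp: max_dist_less clique_def)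
  have img: "set t = (\<lambda>x. restrict x I) ` set s" by (simp add: s(2))
  have "set t \<subseteq> PiE I X" unfolding img using PiE by (rule image_subsetI)
  moreover have "\<forall>p\<in>set t. \<forall>q\<in>set t. max_dist I p q < \<epsilon>" unfolding img using close by blast
  moreover have "set t \<noteq> {}" using cl(1) s(2) by auto
  ultimately show "length t = Suc l \<and> set t \<in> vietoris_rips (max_dist I) (PiE I X) \<epsilon>"
    using cl(1) by (simp add: s(2) vietoris_rips_def)
qed

lemma push_fill_chn:
  assumes I: "I \<subseteq> A" "I \<noteq> {}" and c: "c \<in> kchains l (vietoris_rips (max_dist I) (PiE I X) \<epsilon>)"
  shows "push (map (fill I)) c \<in> chn l \<epsilon>"
  unfolding chn_def
proof (intro CollectI ballI)
  fix t assume "t \<in> keys (push (map (fill I)) c)"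
  then obtain s where s: "s \<in> keys c" "t = map (fill I) s" by (rule keys_pushE)
  have v: "length s = l" "set s \<in> vietoris_rips (max_dist I) (PiE I X) \<epsilon>" using c s(1) by (auto simp: kchains_def)
  have sub: "set s \<subseteq> PiE I X" and close: "\<And>x y L. x \<in> set s \<Longrightarrow> y \<in> set s \<Longrightarrow> L \<in> I \<Longrightarrow> d L (x L) (y L) < \<epsilon>"
    using v(2) I by (auto simp: vietoris_rips_def max_dist_less)
  \<comment> \<open>Filled points have distance 0 in the added coordinates, which is admissible
    because a nonempty simplex forces \<open>\<epsilon>\<close> to be positive.\<close>
  have "0 < \<epsilon>" if "x \<in> set s" for x using close[OF that that] I(2) by auto
  then have "d L (fill I x L) (fill I y L) < \<epsilon>" if "x \<in> set s" "y \<in> set s" for x y L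
    using close that by (auto simp: fill_def)
  moreover have "fill I x \<in> T" if "x \<in> set s" for x
    using sub that I(1) base by (auto simp: fill_def T_def PiE_iff)
  ultimately show "length t = l \<and> clique \<epsilon> (set t)" unfolding clique_def s(2) using v(1) by auto
qed

lemma e_push_fill: "L \<notin> I \<Longrightarrow> e L (push (map (fill I)) c) = push (map (fill I)) c"
  unfolding e_def push_push by (intro push_cong) (auto simp: upd_def fill_def)

lemma restrict_fill:
  assumes "c \<in> kchains l (vietoris_rips D (PiE I X) \<epsilon>)"
  shows "push (map (\<lambda>x. restrict x I)) (push (map (fill I)) c) = c"
  unfolding push_push
proof (rule push_id_on)
  fix s assume "s \<in> keys c"
  then have sub: "set s \<subseteq> PiE I X" using assms by (auto simp: kchains_def vietoris_rips_def)
  have "restrict (fill I x) I = x" if "x \<in> set s" for x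
  proof -
    have "x \<in> extensional I" using sub that by (auto simp: PiE_def)
    then show ?thesis by (auto simp: fill_def extensional_def fun_eq_iff)
  qed
  then show "map (\<lambda>x. restrict x I) (map (fill I) s) = s" by (simp add: map_idI)
qed

lemma fill_restrict:
  assumes c: "c \<in> chn l \<epsilon>" and fixed: "\<And>L. L \<in> A - I \<Longrightarrow> e L c = c"
  shows "push (map (fill I)) (push (map (\<lambda>x. restrict x I)) c) = c"
  unfolding push_push
proof (rule push_id_on)
  fix s assume s: "s \<in> keys c"
  have "fill I (restrict x I) = x" if x: "x \<in> set s" for x
  proof
    fix L
    have "x \<in> T" using c s x by (auto simp: chn_def clique_def)
    then have "L \<notin> A \<Longrightarrow> x L = b L" by (auto simp: T_def dest: spec[of _ L])
    moreover have "x L = b L" if "L \<in> A - I" using fixed_keys[OF fixed[OF that] s x] .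
    ultimately show "fill I (restrict x I) L = x L" by (cases "L \<in> A") (auto simp: fill_def)
  qed
  then show "map (fill I) (map (\<lambda>x. restrict x I) s) = s" by (simp add: map_idI)
qed

text \<open>Restriction and filling commute with the boundary. A cycle of the subproduct is filled,
  expanded in the whole product and restricted again; a relation in the subproduct is filled, which
  recovers the original representatives because their supports lie in \<open>I\<close>.\<close>

theorem subproduct_barcodes:
  assumes ne: "A \<noteq> {}" and n: "1 \<le> n"
  shows "\<exists>(Bar :: tagged_bar set) (supp :: tagged_bar \<Rightarrow> 'i set).
    (\<forall>\<beta>\<in>Bar. supp \<beta> \<subseteq> A \<and> supp \<beta> \<noteq> {} \<and> card (supp \<beta>) \<le> n) \<and>
    (\<forall>I. I \<subseteq> A \<and> I \<noteq> {} \<longrightarrow>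
       is_barcode TYPE('k::field) n (vietoris_rips (max_dist I) (PiE I X)) {\<beta>\<in>Bar. supp \<beta> \<subseteq> I})"
proof -
  obtain Bar :: "tagged_bar set" and supp :: "tagged_bar \<Rightarrow> 'i set"
    and z :: "tagged_bar \<Rightarrow> real \<Rightarrow> (('i \<Rightarrow> 'p) list \<Rightarrow>\<^sub>0 'k)" where
    bars: "\<forall>\<beta>\<in>Bar. ereal (fst (fst \<beta>)) < snd (fst \<beta>) \<and> supp \<beta> \<subseteq> A \<and> supp \<beta> \<noteq> {} \<and> card (supp \<beta>) \<le> n" and
    zc: "\<forall>\<beta>\<in>Bar. \<forall>\<epsilon>\<in>bar_set (fst \<beta>). z \<beta> \<epsilon> \<in> cyc n \<epsilon> \<inter> effect (supp \<beta>)" and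
    coh: "\<forall>\<beta>\<in>Bar. \<forall>\<epsilon>\<in>bar_set (fst \<beta>). \<forall>\<epsilon>'\<ge>\<epsilon>.
       z \<beta> \<epsilon> - (if \<epsilon>' \<in> bar_set (fst \<beta>) then z \<beta> \<epsilon>' else 0) \<in> bdr n \<epsilon>'" and
    sp: "\<forall>I\<subseteq>A. \<forall>\<epsilon>. \<forall>c\<in>cyc n \<epsilon>. (\<forall>L\<in>A - I. e L c = c) \<longrightarrow>
       c \<in> pm.span ((\<lambda>\<beta>. z \<beta> \<epsilon>) ` {\<beta>\<in>Bar. supp \<beta> \<subseteq> I \<and> \<epsilon> \<in> bar_set (fst \<beta>)} \<union> bdr n \<epsilon>)" and
    ind: "\<forall>\<epsilon> S a. finite S \<and> S \<subseteq> {\<beta>\<in>Bar. \<epsilon> \<in> bar_set (fst \<beta>)} \<and> (\<Sum>\<beta>\<in>S. smul (a \<beta>) (z \<beta> \<epsilon>)) \<in> bdr n \<epsilon> \<longrightarrow>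
       (\<forall>\<beta>\<in>S. a \<beta> = 0)"
    using product_barcode[OF ne, of n] by (elim exE conjE)
  have "is_barcode TYPE('k) n (vietoris_rips (max_dist I) (PiE I X)) {\<beta>\<in>Bar. supp \<beta> \<subseteq> I}"
    if I: "I \<subseteq> A" "I \<noteq> {}" for I
  proof -
    let ?K = "vietoris_rips (max_dist I) (PiE I X)"
    let ?\<rho> = "push (map (\<lambda>x. restrict x I)) :: (('i \<Rightarrow> 'p) list \<Rightarrow>\<^sub>0 'k) \<Rightarrow> _"
    let ?\<phi> = "push (map (fill I)) :: (('i \<Rightarrow> 'p) list \<Rightarrow>\<^sub>0 'k) \<Rightarrow> _"
    \<comment> \<open>A bounding chain may involve coordinates outside \<open>I\<close>; restriction
      is a chain map on these as well.\<close>
    have bdr_K: "?\<rho> x \<in> lin bd ` kchains (Suc (Suc n)) (?K \<epsilon>)" if x: "x \<in> bdr n \<epsilon>" for x \<epsilon>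
    proof -
      obtain y where y: "x = lin bd y" "y \<in> chn (Suc (Suc n)) \<epsilon>" using x unfolding bdr_def by (rule imageE)
      have "?\<rho> x = lin bd (?\<rho> y)" by (simp add: y(1) lin_bd_push)
      then show ?thesis using push_restrict_kchains[OF I y(2)] by (simp only: imageI)
    qed
    have push_sum: "push f (\<Sum>\<beta>\<in>S. smul (a \<beta>) (g \<beta>)) = (\<Sum>\<beta>\<in>S. smul (a \<beta>) (push f (g \<beta>)))"
      for f :: "('i \<Rightarrow> 'p) list \<Rightarrow> ('i \<Rightarrow> 'p) list" and S :: "tagged_bar set" and a :: "tagged_bar \<Rightarrow> 'k"
        and g :: "tagged_bar \<Rightarrow> ('i \<Rightarrow> 'p) list \<Rightarrow>\<^sub>0 'k"
      by (simp add: push_def lin.sum lin.scale)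
    have "interval_basis n ?K {\<beta>\<in>Bar. supp \<beta> \<subseteq> I} (\<lambda>\<beta> \<epsilon>. lookup (?\<rho> (z \<beta> \<epsilon>)))"
    proof (rule interval_basisI[OF n])
      fix \<beta> \<epsilon> assume \<beta>: "\<beta> \<in> {\<beta>\<in>Bar. supp \<beta> \<subseteq> I}" "\<epsilon> \<in> bar_set (fst \<beta>)"
      then have "z \<beta> \<epsilon> \<in> chn (Suc n) \<epsilon>" "lin bd (z \<beta> \<epsilon>) = 0" using zc by (auto simp: cyc_def)
      then show "?\<rho> (z \<beta> \<epsilon>) \<in> kchains (Suc n) (?K \<epsilon>) \<and> lin bd (?\<rho> (z \<beta> \<epsilon>)) = 0"
        using push_restrict_kchains[OF I] by (simp add: lin_bd_push)
      fix \<epsilon>' assume "\<epsilon> \<le> \<epsilon>'"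
      then have "z \<beta> \<epsilon> - (if \<epsilon>' \<in> bar_set (fst \<beta>) then z \<beta> \<epsilon>' else 0) \<in> bdr n \<epsilon>'" using coh \<beta> by blast
      from bdr_K[OF this]
      show "?\<rho> (z \<beta> \<epsilon>) - (if \<epsilon>' \<in> bar_set (fst \<beta>) then ?\<rho> (z \<beta> \<epsilon>') else 0) \<in>
          lin bd ` kchains (Suc (Suc n)) (?K \<epsilon>')"
        by (auto simp: push_diff split: if_splits)
    next
      fix \<epsilon> and c :: "('i \<Rightarrow> 'p) list \<Rightarrow>\<^sub>0 'k"
      assume c: "c \<in> kchains (Suc n) (?K \<epsilon>)" "lin bd c = 0"
      have "?\<phi> c \<in> cyc n \<epsilon>" using push_fill_chn[OF I c(1)] c(2) by (simp add: cyc_def lin_bd_push)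
      moreover have "\<forall>L\<in>A - I. e L (?\<phi> c) = ?\<phi> c" by (simp add: e_push_fill)
      ultimately have "?\<phi> c \<in> pm.span ((\<lambda>\<beta>. z \<beta> \<epsilon>) ` {\<beta>\<in>Bar. supp \<beta> \<subseteq> I \<and> \<epsilon> \<in> bar_set (fst \<beta>)} \<union> bdr n \<epsilon>)"
        using sp I(1) by blast
      from pm.span_coefficients[OF subspace_bdr this]
      obtain S a where S: "finite S" "S \<subseteq> {\<beta>\<in>Bar. supp \<beta> \<subseteq> I \<and> \<epsilon> \<in> bar_set (fst \<beta>)}"
        "?\<phi> c - (\<Sum>\<beta>\<in>S. smul (a \<beta>) (z \<beta> \<epsilon>)) \<in> bdr n \<epsilon>" by blast
      have "c - (\<Sum>\<beta>\<in>S. smul (a \<beta>) (?\<rho> (z \<beta> \<epsilon>))) \<in> lin bd ` kchains (Suc (Suc n)) (?K \<epsilon>)"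
        using bdr_K[OF S(3)] restrict_fill[OF c(1)] by (simp add: push_diff push_sum)
      then show "\<exists>S a. finite S \<and> S \<subseteq> {\<beta>\<in>{\<beta>\<in>Bar. supp \<beta> \<subseteq> I}. \<epsilon> \<in> bar_set (fst \<beta>)} \<and>
          c - (\<Sum>\<beta>\<in>S. smul (a \<beta>) (?\<rho> (z \<beta> \<epsilon>))) \<in> lin bd ` kchains (Suc (Suc n)) (?K \<epsilon>)"
        using S(1,2) by (intro exI[of _ S] exI[of _ a]) auto
    next
      fix \<epsilon> S and a :: "tagged_bar \<Rightarrow> 'k"
      assume S: "finite S" "S \<subseteq> {\<beta>\<in>{\<beta>\<in>Bar. supp \<beta> \<subseteq> I}. \<epsilon> \<in> bar_set (fst \<beta>)}"
        "(\<Sum>\<beta>\<in>S. smul (a \<beta>) (?\<rho> (z \<beta> \<epsilon>))) \<in> lin bd ` kchains (Suc (Suc n)) (?K \<epsilon>)"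
      have zfix: "?\<phi> (?\<rho> (z \<beta> \<epsilon>)) = z \<beta> \<epsilon>" if "\<beta> \<in> S" for \<beta>
      proof (rule fill_restrict)
        have "z \<beta> \<epsilon> \<in> cyc n \<epsilon> \<inter> effect (supp \<beta>)" "supp \<beta> \<subseteq> I" using zc S(2) that by auto
        then show "z \<beta> \<epsilon> \<in> chn (Suc n) \<epsilon>" "\<And>L. L \<in> A - I \<Longrightarrow> e L (z \<beta> \<epsilon>) = z \<beta> \<epsilon>"
          by (auto simp: cyc_def effect_def)
      qed
      obtain y where y: "(\<Sum>\<beta>\<in>S. smul (a \<beta>) (?\<rho> (z \<beta> \<epsilon>))) = lin bd y" "y \<in> kchains (Suc (Suc n)) (?K \<epsilon>)"
        using S(3) by (rule imageE)
      have "(\<Sum>\<beta>\<in>S. smul (a \<beta>) (z \<beta> \<epsilon>)) = ?\<phi> (\<Sum>\<beta>\<in>S. smul (a \<beta>) (?\<rho> (z \<beta> \<epsilon>)))"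
        unfolding push_sum by (intro sum.cong refl) (simp add: zfix)
      also have "\<dots> = lin bd (?\<phi> y)" by (simp add: y(1) lin_bd_push)
      finally have eq: "(\<Sum>\<beta>\<in>S. smul (a \<beta>) (z \<beta> \<epsilon>)) = lin bd (?\<phi> y)" .
      have "(\<Sum>\<beta>\<in>S. smul (a \<beta>) (z \<beta> \<epsilon>)) \<in> bdr n \<epsilon>"
        unfolding bdr_def eq by (rule imageI[OF push_fill_chn[OF I y(2)]])
      moreover have "S \<subseteq> {\<beta>\<in>Bar. \<epsilon> \<in> bar_set (fst \<beta>)}" using S(2) by auto
      ultimately show "\<forall>\<beta>\<in>S. a \<beta> = 0"
        by (intro mp[OF spec[OF spec[OF spec[OF ind]]]] conjI S(1))
    qed
    then show ?thesis using bars unfolding is_barcode_def by blast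
  qed
  then have "\<forall>I. I \<subseteq> A \<and> I \<noteq> {} \<longrightarrow>
      is_barcode TYPE('k) n (vietoris_rips (max_dist I) (PiE I X)) {\<beta>\<in>Bar. supp \<beta> \<subseteq> I}" by simp
  moreover have "\<forall>\<beta>\<in>Bar. supp \<beta> \<subseteq> A \<and> supp \<beta> \<noteq> {} \<and> card (supp \<beta>) \<le> n" using bars by simp
  ultimately show ?thesis by blast
qed

end

section \<open>Circles as Lipschitz curves\<close>

lemma Lipschitz_curve_totally_bounded:
  fixes \<gamma> :: "real \<Rightarrow> 'p" and \<delta> :: "'p \<Rightarrow> 'p \<Rightarrow> real"
  assumes K: "0 < K" and lip: "\<And>s t. \<delta> (\<gamma> s) (\<gamma> t) \<le> K * \<bar>s - t\<bar>" and "0 < \<epsilon>"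
  shows "\<exists>Y. finite Y \<and> Y \<subseteq> \<gamma> ` {a..b} \<and> (\<forall>x\<in>\<gamma> ` {a..b}. \<exists>y\<in>Y. \<delta> x y < \<epsilon>)"
proof -
  have "seq_compact {a..b}" using compact_Icc compact_imp_seq_compact by blast
  from seq_compact_imp_totally_bounded[OF this] obtain k where
    k: "finite k" "k \<subseteq> {a..b}" "{a..b} \<subseteq> (\<Union>x\<in>k. ball x (\<epsilon> / K))"
    using assms by (metis divide_pos_pos)
  have "\<exists>y\<in>\<gamma> ` k. \<delta> (\<gamma> s) y < \<epsilon>" if s: "s \<in> {a..b}" for s
  proof -
    obtain t where t: "t \<in> k" "dist t s < \<epsilon> / K" using k(3) s by force
    have "\<delta> (\<gamma> s) (\<gamma> t) \<le> K * dist t s" using lip[of s t] by (simp add: dist_real_def abs_minus_commute)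
    also have "\<dots> < \<epsilon>" using t(2) K by (simp add: pos_less_divide_eq mult.commute)
    finally show ?thesis using t(1) by blast
  qed
  then show ?thesis using k by (intro exI[of _ "\<gamma> ` k"]) auto
qed

lemma Lipschitz_curve_connected:
  fixes \<gamma> :: "real \<Rightarrow> 'p" and \<delta> :: "'p \<Rightarrow> 'p \<Rightarrow> real"
  assumes K: "0 < K" and lip: "\<And>s t. \<delta> (\<gamma> s) (\<gamma> t) \<le> K * \<bar>s - t\<bar>" and eps: "0 < \<epsilon>"
    and "s \<in> {a..b}" "t \<in> {a..b}"
  shows "(\<gamma> s, \<gamma> t) \<in> {(y, y'). y \<in> \<gamma> ` {a..b} \<and> y' \<in> \<gamma> ` {a..b} \<and> \<delta> y y' < \<epsilon>}\<^sup>*"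
    (is "_ \<in> ?R\<^sup>*")
proof -
  \<comment> \<open>Half of \<open>\<epsilon> / K\<close>, so that a parameter step of length at
    most \<open>h\<close> moves the point by strictly less than \<open>\<epsilon>\<close>.\<close>
  define h where "h = \<epsilon> / (2 * K)"
  have h: "0 < h" "K * h < \<epsilon>" using K eps by (auto simp: h_def)
  have step: "(\<gamma> s, \<gamma> t) \<in> ?R" if "s \<in> {a..b}" "t \<in> {a..b}" "\<bar>s - t\<bar> \<le> h" for s t
  proof -
    have "K * \<bar>s - t\<bar> \<le> K * h" using that(3) K by (intro mult_left_mono) auto
    then have "\<delta> (\<gamma> s) (\<gamma> t) < \<epsilon>" using lip[of s t] h(2) by linarith
    then show ?thesis using that by blast
  qed
  have "(\<gamma> s, \<gamma> t) \<in> ?R\<^sup>*" if "s \<in> {a..b}" "t \<in> {a..b}" "\<bar>s - t\<bar> \<le> real m * h" for s t m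
    using that
  proof (induction m arbitrary: s)
    case 0
    then show ?case by simp
  next
    case (Suc m)
    show ?case
    proof (cases "\<bar>s - t\<bar> \<le> h")
      case True
      then show ?thesis using step[OF Suc.prems(1,2)] by (meson r_into_rtrancl)
    next
      case False
      define s' where "s' = (if s < t then s + h else s - h)"
      have "s' \<in> {a..b}" "\<bar>s - s'\<bar> \<le> h" "\<bar>s' - t\<bar> \<le> real m * h"
        using False Suc.prems h(1) by (auto simp: s'_def algebra_simps abs_if split: if_splits)
      then show ?thesis
        using step[OF Suc.prems(1)] Suc.IH[OF _ Suc.prems(2)] by (meson converse_rtrancl_into_rtrancl)
    qed
  qed
  moreover obtain m where "\<bar>s - t\<bar> / h \<le> real m" using real_arch_simple by blast
  ultimately show ?thesis using assms(4,5) h(1) by (simp add: pos_divide_le_eq)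
qed

lemma circle_curve:
  assumes L: "1 \<le> L" "L \<le> N"
  shows "\<exists>\<gamma> K. 0 < K \<and> {y \<in> plane N L. L2_set y {..2*N} = radius f L} = \<gamma> ` {0..2*pi} \<and>
    (\<forall>s t. L2_set (\<lambda>j. \<gamma> s j - \<gamma> t j) {..2*N} \<le> K * \<bar>s - t\<bar>)"
proof -
  define r where "r = radius f L"
  have r: "0 \<le> r" by (simp add: r_def radius_def)
  define c where "c t = (r * cos t, r * sin t)" for t
  have "{x. action x = r\<^sup>2 / 2} = c ` {0..2*pi}"
  proof (intro equalityI subsetI)
    fix x assume "x \<in> {x. action x = r\<^sup>2 / 2}"
    then obtain q p where x: "x = (q, p)" "q\<^sup>2 + p\<^sup>2 = r\<^sup>2"
      by (cases x) (auto simp: action_def add.commute)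
    show "x \<in> c ` {0..2*pi}"
    proof (cases "r = 0")
      case True
      then have "x = c 0" using x by (simp add: c_def)
      then show ?thesis by (intro image_eqI[of _ _ 0]) auto
    next
      case False
      have "(q / r)\<^sup>2 + (p / r)\<^sup>2 = 1" using x(2) False by (simp add: power_divide add_divide_distrib[symmetric])
      then obtain t where t: "0 \<le> t" "t < 2 * pi" "q / r = cos t" "p / r = sin t"
        by (rule sincos_total_2pi)
      then have "x = c t" using False x(1) by (simp add: c_def field_simps)
      then show ?thesis using t by auto
    qed
  next
    fix x assume "x \<in> c ` {0..2*pi}"
    then obtain t where "x = c t" by blast
    moreover have "(r * sin t)\<^sup>2 + (r * cos t)\<^sup>2 = r\<^sup>2"
      by (simp add: power_mult_distrib distrib_left[symmetric])
    ultimately show "x \<in> {x. action x = r\<^sup>2 / 2}" by (simp add: action_def c_def)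
  qed
  then have img: "{y \<in> plane N L. L2_set y {..2*N} = radius f L} = (\<lambda>t. embed_plane N L (c t)) ` {0..2*pi}"
    using embed_circle[OF L, of f] by (simp add: r_def image_image)
  \<comment> \<open>Each coordinate contributes at most \<open>r * \<bar>s - t\<bar>\<close>; the
    summand 1 keeps the constant positive for a circle of radius 0.\<close>
  have "dist (c s) (c t) \<le> (2 * r + 1) * \<bar>s - t\<bar>" for s t
  proof -
    have half: "\<bar>sin ((s - t) / 2)\<bar> \<le> \<bar>s - t\<bar> / 2" "\<bar>sin ((t - s) / 2)\<bar> \<le> \<bar>s - t\<bar> / 2"
      using abs_sin_x_le_abs_x[of "(s - t) / 2"] abs_sin_x_le_abs_x[of "(t - s) / 2"]
      by (simp_all add: abs_minus_commute)
    have "\<bar>cos s - cos t\<bar> = 2 * (\<bar>sin ((s + t) / 2)\<bar> * \<bar>sin ((t - s) / 2)\<bar>)"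
      by (simp add: cos_diff_cos abs_mult)
    also have "\<dots> \<le> 2 * (1 * (\<bar>s - t\<bar> / 2))" using half by (intro mult_left_mono mult_mono) auto
    finally have 1: "\<bar>cos s - cos t\<bar> \<le> \<bar>s - t\<bar>" by simp
    have "\<bar>sin s - sin t\<bar> = 2 * (\<bar>sin ((s - t) / 2)\<bar> * \<bar>cos ((s + t) / 2)\<bar>)"
      by (simp add: sin_diff_sin abs_mult)
    also have "\<dots> \<le> 2 * ((\<bar>s - t\<bar> / 2) * 1)" using half by (intro mult_left_mono mult_mono) auto
    finally have 2: "\<bar>sin s - sin t\<bar> \<le> \<bar>s - t\<bar>" by simp
    have "dist (c s) (c t) \<le> \<bar>r * cos s - r * cos t\<bar> + \<bar>r * sin s - r * sin t\<bar>"
      unfolding c_def dist_Pair_Pair dist_real_def using sqrt_sum_squares_le_sum_abs by force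
    also have "\<dots> = r * (\<bar>cos s - cos t\<bar> + \<bar>sin s - sin t\<bar>)"
      using r by (simp add: right_diff_distrib[symmetric] abs_mult distrib_left)
    also have "\<dots> \<le> r * (\<bar>s - t\<bar> + \<bar>s - t\<bar>)" using 1 2 r by (intro mult_left_mono add_mono)
    also have "\<dots> \<le> (2 * r + 1) * \<bar>s - t\<bar>" by (simp add: algebra_simps)
    finally show ?thesis .
  qed
  then have "L2_set (\<lambda>j. embed_plane N L (c s) j - embed_plane N L (c t) j) {..2*N} \<le> (2 * r + 1) * \<bar>s - t\<bar>" for s t
    by (simp add: embed_plane_isometry[OF L])
  then show ?thesis using img r by (intro exI[of _ "\<lambda>t. embed_plane N L (c t)"] exI[of _ "2 * r + 1"]) auto
qed

theorem theorem3p19: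
  fixes f :: "real \<Rightarrow> real" and N n :: nat
  assumes "\<And>t. f (t + 2 * pi) = f t"
    and "1 \<le> N" and "1 \<le> n"
  shows "\<exists>(B :: tagged_bar set) (C :: nat set \<Rightarrow> tagged_bar set) (deg :: tagged_bar \<Rightarrow> nat \<Rightarrow> nat).
    is_barcode TYPE('k::field) n (vietoris_rips (plane_dist N {1..N}) (psi N f)) B \<and>
    (\<forall>I. I \<subseteq> {1..N} \<and> 1 \<le> card I \<and> card I \<le> n \<longrightarrow>
       is_barcode TYPE('k) n (vietoris_rips (plane_dist N I) (plane_proj I ` psi N f)) (C I) \<and>
       C I = {\<beta> \<in> B. {L \<in> {1..N}. 0 < deg \<beta> L} \<subseteq> I}) \<and>
    (\<forall>\<beta>\<in>B. \<exists>I. I \<subseteq> {1..N} \<and> 1 \<le> card I \<and> card I \<le> n \<and> \<beta> \<in> C I \<and>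
       (\<forall>L\<in>I. 0 < deg \<beta> L) \<and> (\<Sum>L\<in>I. deg \<beta> L) = n) \<and>
    B = (\<Union>k\<in>{1..n}. \<Union>I\<in>{I. I \<subseteq> {1..N} \<and> card I = k}. C I)"
proof -
  define X where "X L = {y \<in> plane N L. L2_set y {..2*N} = radius f L}" for L
  define d where "d L x y = L2_set (\<lambda>j. x j - y j) {..2*N}" for L :: nat and x y :: "nat \<Rightarrow> real"
  have curve: "\<exists>\<gamma> K. 0 < K \<and> X L = \<gamma> ` {0..2*pi} \<and> (\<forall>s t. d L (\<gamma> s) (\<gamma> t) \<le> K * \<bar>s - t\<bar>)" if "L \<in> {1..N}" for L
    using circle_curve[of L N f] that unfolding X_def d_def by simp
  define b where "b L = (SOME y. y \<in> X L)" for L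
  have bX: "b L \<in> X L" if L: "L \<in> {1..N}" for L
  proof -
    obtain \<gamma> :: "real \<Rightarrow> nat \<Rightarrow> real" where "X L = \<gamma> ` {0..2*pi}" using curve[OF L] by blast
    then have "\<gamma> 0 \<in> X L" by simp
    then show ?thesis unfolding b_def by (rule someI[of "\<lambda>y. y \<in> X L"])
  qed
  interpret rips_product "{1..N}" X d b
  proof
    show "d L x x = 0" for L x by (simp add: d_def L2_set_def)
    show "d L x y = d L y x" for L x y by (simp add: d_def L2_set_def power2_commute)
    show "d L x z \<le> d L x y + d L y z" for L x y z
    proof -
      have "L2_set (\<lambda>j. (x j - y j) + (y j - z j)) {..2*N} \<le> d L x y + d L y z"
        unfolding d_def by (rule L2_set_triangle_ineq)
      then show ?thesis by (simp add: d_def)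
    qed
    show "(x, y) \<in> {(y, y'). y \<in> X L \<and> y' \<in> X L \<and> d L y y' < \<epsilon>}\<^sup>*"
      if L: "L \<in> {1..N}" and \<epsilon>: "0 < \<epsilon>" and xy: "x \<in> X L" "y \<in> X L" for L \<epsilon> x y
    proof -
      obtain \<gamma> K where \<gamma>: "0 < K" "X L = \<gamma> ` {0..2*pi}" "\<And>s t. d L (\<gamma> s) (\<gamma> t) \<le> K * \<bar>s - t\<bar>"
        using curve[OF L] by blast
      obtain s t where st: "s \<in> {0..2*pi}" "x = \<gamma> s" "t \<in> {0..2*pi}" "y = \<gamma> t" using xy unfolding \<gamma>(2) by blast
      show ?thesis
        unfolding \<gamma>(2) st(2,4) by (rule Lipschitz_curve_connected[where \<delta> = "d L", OF \<gamma>(1,3) \<epsilon> st(1,3)])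
    qed
    show "\<exists>Y. finite Y \<and> Y \<subseteq> X L \<and> (\<forall>x\<in>X L. \<exists>y\<in>Y. d L x y < \<epsilon>)"
      if L: "L \<in> {1..N}" and \<epsilon>: "0 < \<epsilon>" for L \<epsilon>
    proof -
      obtain \<gamma> K where \<gamma>: "0 < K" "X L = \<gamma> ` {0..2*pi}" "\<And>s t. d L (\<gamma> s) (\<gamma> t) \<le> K * \<bar>s - t\<bar>"
        using curve[OF L] by blast
      show ?thesis unfolding \<gamma>(2) by (rule Lipschitz_curve_totally_bounded[where \<delta> = "d L", OF \<gamma>(1,3) \<epsilon>])
    qed
  qed (use bX in auto)
  have psi: "psi N f = PiE {1..N} X" unfolding psi_eq_circles X_def ..
  \<comment> \<open>A point of the smaller torus is completed by base points, which exist because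
    every circle is nonempty, even of radius 0.\<close>
  have proj_psi: "plane_proj I ` psi N f = PiE I X" if I: "I \<subseteq> {1..N}" for I
  proof (intro equalityI subsetI)
    fix y assume "y \<in> plane_proj I ` psi N f"
    then show "y \<in> PiE I X" using I by (auto simp: psi plane_proj_def)
  next
    fix y assume y: "y \<in> PiE I X"
    define x where "x = (\<lambda>L\<in>{1..N}. if L \<in> I then y L else b L)"
    have "x \<in> PiE {1..N} X" using y bX by (auto simp: x_def)
    moreover have "plane_proj I x = y"
    proof
      fix L show "plane_proj I x L = y L"
        using y I by (cases "L \<in> I") (auto simp: plane_proj_def x_def PiE_def extensional_def)
    qed
    ultimately show "y \<in> plane_proj I ` psi N f" unfolding psi by blast
  qed
  have pd: "plane_dist N I = max_dist I" for I
    by (simp add: fun_eq_iff plane_dist_def max_dist_def d_def)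
  have ne: "{1..N} \<noteq> {}" using assms(2) by simp
  obtain B :: "tagged_bar set" and supp :: "tagged_bar \<Rightarrow> nat set" where
    supp_all: "\<forall>\<beta>\<in>B. supp \<beta> \<subseteq> {1..N} \<and> supp \<beta> \<noteq> {} \<and> card (supp \<beta>) \<le> n" and
    barcode_all: "\<forall>I. I \<subseteq> {1..N} \<and> I \<noteq> {} \<longrightarrow>
       is_barcode TYPE('k) n (vietoris_rips (max_dist I) (PiE I X)) {\<beta>\<in>B. supp \<beta> \<subseteq> I}"
    using subproduct_barcodes[where 'k = 'k, OF ne assms(3)] by (elim exE conjE)
  note supp = bspec[OF supp_all]
  note barcode = mp[OF spec[OF barcode_all], OF conjI]
  \<comment> \<open>One way to write \<open>n\<close> as a sum of positive integers over the
    support: 1 everywhere except at the least coordinate, which takes the rest. The rest is positive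
    because the support has at most \<open>n\<close> elements.\<close>
  define deg where "deg \<beta> L = (if L \<in> supp \<beta> then if L = Min (supp \<beta>) then n - (card (supp \<beta>) - 1) else 1 else 0)"
    for \<beta> L
  have fin: "finite (supp \<beta>)" "1 \<le> card (supp \<beta>)" if "\<beta> \<in> B" for \<beta>
  proof -
    show "finite (supp \<beta>)" using supp[OF that] finite_subset by blast
    then show "1 \<le> card (supp \<beta>)" using supp[OF that] by (simp add: Suc_le_eq card_gt_0_iff)
  qed
  have deg_pos: "0 < deg \<beta> L \<longleftrightarrow> L \<in> supp \<beta>" if "\<beta> \<in> B" for \<beta> L
    using supp[OF that] fin[OF that] by (auto simp: deg_def)
  have deg_supp: "{L \<in> {1..N}. 0 < deg \<beta> L} = supp \<beta>" if "\<beta> \<in> B" for \<beta>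
    using deg_pos[OF that] supp[OF that] by blast
  have deg_sum: "(\<Sum>L\<in>supp \<beta>. deg \<beta> L) = n" if "\<beta> \<in> B" for \<beta>
  proof -
    have m: "Min (supp \<beta>) \<in> supp \<beta>" using fin[OF that] supp[OF that] by (intro Min_in) auto
    have "(\<Sum>L\<in>supp \<beta>. deg \<beta> L) = deg \<beta> (Min (supp \<beta>)) + (\<Sum>L\<in>supp \<beta> - {Min (supp \<beta>)}. deg \<beta> L)"
      using fin(1)[OF that] m by (rule sum.remove)
    also have "(\<Sum>L\<in>supp \<beta> - {Min (supp \<beta>)}. deg \<beta> L) = (\<Sum>L\<in>supp \<beta> - {Min (supp \<beta>)}. 1)"
      by (intro sum.cong) (auto simp: deg_def)
    also have "\<dots> = card (supp \<beta>) - 1" using m fin(1)[OF that] by simp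
    finally show ?thesis using m supp[OF that] fin(2)[OF that] by (simp add: deg_def)
  qed
  \<comment> \<open>The bars of a projection are selected among the tagged bars of the torus, so
    that a bar common to several \<open>C I\<close> counts once in the union.\<close>
  define C where "C I = {\<beta>\<in>B. supp \<beta> \<subseteq> I}" for I
  have C_deg: "C I = {\<beta> \<in> B. {L \<in> {1..N}. 0 < deg \<beta> L} \<subseteq> I}" for I
    unfolding C_def using deg_supp by blast
  have "{\<beta>\<in>B. supp \<beta> \<subseteq> {1..N}} = B" using supp by blast
  then have whole: "is_barcode TYPE('k) n (vietoris_rips (plane_dist N {1..N}) (psi N f)) B"
    using barcode[of "{1..N}"] ne by (simp add: pd psi)
  have sub: "is_barcode TYPE('k) n (vietoris_rips (plane_dist N I) (plane_proj I ` psi N f)) (C I)"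
    if "I \<subseteq> {1..N}" "1 \<le> card I" for I
  proof -
    have "I \<noteq> {}" using that(2) by auto
    then show ?thesis using barcode[OF that(1)] unfolding pd proj_psi[OF that(1)] C_def by simp
  qed
  have own: "\<exists>I. I \<subseteq> {1..N} \<and> 1 \<le> card I \<and> card I \<le> n \<and> \<beta> \<in> C I \<and>
       (\<forall>L\<in>I. 0 < deg \<beta> L) \<and> (\<Sum>L\<in>I. deg \<beta> L) = n" if "\<beta> \<in> B" for \<beta>
    using supp[OF that] fin[OF that] deg_pos[OF that] deg_sum[OF that] that
    by (intro exI[of _ "supp \<beta>"]) (simp add: C_def)
  have union: "B = (\<Union>k\<in>{1..n}. \<Union>I\<in>{I. I \<subseteq> {1..N} \<and> card I = k}. C I)"
  proof (intro equalityI subsetI)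
    fix \<beta> assume \<beta>: "\<beta> \<in> B"
    then have "\<beta> \<in> C (supp \<beta>)" "card (supp \<beta>) \<in> {1..n}" "supp \<beta> \<subseteq> {1..N}"
      using supp[OF \<beta>] fin[OF \<beta>] by (auto simp: C_def)
    then show "\<beta> \<in> (\<Union>k\<in>{1..n}. \<Union>I\<in>{I. I \<subseteq> {1..N} \<and> card I = k}. C I)" by blast
  qed (auto simp: C_def)
  show ?thesis
  proof (intro exI[of _ B] exI[of _ C] exI[of _ deg] conjI allI impI ballI)
    fix I assume "I \<subseteq> {1..N} \<and> 1 \<le> card I \<and> card I \<le> n"
    then show "is_barcode TYPE('k) n (vietoris_rips (plane_dist N I) (plane_proj I ` psi N f)) (C I)"
      by (intro sub) auto
  qed (rule whole C_deg own union; assumption?)+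
qed

end
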